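(* Let $M$ be a finitely generated module over $A:=\mathbb{Z}[t_1^{\pm 1},\dots,t_n^{\pm 1}]$. Suppose that for every $1\leq i\leq n$ there exist a nonzero integer $d_i$, a sequence of integers $(r_{i,j})_j$ satisfying $r_{i,j}\to\infty$ as $j\to\infty$, and $A$-module automorphisms $w_{i,j}:M\to M$ such that $w_{i,j}^{r_{i,j}}$ coincides with multiplication by $t_i^{d_i}$. Then $M$ is finitely generated as a $\mathbb{Z}$-module.
   Context: $\mathbb{Z}[t_1^{\pm 1},\dots,t_n^{\pm 1}]$ denotes the ring of Laurent polynomials in $n$ variables with integer coefficients. *)

theory Defs
  imports
    Complex_Main
    "HOL-Library.Poly_Mapping"
    "HOL-Algebra.IntRing"
    "HOL-Algebra.Bij"
    "HOL-Algebra.Module"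
begin

section \<open>Laurent polynomials\<close>

text \<open>
  A Laurent polynomial over the integers is a finitely supported function from exponent vectors
  to coefficients; exponent vectors are finitely supported functions from variable indices to
  integers, and the multiplication of \<^theory>\<open>HOL-Library.Poly_Mapping\<close> is convolution.
  This type has a variable \<open>t\<^sub>i\<close> for every natural number \<open>i\<close>; the ring in \<open>n\<close> variables consists of
  those elements in which only \<open>t\<^sub>1, \<dots>, t\<^sub>n\<close> occur.
\<close>

type_synonym laurent = "(nat \<Rightarrow>\<^sub>0 int) \<Rightarrow>\<^sub>0 int"

definition laurent_ring :: "nat \<Rightarrow> laurent ring"
  where "laurent_ring n =
    \<lparr>carrier = {p. \<forall>e \<in> Poly_Mapping.keys p. Poly_Mapping.keys e \<subseteq> {1..n}},
     mult = (*), one = 1, zero = 0, add = (+)\<rparr>"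

definition laurent_var :: "nat \<Rightarrow> laurent"
  where "laurent_var i = Poly_Mapping.single (Poly_Mapping.single i 1) 1"

lemma cring_laurent_ring: "cring (laurent_ring n)"
proof -
  have add: "p + q \<in> carrier (laurent_ring n)"
    if "p \<in> carrier (laurent_ring n)" "q \<in> carrier (laurent_ring n)" for p q
    using that Poly_Mapping.keys_add[of p q] by (fastforce simp: laurent_ring_def)
  have mult: "p * q \<in> carrier (laurent_ring n)"
    if p: "p \<in> carrier (laurent_ring n)" and q: "q \<in> carrier (laurent_ring n)" for p q
  proof -
    have "Poly_Mapping.keys e \<subseteq> {1..n}" if e: "e \<in> Poly_Mapping.keys (p * q)" for e
    proof -
      obtain a b where "e = a + b" "a \<in> Poly_Mapping.keys p" "b \<in> Poly_Mapping.keys q"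
        using e keys_mult[of p q] by blast
      then show ?thesis
        using p q Poly_Mapping.keys_add[of a b] by (fastforce simp: laurent_ring_def)
    qed
    then show ?thesis by (simp add: laurent_ring_def)
  qed
  have minus: "- p \<in> carrier (laurent_ring n)" if "p \<in> carrier (laurent_ring n)" for p
    using that by (auto simp: laurent_ring_def in_keys_iff)
  have one: "1 \<in> carrier (laurent_ring n)" and zero: "0 \<in> carrier (laurent_ring n)"
    by (simp_all add: laurent_ring_def)
  have ops: "p \<oplus>\<^bsub>laurent_ring n\<^esub> q = p + q" "p \<otimes>\<^bsub>laurent_ring n\<^esub> q = p * q"
    "\<zero>\<^bsub>laurent_ring n\<^esub> = 0" "\<one>\<^bsub>laurent_ring n\<^esub> = 1" for p q
    by (simp_all add: laurent_ring_def)
  show ?thesis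
  proof (rule cringI)
    show "abelian_group (laurent_ring n)"
    proof (rule abelian_groupI)
      fix p assume "p \<in> carrier (laurent_ring n)"
      then show "\<exists>q \<in> carrier (laurent_ring n).
          q \<oplus>\<^bsub>laurent_ring n\<^esub> p = \<zero>\<^bsub>laurent_ring n\<^esub>"
        using minus by (intro bexI[where x = "- p"]) (simp_all add: ops)
    qed (simp_all add: ops add zero add.assoc add.commute)
    show "Group.comm_monoid (laurent_ring n)"
      by (rule monoid.monoid_comm_monoidI, rule monoidI)
        (simp_all add: ops mult one mult.assoc mult.commute)
  qed (simp add: ops distrib_right)
qed

text \<open>The variables are units of \<open>laurent_ring n\<close>, and their integer powers are the expected ones.\<close>

lemma laurent_var_int_pow:
  assumes "i \<in> {1..n}"
  shows "laurent_var i [^]\<^bsub>laurent_ring n\<^esub> (d::int)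
    = Poly_Mapping.single (Poly_Mapping.single i d) 1"
proof -
  let ?m = "\<lambda>d::int. Poly_Mapping.single (Poly_Mapping.single i d) (1::int)"
  interpret cring "laurent_ring n" by (rule cring_laurent_ring)
  have mm: "?m a \<otimes>\<^bsub>laurent_ring n\<^esub> ?m b = ?m (a + b)" for a b
    by (simp add: laurent_ring_def mult_single single_add)
  have m0: "?m 0 = \<one>\<^bsub>laurent_ring n\<^esub>" by (simp add: laurent_ring_def)
  have mc: "?m a \<in> carrier (laurent_ring n)" for a
    using assms by (simp add: laurent_ring_def)
  have p: "laurent_var i [^]\<^bsub>laurent_ring n\<^esub> k = ?m (int k)" for k :: nat
  proof (induction k)
    case 0
    show ?case using m0 by simp
  next
    case (Suc k)
    then show ?case using mm[of "int k" 1] by (simp add: laurent_var_def add.commute)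
  qed
  have inv: "inv\<^bsub>laurent_ring n\<^esub> (?m a) = ?m (- a)" for a
    by (rule comm_inv_char) (simp_all only: mc mm m0 add.right_inverse)
  show ?thesis
    by (cases "d < 0") (simp_all add: int_pow_def2 p inv)
qed


section \<open>Modules\<close>

definition fin_gen_module :: "('r, 'a) ring_scheme \<Rightarrow> ('r, 'm, 'b) module_scheme \<Rightarrow> bool"
  where "fin_gen_module R M \<longleftrightarrow>
    (\<exists>S. finite S \<and> S \<subseteq> carrier M \<and>
      (\<forall>x \<in> carrier M. \<exists>c \<in> S \<rightarrow> carrier R. x = (\<Oplus>\<^bsub>M\<^esub>s\<in>S. c s \<odot>\<^bsub>M\<^esub> s)))"

text \<open>
  The underlying abelian group of \<open>M\<close> as a module over the integers. The fields \<^const>\<open>mult\<close> and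
  \<^const>\<open>one\<close> are present in every module record but play no role in the module structure.
\<close>

definition int_module :: "('m, 'a) ring_scheme \<Rightarrow> (int, 'm) module"
  where "int_module M =
    \<lparr>carrier = carrier M, mult = mult M, one = one M, zero = zero M, add = add M,
     smult = (\<lambda>k x. [k] \<cdot>\<^bsub>M\<^esub> x)\<rparr>"

lemma module_int_module:
  assumes "abelian_group M"
  shows "Module.module int_ring (int_module M)"
proof -
  interpret abelian_group M by fact
  have "abelian_group (int_module M)"
    by (rule abelian_groupI)
      (auto simp: int_module_def a_assoc intro: a_comm bexI[where x = "\<ominus>\<^bsub>M\<^esub> x" for x] l_neg)
  then show ?thesis
    by (intro moduleI int_is_cring)
      (simp_all add: int_module_def add.int_pow_mult add.int_pow_distrib add.int_pow_pow mult.commute)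
qed

text \<open>
  As with \<^const>\<open>auto\<close> and \<^const>\<open>AutoGroup\<close> for groups, automorphisms are represented by functions
  that are extensional on the carrier.
\<close>

definition module_auto :: "('r, 'a) ring_scheme \<Rightarrow> ('r, 'm, 'b) module_scheme \<Rightarrow> ('m \<Rightarrow> 'm) set"
  where "module_auto R M = {w \<in> Bij (carrier M).
    (\<forall>x \<in> carrier M. \<forall>y \<in> carrier M. w (x \<oplus>\<^bsub>M\<^esub> y) = w x \<oplus>\<^bsub>M\<^esub> w y) \<and>
    (\<forall>a \<in> carrier R. \<forall>x \<in> carrier M. w (a \<odot>\<^bsub>M\<^esub> x) = a \<odot>\<^bsub>M\<^esub> w x)}"

definition ModuleAutoGroup ::
    "('r, 'a) ring_scheme \<Rightarrow> ('r, 'm, 'b) module_scheme \<Rightarrow> ('m \<Rightarrow> 'm) monoid"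
  where "ModuleAutoGroup R M = BijGroup (carrier M) \<lparr>carrier := module_auto R M\<rparr>"

lemma group_ModuleAutoGroup:
  assumes "Module.module R M"
  shows "group (ModuleAutoGroup R M)"
proof -
  interpret Module.module R M by fact
  have "subgroup (module_auto R M) (BijGroup (carrier M))"
  proof (rule subgroup.intro)
    show "module_auto R M \<subseteq> carrier (BijGroup (carrier M))"
      by (auto simp: module_auto_def BijGroup_def)
  next
    fix v w
    assume v: "v \<in> module_auto R M" and w: "w \<in> module_auto R M"
    then have [simp]: "x \<in> carrier M \<Longrightarrow> w x \<in> carrier M" for x
      using Bij_imp_funcset by (fastforce simp: module_auto_def)
    show "v \<otimes>\<^bsub>BijGroup (carrier M)\<^esub> w \<in> module_auto R M"
    proof -
      have "v \<in> Bij (carrier M)" "w \<in> Bij (carrier M)"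
        using v w by (simp_all add: module_auto_def)
      moreover from this have "compose (carrier M) v w \<in> module_auto R M"
        using v w by (simp add: module_auto_def compose_Bij compose_eq)
      ultimately show ?thesis by (simp add: BijGroup_def)
    qed
  next
    show "\<one>\<^bsub>BijGroup (carrier M)\<^esub> \<in> module_auto R M"
      by (simp add: module_auto_def BijGroup_def id_Bij)
  next
    fix w
    assume w: "w \<in> module_auto R M"
    then have b: "w \<in> Bij (carrier M)" by (simp add: module_auto_def)
    let ?v = "inv_into (carrier M) w"
    have vc: "?v x \<in> carrier M" if "x \<in> carrier M" for x
      using Bij_inv_into_mem[OF b that] .
    have add: "?v (x \<oplus>\<^bsub>M\<^esub> y) = ?v x \<oplus>\<^bsub>M\<^esub> ?v y" if "x \<in> carrier M" "y \<in> carrier M" for x y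
      by (rule Bij_inv_into_lemma[where g = "add M"]) (use w b that in \<open>auto simp: module_auto_def\<close>)
    have smult: "?v (a \<odot>\<^bsub>M\<^esub> x) = a \<odot>\<^bsub>M\<^esub> ?v x" if "a \<in> carrier R" "x \<in> carrier M" for a x
    proof -
      have "w (a \<odot>\<^bsub>M\<^esub> ?v x) = a \<odot>\<^bsub>M\<^esub> w (?v x)"
        using w that vc by (simp add: module_auto_def)
      also have "w (?v x) = x"
        using b that by (auto simp: Bij_def bij_betw_def f_inv_into_f)
      finally show ?thesis
        using b that vc by (metis Bij_def IntD2 bij_betw_def inv_into_f_f mem_Collect_eq smult_closed)
    qed
    show "inv\<^bsub>BijGroup (carrier M)\<^esub> w \<in> module_auto R M"
      using add smult by (simp add: inv_BijGroup[OF b] module_auto_def restrict_inv_into_Bij[OF b])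
  qed
  then show ?thesis
    by (simp add: ModuleAutoGroup_def subgroup.subgroup_is_group group_BijGroup)
qed

end

theory Submission
  imports Defs "HOL-Computational_Algebra.Polynomial" "HOL-Library.Function_Algebras"
begin

text \<open>
Fix \<open>i\<close> and a sign, and let \<open>t\<close> be \<open>t\<^sub>i\<close> or \<open>t\<^sub>i\<^sup>-\<^sup>1\<close>, with inverse \<open>u\<close>. The heart of the matter is that \<open>t\<close> acts
on \<open>M\<close> as an integral element over \<open>\<int>\<close>, that is, some \<open>1 + u h\<close> with \<open>h \<in> \<int>[u]\<close> annihilates \<open>M\<close>
(\<open>unbounded_roots_integral\<close>). Given this for both signs, a polynomial in \<open>t\<^sub>i\<close> with integer
coefficients and both extreme coefficients equal to 1 annihilates \<open>M\<close> (\<open>bimonic_combination\<close>), and all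
powers of \<open>t\<^sub>i\<close> reduce to finitely many (\<open>gspan_eliminate_unit\<close>). Doing this for each variable leaves
finitely many generators over \<open>\<int>\<close>.

Suppose that no \<open>1 + u h\<close> annihilates \<open>M\<close>. Then there is a prime ideal \<open>P\<close> of \<open>A\<close> that contains no such
element, and a nonzero quotient \<open>V\<close> of \<open>M\<close> that is torsion-free over \<open>A / P\<close> and on which every
automorphism of \<open>M\<close> acts (\<open>exists_prime_torsion_free_quotient\<close>). Choose variables \<open>Y\<close> that form a
transcendence basis of \<open>A / P\<close> relative to \<open>t\<close>. If \<open>t\<close> is transcendental modulo \<open>P\<close>, then \<open>V\<close> has finite
rank over the image of \<open>\<int>[Y\<^sup>\<plusminus>\<^sup>1, t\<^sup>\<plusminus>\<^sup>1]\<close> in \<open>A / P\<close>, and the order in \<open>u\<close> is a discrete valuation that is not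
nonnegative at \<open>t\<close>. If \<open>t\<close> is algebraic, then \<open>V\<close> has finite rank over \<open>\<int>[Y\<^sup>\<plusminus>\<^sup>1]\<close>; as \<open>t\<close> is not integral, a
prime number \<open>p\<close> divides the leading coefficients of all integer relations for \<open>t\<close>, and the \<open>p\<close>-adic
valuation plays the same part.

An automorphism of \<open>M\<close>, or its inverse, gives an endomorphism \<open>z\<close> of \<open>V\<close> with \<open>z\<^sup>r = u\<^sup>d\<close>. For a nonzero
vector \<open>x\<close> the vectors \<open>x, z x, \<dots>, z\<^sup>m x\<close> are linearly dependent, where the rank \<open>m\<close> does not depend
on \<open>z\<close> (\<open>dependent_of_card\<close>). On the one hand the slopes of the Newton polygon of such a relation
have denominator at most \<open>m\<close>; on the other hand they include a nonzero one that is \<open>d / r\<close> times a slope of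
\<open>u\<close>. For large \<open>r\<close> this is impossible. The argument with slopes is carried out in \<open>root_relation_integrality\<close> without
extending valuations, by adjoining the quotient of the uniformizer by \<open>z\<^sup>m\<^sup>+\<^sup>1\<close>, which is integral for large \<open>r\<close>.
\<close>

section \<open>Subsets of commutative rings\<close>

text \<open>
Subrings and ideals are plain sets of elements of a type of class \<open>comm_ring_1\<close>. All work with
residue rings and fraction fields takes place in the ambient ring: equality becomes congruence
modulo an ideal, and a denominator becomes an explicit factor on the other side.
\<close>

definition unital_subring :: "'a::comm_ring_1 set \<Rightarrow> bool"
  where "unital_subring B \<longleftrightarrow> 1 \<in> B \<and> (\<forall>x\<in>B. \<forall>y\<in>B. x - y \<in> B \<and> x * y \<in> B)"

lemma subring_closed:
  assumes "unital_subring B"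
  shows "1 \<in> B" "0 \<in> B" "x \<in> B \<Longrightarrow> y \<in> B \<Longrightarrow> x + y \<in> B" "x \<in> B \<Longrightarrow> y \<in> B \<Longrightarrow> x - y \<in> B"
    "x \<in> B \<Longrightarrow> y \<in> B \<Longrightarrow> x * y \<in> B" "x \<in> B \<Longrightarrow> - x \<in> B" "x \<in> B \<Longrightarrow> x ^ k \<in> B"
proof -
  show 1: "1 \<in> B" and diff: "x \<in> B \<Longrightarrow> y \<in> B \<Longrightarrow> x - y \<in> B"
    and mult: "x \<in> B \<Longrightarrow> y \<in> B \<Longrightarrow> x * y \<in> B" for x y
    using assms by (auto simp: unital_subring_def)
  show 0: "0 \<in> B" using diff[OF 1 1] by simp
  show neg: "x \<in> B \<Longrightarrow> - x \<in> B" for x using diff[OF 0] by fastforce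
  show "x \<in> B \<Longrightarrow> y \<in> B \<Longrightarrow> x + y \<in> B" using diff[of x "- y"] neg[of y] by simp
  show "x \<in> B \<Longrightarrow> x ^ k \<in> B" by (induction k) (simp_all add: 1 mult)
qed

lemma subring_sum:
  assumes "unital_subring B" "\<And>i. i \<in> I \<Longrightarrow> f i \<in> B"
  shows "sum f I \<in> B"
  using assms(2) by (induction I rule: infinite_finite_induct)
    (simp_all add: subring_closed[OF assms(1)])

definition mult_closed :: "'a::comm_ring_1 set \<Rightarrow> bool"
  where "mult_closed S \<longleftrightarrow> 1 \<in> S \<and> (\<forall>x\<in>S. \<forall>y\<in>S. x * y \<in> S)"

definition ideal_set :: "'a::comm_ring_1 set \<Rightarrow> bool"
  where "ideal_set J \<longleftrightarrow> 0 \<in> J \<and> (\<forall>x\<in>J. \<forall>y\<in>J. x + y \<in> J) \<and> (\<forall>c. \<forall>x\<in>J. c * x \<in> J)"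

definition prime_ideal_set :: "'a::comm_ring_1 set \<Rightarrow> bool"
  where "prime_ideal_set P \<longleftrightarrow> ideal_set P \<and> 1 \<notin> P \<and> (\<forall>a b. a * b \<in> P \<longrightarrow> a \<in> P \<or> b \<in> P)"

lemma ideal_closed:
  assumes "ideal_set J"
  shows "0 \<in> J" "x \<in> J \<Longrightarrow> y \<in> J \<Longrightarrow> x + y \<in> J" "x \<in> J \<Longrightarrow> y \<in> J \<Longrightarrow> x - y \<in> J"
    "x \<in> J \<Longrightarrow> c * x \<in> J" "x \<in> J \<Longrightarrow> x * c \<in> J" "x \<in> J \<Longrightarrow> - x \<in> J"
proof -
  show 0: "0 \<in> J" and add: "x \<in> J \<Longrightarrow> y \<in> J \<Longrightarrow> x + y \<in> J"
    and mult: "x \<in> J \<Longrightarrow> c * x \<in> J" for x y c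
    using assms by (auto simp: ideal_set_def)
  show "x \<in> J \<Longrightarrow> x * c \<in> J" using mult[of x c] by (simp add: mult.commute)
  show neg: "x \<in> J \<Longrightarrow> - x \<in> J" for x using mult[of x "-1"] by simp
  show "x \<in> J \<Longrightarrow> y \<in> J \<Longrightarrow> x - y \<in> J" using add[of x "- y"] neg[of y] by simp
qed

lemma ideal_sum:
  assumes "ideal_set J" "\<And>i. i \<in> I \<Longrightarrow> f i \<in> J"
  shows "sum f I \<in> J"
  using assms(2) by (induction I rule: infinite_finite_induct)
    (simp_all add: ideal_closed[OF assms(1)])

lemma prime_idealD:
  assumes "prime_ideal_set P"
  shows "ideal_set P" "1 \<notin> P" "a * b \<in> P \<Longrightarrow> a \<in> P \<or> b \<in> P" "a ^ k \<in> P \<Longrightarrow> a \<in> P"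
proof -
  show "ideal_set P" "1 \<notin> P" and *: "a * b \<in> P \<Longrightarrow> a \<in> P \<or> b \<in> P" for a b
    using assms by (auto simp: prime_ideal_set_def)
  show "a ^ k \<in> P \<Longrightarrow> a \<in> P" by (induction k) (use * \<open>1 \<notin> P\<close> in auto)
qed

lemma mult_closed_compl_prime:
  assumes "prime_ideal_set P" "unital_subring B"
  shows "mult_closed (B - P)"
  using prime_idealD[OF assms(1)] subring_closed[OF assms(2)]
  by (auto simp: mult_closed_def)

section \<open>Spans over a subring, up to denominators\<close>

locale scalar_module = Modules.module scale
  for scale :: "'a::comm_ring_1 \<Rightarrow> 'b::ab_group_add \<Rightarrow> 'b" (infixr \<open>*s\<close> 75)
begin

definition bspan :: "'a set \<Rightarrow> 'b set \<Rightarrow> 'b set"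
  where "bspan B X = {\<Sum>x\<in>X. c x *s x | c. \<forall>x\<in>X. c x \<in> B}"

lemma bspan_insert:
  fixes X :: "'b set"
  assumes "finite X" "x \<notin> X"
  shows "v \<in> bspan B (insert x X) \<longleftrightarrow> (\<exists>b\<in>B. \<exists>u\<in>bspan B X. v = b *s x + u)"
proof
  assume "v \<in> bspan B (insert x X)"
  then obtain c where "\<forall>y\<in>insert x X. c y \<in> B" "v = (\<Sum>y\<in>insert x X. c y *s y)"
    by (auto simp: bspan_def)
  then show "\<exists>b\<in>B. \<exists>u\<in>bspan B X. v = b *s x + u"
    using assms by (intro bexI[of _ "c x"] bexI[of _ "\<Sum>y\<in>X. c y *s y"]) (auto simp: bspan_def)
next
  assume "\<exists>b\<in>B. \<exists>u\<in>bspan B X. v = b *s x + u"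
  then obtain b c where b: "b \<in> B" and c: "\<forall>y\<in>X. c y \<in> B" "v = b *s x + (\<Sum>y\<in>X. c y *s y)"
    by (auto simp: bspan_def)
  have "(\<Sum>y\<in>X. (c(x := b)) y *s y) = (\<Sum>y\<in>X. c y *s y)"
    by (rule sum.cong) (use assms in auto)
  then have "v = (\<Sum>y\<in>insert x X. (c(x := b)) y *s y)"
    using assms c(2) by simp
  then show "v \<in> bspan B (insert x X)"
    unfolding bspan_def using b c(1) by (auto intro!: exI[of _ "c(x := b)"])
qed

lemma bspan_empty [simp]: "bspan B {} = {0}"
  by (simp add: bspan_def)

lemma bspan_closed:
  assumes B: "unital_subring B"
  shows bspan_0: "0 \<in> bspan B X"
    and bspan_add: "u \<in> bspan B X \<Longrightarrow> v \<in> bspan B X \<Longrightarrow> u + v \<in> bspan B X"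
    and bspan_scale: "b \<in> B \<Longrightarrow> u \<in> bspan B X \<Longrightarrow> b *s u \<in> bspan B X"
    and bspan_diff: "u \<in> bspan B X \<Longrightarrow> v \<in> bspan B X \<Longrightarrow> u - v \<in> bspan B X"
    and bspan_base: "finite X \<Longrightarrow> x \<in> X \<Longrightarrow> x \<in> bspan B X"
proof -
  note [simp] = subring_closed[OF B]
  show "0 \<in> bspan B X" by (auto simp: bspan_def intro!: exI[of _ "\<lambda>_. 0"])
  show add: "u \<in> bspan B X \<Longrightarrow> v \<in> bspan B X \<Longrightarrow> u + v \<in> bspan B X" for u v
    unfolding bspan_def
    by clarify (rule_tac x="\<lambda>x. c x + ca x" in exI, simp add: scale_left_distrib sum.distrib)
  show scale: "b \<in> B \<Longrightarrow> u \<in> bspan B X \<Longrightarrow> b *s u \<in> bspan B X" for b u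
    unfolding bspan_def
    by clarify (rule_tac x="\<lambda>x. b * c x" in exI, simp add: scale_sum_right)
  have neg: "u \<in> bspan B X \<Longrightarrow> - u \<in> bspan B X" for u using scale[of "-1" u] by simp
  show "u \<in> bspan B X \<Longrightarrow> v \<in> bspan B X \<Longrightarrow> u - v \<in> bspan B X"
    using add[of u "- v"] neg[of v] by simp
  show "x \<in> bspan B X" if "finite X" "x \<in> X"
    unfolding bspan_def
    using that by (auto intro!: exI[of _ "\<lambda>y. if y = x then 1 else 0"] simp: if_distrib[of "\<lambda>c. c *s _"] cong: if_cong)
qed

lemma bspan_sum:
  assumes "unital_subring B" "\<And>i. i \<in> I \<Longrightarrow> f i \<in> bspan B X"
  shows "sum f I \<in> bspan B X"
  using assms(2) by (induction I rule: infinite_finite_induct)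
    (simp_all add: bspan_closed[OF assms(1)])

text \<open>
With \<open>S = B - P\<close> for a prime ideal \<open>P\<close> these are the vectors whose class modulo \<open>N\<close> lies in the
span of \<open>X\<close> over the fraction field of the image of \<open>B\<close> modulo \<open>P\<close>.
\<close>

definition gspan :: "'a set \<Rightarrow> 'a set \<Rightarrow> 'b set \<Rightarrow> 'b set \<Rightarrow> 'b set"
  where "gspan B S N X = {v. \<exists>s\<in>S. \<exists>u\<in>bspan B X. s *s v - u \<in> N}"

lemma gspan_closed:
  fixes N X :: "'b set"
  assumes B: "unital_subring B" and S: "mult_closed S" "S \<subseteq> B" and N: "subspace N"
  shows gspan_bspan: "u \<in> bspan B X \<Longrightarrow> u \<in> gspan B S N X"
    and gspan_N: "u \<in> N \<Longrightarrow> u \<in> gspan B S N X"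
    and gspan_add: "u \<in> gspan B S N X \<Longrightarrow> v \<in> gspan B S N X \<Longrightarrow> u + v \<in> gspan B S N X"
    and gspan_scale: "b \<in> B \<Longrightarrow> u \<in> gspan B S N X \<Longrightarrow> b *s u \<in> gspan B S N X"
    and gspan_cancel: "s \<in> S \<Longrightarrow> s *s u \<in> gspan B S N X \<Longrightarrow> u \<in> gspan B S N X"
    and gspan_cong: "u - v \<in> N \<Longrightarrow> u \<in> gspan B S N X \<Longrightarrow> v \<in> gspan B S N X"
proof -
  have S1: "1 \<in> S" and SS: "\<And>x y. x \<in> S \<Longrightarrow> y \<in> S \<Longrightarrow> x * y \<in> S"
    using S by (auto simp: mult_closed_def)
  show bs: "u \<in> gspan B S N X" if "u \<in> bspan B X" for u
    unfolding gspan_def using that S1 subspace_0[OF N] by (auto intro!: bexI[of _ 1] bexI[of _ u])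
  show N': "u \<in> gspan B S N X" if "u \<in> N" for u
    unfolding gspan_def mem_Collect_eq
    by (rule bexI[OF _ S1], rule bexI[OF _ bspan_0[OF B]]) (simp add: that)
  show add: "u + v \<in> gspan B S N X" if uv: "u \<in> gspan B S N X" "v \<in> gspan B S N X" for u v
  proof -
    obtain s a s' a' where *: "s \<in> S" "a \<in> bspan B X" "s *s u - a \<in> N"
      "s' \<in> S" "a' \<in> bspan B X" "s' *s v - a' \<in> N"
      using uv unfolding gspan_def by blast
    have "s' *s (s *s u - a) + s *s (s' *s v - a') \<in> N"
      using * N by (intro subspace_add subspace_scale)
    moreover have "s' *s (s *s u - a) + s *s (s' *s v - a')
        = (s * s') *s (u + v) - (s' *s a + s *s a')"
      by (simp add: algebra_simps)
    moreover have "s' *s a + s *s a' \<in> bspan B X"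
      using * S(2) by (intro bspan_add bspan_scale B) auto
    ultimately show ?thesis unfolding gspan_def using SS[OF *(1,4)] by auto
  qed
  show "b *s u \<in> gspan B S N X" if bu: "b \<in> B" "u \<in> gspan B S N X" for b u
  proof -
    obtain s a where *: "s \<in> S" "a \<in> bspan B X" "s *s u - a \<in> N"
      using bu unfolding gspan_def by blast
    have "b *s (s *s u - a) \<in> N" using * N by (intro subspace_scale)
    then have "s *s (b *s u) - b *s a \<in> N" by (simp add: algebra_simps)
    then show ?thesis unfolding gspan_def using * bspan_scale[OF B bu(1) *(2)] by auto
  qed
  show "u \<in> gspan B S N X" if "s \<in> S" "s *s u \<in> gspan B S N X" for s u
    using that SS unfolding gspan_def by fastforce
  show "v \<in> gspan B S N X" if "u - v \<in> N" "u \<in> gspan B S N X"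
  proof -
    have "v - u \<in> N" using subspace_neg[OF N that(1)] by simp
    then show ?thesis using add[OF that(2) N'[of "v - u"]] by simp
  qed
qed

text \<open>
Gaussian elimination over the fraction field of \<open>B / (B \<inter> P)\<close>, with denominators cleared. The
bound depends only on the number of generators, not on the vectors \<open>f i\<close>: this uniformity is what
later bounds the degree of a relation between the powers of a root uniformly in the root.
\<close>

lemma dependent_of_card:
  fixes X :: "'b set" and T :: "'i set"
  assumes P: "prime_ideal_set P" and B: "unital_subring B" and N: "subspace N"
    and PN: "\<And>a v. a \<in> P \<Longrightarrow> a *s v \<in> N"
    and "finite X" "finite T" "card X < card T" "\<And>i. i \<in> T \<Longrightarrow> f i \<in> gspan B (B - P) N X"
  shows "\<exists>c. (\<forall>i\<in>T. c i \<in> B) \<and> (\<exists>i\<in>T. c i \<notin> P) \<and> (\<Sum>i\<in>T. c i *s f i) \<in> N"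
  using assms(5-)
proof (induction X arbitrary: T f rule: finite_induct)
  case empty
  then obtain i where i: "i \<in> T" by fastforce
  then obtain s where s: "s \<in> B" "s \<notin> P" "s *s f i \<in> N"
    using empty(3)[of i] by (auto simp: gspan_def)
  have "(\<Sum>j\<in>T. (if j = i then s else 0) *s f j) = s *s f i"
    using i empty(1) by (simp add: if_distrib[of "\<lambda>c. c *s _"] cong: if_cong)
  then show ?case
    using s i subring_closed[OF B] by (intro exI[of _ "\<lambda>j. if j = i then s else 0"]) auto
next
  case (insert x X)
  note [simp] = subring_closed[OF B]
  have "\<exists>s b g. s \<in> B \<and> s \<notin> P \<and> b \<in> B \<and> g \<in> bspan B X \<and> s *s f i - (b *s x + g) \<in> N"
    if "i \<in> T" for i
    using insert.prems(3)[OF that] insert.hyps by (fastforce simp: gspan_def bspan_insert)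
  then obtain s b g where *: "\<And>i. i \<in> T \<Longrightarrow> s i \<in> B" "\<And>i. i \<in> T \<Longrightarrow> s i \<notin> P"
    "\<And>i. i \<in> T \<Longrightarrow> b i \<in> B" "\<And>i. i \<in> T \<Longrightarrow> g i \<in> bspan B X"
    "\<And>i. i \<in> T \<Longrightarrow> s i *s f i - (b i *s x + g i) \<in> N"
    by metis
  show ?case
  proof (cases "\<forall>i\<in>T. b i \<in> P")
    case True
    have "f i \<in> gspan B (B - P) N X" if i: "i \<in> T" for i
    proof -
      have "(s i *s f i - (b i *s x + g i)) + b i *s x \<in> N"
        using True i *(5) PN N by (blast intro: subspace_add)
      then have "s i *s f i - g i \<in> N" by simp
      then show ?thesis
        unfolding gspan_def using i * by (auto intro!: bexI[of _ "s i"] bexI[of _ "g i"])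
    qed
    then show ?thesis using insert.IH[of T f] insert.prems insert.hyps by simp
  next
    case False
    then obtain k where k: "k \<in> T" "b k \<notin> P" by blast
    \<comment> \<open>Subtract the multiple of the pivot vector that cancels the coordinate along
      \<open>x\<close>.\<close>
    define h where "h i = (b k * s i) *s f i - (b i * s k) *s f k" for i
    have 1: "1 \<in> B - P" using prime_idealD[OF P] by simp
    have "h i \<in> gspan B (B - P) N X" if i: "i \<in> T" for i
    proof -
      have "b k *s (s i *s f i - (b i *s x + g i)) - b i *s (s k *s f k - (b k *s x + g k)) \<in> N"
        by (rule subspace_diff[OF N subspace_scale[OF N *(5)[OF i]] subspace_scale[OF N *(5)[OF k(1)]]])
      then have "1 *s h i - (b k *s g i - b i *s g k) \<in> N"
        by (simp add: h_def algebra_simps)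
      moreover have "b k *s g i - b i *s g k \<in> bspan B X"
        using i k * by (intro bspan_diff bspan_scale B)
      ultimately show ?thesis unfolding gspan_def using 1 by blast
    qed
    moreover have "card X < card (T - {k})" using insert k by auto
    ultimately obtain c where c: "\<forall>i\<in>T - {k}. c i \<in> B" "(\<Sum>i\<in>T - {k}. c i *s h i) \<in> N"
      and ex: "\<exists>i\<in>T - {k}. c i \<notin> P"
      using insert.IH[of "T - {k}" h] insert.prems by auto
    then obtain l where l: "l \<in> T - {k}" "c l \<notin> P" by blast
    define c' where "c' i = (if i = k then - (\<Sum>i\<in>T - {k}. c i * (b i * s k))
        else c i * (b k * s i))" for i
    have "(\<Sum>i\<in>T. c' i *s f i) = c' k *s f k + (\<Sum>i\<in>T - {k}. c' i *s f i)"
      using k insert.prems by (intro sum.remove) auto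
    also have "(\<Sum>i\<in>T - {k}. c' i *s f i) = (\<Sum>i\<in>T - {k}. c i *s ((b k * s i) *s f i))"
      by (rule sum.cong) (auto simp: c'_def)
    also have "c' k *s f k = - (\<Sum>i\<in>T - {k}. c i *s ((b i * s k) *s f k))"
      by (simp add: c'_def scale_sum_left)
    finally have "(\<Sum>i\<in>T. c' i *s f i) = (\<Sum>i\<in>T - {k}. c i *s h i)"
      by (simp add: h_def scale_right_diff_distrib sum_subtractf)
    moreover have "c' i \<in> B" if "i \<in> T" for i
      using c(1) k * that subring_sum[OF B, of "T - {k}" "\<lambda>i. c i * (b i * s k)"]
      by (auto simp: c'_def)
    moreover have "c' l \<notin> P"
    proof -
      have "b k * s l \<notin> P" using l k *(2) prime_idealD(3)[OF P] by blast
      then have "c l * (b k * s l) \<notin> P" using l prime_idealD(3)[OF P] by blast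
      then show ?thesis using l by (simp add: c'_def)
    qed
    ultimately show ?thesis using c l by (intro exI[of _ c']) auto
  qed
qed

text \<open>
If \<open>g\<close> maps the module spanned by \<open>Y\<close> into its multiple by \<open>u\<close>, then \<open>g\<close> satisfies modulo \<open>N\<close> a monic
equation whose other coefficients are divisible by \<open>u\<close>; only the power of \<open>g\<close> and the divisibility are
recorded. Removing one generator at a time replaces the usual determinant: if
\<open>g y\<^sub>0 \<equiv> u (b\<^sub>0 y\<^sub>0 + l\<^sub>0)\<close>, then multiplication by \<open>g - u b\<^sub>0\<close> expresses \<open>y\<^sub>0\<close> through the other generators.
\<close>

lemma nakayama_elimination:
  fixes Y :: "'b set"
  assumes D: "unital_subring D" and u: "u \<in> D" and N: "subspace N" and "finite Y"
    and "g \<in> D" "\<And>y. y \<in> Y \<Longrightarrow> \<exists>l\<in>bspan D Y. g *s y - u *s l \<in> N"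
  shows "\<exists>K. \<exists>h\<in>D. \<forall>y\<in>Y. (g ^ K + u * h) *s y \<in> N"
  using assms(4-)
proof (induction Y arbitrary: g rule: finite_induct)
  case empty
  then show ?case using subring_closed[OF D] by auto
next
  case (insert y0 Y)
  note [simp] = subring_closed[OF D]
  have ex: "\<exists>b\<in>D. \<exists>l\<in>bspan D Y. g *s y - u *s (b *s y0 + l) \<in> N" if "y \<in> insert y0 Y" for y
    using insert.prems(2)[OF that] insert.hyps by (fastforce simp: bspan_insert)
  then obtain b0 l0 where 0: "b0 \<in> D" "l0 \<in> bspan D Y" "g *s y0 - u *s (b0 *s y0 + l0) \<in> N"
    by blast
  define e where "e = g - u * b0"
  have eD: "e \<in> D" using 0 u insert.prems by (simp add: e_def)
  have e0: "e *s y0 - u *s l0 \<in> N" using 0(3) by (simp add: e_def algebra_simps)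
  have "\<exists>l\<in>bspan D Y. (e * g) *s y - u *s l \<in> N" if y: "y \<in> Y" for y
  proof -
    obtain b l where bl: "b \<in> D" "l \<in> bspan D Y" "g *s y - u *s (b *s y0 + l) \<in> N"
      using ex y by blast
    have "e *s (g *s y - u *s (b *s y0 + l)) + (u * b) *s (e *s y0 - u *s l0) \<in> N"
      using bl e0 N by (intro subspace_add subspace_scale)
    also have "e *s (g *s y - u *s (b *s y0 + l)) + (u * b) *s (e *s y0 - u *s l0)
        = (e * g) *s y - u *s (e *s l + (b * u) *s l0)"
      by (simp add: algebra_simps)
    finally have "(e * g) *s y - u *s (e *s l + (b * u) *s l0) \<in> N" .
    moreover have "e *s l + (b * u) *s l0 \<in> bspan D Y"
      using bl 0 eD u by (intro bspan_add bspan_scale D) auto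
    ultimately show ?thesis by blast
  qed
  then have "\<exists>K. \<exists>h\<in>D. \<forall>y\<in>Y. ((e * g) ^ K + u * h) *s y \<in> N"
    using eD insert.prems(1) by (intro insert.IH) simp_all
  then obtain K h where K: "h \<in> D" "\<And>y. y \<in> Y \<Longrightarrow> ((e * g) ^ K + u * h) *s y \<in> N"
    by blast
  have pw: "\<exists>q\<in>D. (e * g) ^ K = (g ^ 2) ^ K + u * q" for K
  proof (induction K)
    case 0
    show ?case by (auto intro!: bexI[of _ 0])
  next
    case (Suc K)
    then obtain q where "q \<in> D" "(e * g) ^ K = (g ^ 2) ^ K + u * q" by blast
    then show ?case using 0 u insert.prems
      by (intro bexI[of _ "g * g * q - b0 * g * ((g ^ 2) ^ K + u * q)"])
        (auto simp: e_def algebra_simps power2_eq_square)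
  qed
  then obtain q where q: "q \<in> D" "(e * g) ^ K = (g ^ 2) ^ K + u * q" by blast
  let ?a = "(e * g) ^ K + u * h"
  have l0: "?a *s l0 \<in> N"
  proof -
    obtain c where c: "l0 = (\<Sum>x\<in>Y. c x *s x)" using 0 by (auto simp: bspan_def)
    have "?a *s l0 = (\<Sum>x\<in>Y. c x *s (?a *s x))"
      unfolding c scale_sum_right by (intro sum.cong refl) (simp only: scale_scale mult.commute)
    also have "\<dots> \<in> N" by (rule subspace_sum[OF N subspace_scale[OF N K(2)]])
    finally show ?thesis .
  qed
  have "(e * ?a) *s y \<in> N" if "y \<in> insert y0 Y" for y
  proof (cases "y = y0")
    case True
    have "?a *s (e *s y0 - u *s l0) + u *s (?a *s l0) \<in> N"
      by (rule subspace_add[OF N subspace_scale[OF N e0] subspace_scale[OF N l0]])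
    also have "?a *s (e *s y0 - u *s l0) + u *s (?a *s l0) = (e * ?a) *s y0"
      by (simp add: scale_right_diff_distrib mult.commute)
    finally show ?thesis using True by simp
  next
    case False
    then have "?a *s y \<in> N" using K that by blast
    then have "e *s (?a *s y) \<in> N" by (rule subspace_scale[OF N])
    then show ?thesis by (simp only: scale_scale)
  qed
  moreover have "e * ?a = g ^ (2 * K + 1) + u * (e * q + e * h - b0 * (g ^ 2) ^ K)"
    unfolding q(2) by (simp add: e_def algebra_simps flip: power_mult)
  moreover have "e * q + e * h - b0 * (g ^ 2) ^ K \<in> D"
    using 0 q K eD insert.prems by simp
  ultimately show ?case by metis
qed

end

lemma scalar_module_mult: "scalar_module ((*) :: 'a::comm_ring_1 \<Rightarrow> 'a \<Rightarrow> 'a)"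
  by unfold_locales (simp_all add: algebra_simps)

lemma subspace_mult_iff: "Modules.module.subspace (*) J \<longleftrightarrow> ideal_set J"
  using scalar_module_mult unfolding scalar_module_def
  by (metis ideal_set_def Modules.module.subspace_def)

context scalar_module
begin

lemma gspan_sum:
  fixes N X :: "'b set"
  assumes "unital_subring B" "mult_closed S" "S \<subseteq> B" "subspace N"
    and "\<And>i. i \<in> I \<Longrightarrow> f i \<in> gspan B S N X"
  shows "sum f I \<in> gspan B S N X"
  using assms(5) by (induction I rule: infinite_finite_induct)
    (auto intro: gspan_add[OF assms(1-4)] gspan_N[OF assms(1-4) subspace_0[OF assms(4)]])

lemma gspan_mono_generators:
  fixes N X Y :: "'b set"
  assumes B: "unital_subring B" and S: "mult_closed S" "S \<subseteq> B" and N: "subspace N"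
    and gen: "\<And>a x. a \<in> A \<Longrightarrow> x \<in> X \<Longrightarrow> a *s (r *s x) \<in> gspan B S N Y"
    and v: "v \<in> gspan A S N X"
  shows "r *s v \<in> gspan B S N Y"
proof -
  obtain s w where s: "s \<in> S" "w \<in> bspan A X" "s *s v - w \<in> N"
    using v unfolding gspan_def by blast
  then obtain c where c: "w = (\<Sum>x\<in>X. c x *s x)" "\<forall>x\<in>X. c x \<in> A"
    unfolding bspan_def by blast
  have "r *s w = (\<Sum>x\<in>X. c x *s (r *s x))" by (simp add: c scale_sum_right mult.commute)
  also have "\<dots> \<in> gspan B S N Y"
    by (rule gspan_sum[OF B S N]) (use c gen in blast)
  finally have "r *s w \<in> gspan B S N Y" .
  moreover have "r *s w - s *s (r *s v) \<in> N"
    using subspace_scale[OF N s(3), of "- r"] by (simp add: algebra_simps)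
  ultimately have "s *s (r *s v) \<in> gspan B S N Y" using gspan_cong[OF B S N] by blast
  then show ?thesis using gspan_cancel[OF B S N s(1)] by blast
qed

text \<open>
Here \<open>T j\<close> is the \<open>j\<close>-th power of a unit \<open>t\<close>. As both extreme coefficients of the relation are
admissible denominators, \<open>t\<^sup>e\<close> and \<open>t\<^sup>-\<^sup>1\<close> can be expressed through \<open>1, t, \<dots>, t\<^sup>e\<^sup>-\<^sup>1\<close>, and therefore so
can all powers of \<open>t\<close>.
\<close>

lemma gspan_eliminate_unit:
  fixes N X :: "'b set" and T :: "int \<Rightarrow> 'a"
  assumes B: "unital_subring B" and S: "mult_closed S" "S \<subseteq> B" and N: "subspace N"
    and T: "T 0 = 1" "\<And>i j. T (i + j) = T i * T j"
    and rel: "\<And>v. (\<Sum>j\<le>e. b j * T (int j)) *s v \<in> N"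
    and b: "\<And>j. j \<le> e \<Longrightarrow> b j \<in> B" "b 0 \<in> S" "b e \<in> S"
    and "finite X"
    and A: "\<And>a. a \<in> A \<Longrightarrow> \<exists>F q. finite F \<and> (\<forall>j\<in>F. q j \<in> B) \<and> a = (\<Sum>j\<in>F. q j * T j)"
  shows "gspan A S N X \<subseteq> gspan B S N ((\<lambda>(l, x). T (int l) *s x) ` ({..<e} \<times> X))"
proof -
  define X' where "X' = (\<lambda>(l, x). T (int l) *s x) ` ({..<e} \<times> X)"
  have fX': "finite X'" using \<open>finite X\<close> by (simp add: X'_def)
  define G where "G = gspan B S N X'"
  note [simp] = subring_closed[OF B]
  note bspan = gspan_bspan[OF B S N, of _ X', folded G_def]
    and inN = gspan_N[OF B S N, of _ X', folded G_def]
    and add = gspan_add[OF B S N, of _ X', folded G_def]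
    and scale = gspan_scale[OF B S N, of _ _ X', folded G_def]
    and cancel = gspan_cancel[OF B S N, of _ _ X', folded G_def]
    and cong = gspan_cong[OF B S N, of _ _ X', folded G_def]
    and gsum = gspan_sum[OF B S N, of _ _ X', folded G_def]
    and gens = gspan_mono_generators[OF B S N, of _ _ _ X', folded G_def]
  have gen: "T (int l) *s x \<in> G" if "l < e" "x \<in> X" for l x
    by (rule bspan, rule bspan_base[OF B fX']) (use that in \<open>auto simp: X'_def\<close>)
  have top: "T (int e) *s x \<in> G" if x: "x \<in> X" for x
  proof -
    have "(\<Sum>j\<le>e. b j * T (int j)) *s x
        = b e *s (T (int e) *s x) - (\<Sum>j<e. (- b j) *s (T (int j) *s x))"
      by (simp add: lessThan_Suc_atMost[symmetric] algebra_simps scale_sum_left sum_negf)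
    then have "(\<Sum>j<e. (- b j) *s (T (int j) *s x)) - b e *s (T (int e) *s x) \<in> N"
      using subspace_neg[OF N rel[of x]] by simp
    moreover have "(\<Sum>j<e. (- b j) *s (T (int j) *s x)) \<in> G"
      by (rule gsum, rule scale) (use b gen x in auto)
    ultimately show ?thesis using cong cancel b by blast
  qed
  have bottom: "T (- 1) *s x \<in> G" if x: "x \<in> X" for x
  proof -
    have "(\<Sum>j\<le>e. b j * T (int j)) *s (T (- 1) *s x)
        = (\<Sum>j\<le>e. (b j * T (int j - 1)) *s x)"
      by (simp add: sum_distrib_right scale_sum_left mult.assoc flip: T(2))
    also have "\<dots> = b 0 *s (T (- 1) *s x) + (\<Sum>j<e. (b (Suc j) * T (int j)) *s x)"
      by (subst sum.atMost_shift) simp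
    also have "\<dots> = b 0 *s (T (- 1) *s x) - (\<Sum>j<e. (- b (Suc j)) *s (T (int j) *s x))"
      by (simp add: sum_negf)
    finally have "(\<Sum>j<e. (- b (Suc j)) *s (T (int j) *s x)) - b 0 *s (T (- 1) *s x) \<in> N"
      using subspace_neg[OF N rel[of "T (- 1) *s x"]] by simp
    moreover have "(\<Sum>j<e. (- b (Suc j)) *s (T (int j) *s x)) \<in> G"
      by (rule gsum, rule scale) (use b gen x in auto)
    ultimately show ?thesis using cong cancel b by blast
  qed
  have up: "T 1 *s v \<in> G" if "v \<in> G" for v
  proof (rule gens)
    show "a *s (T 1 *s y) \<in> G" if a: "a \<in> B" and y: "y \<in> X'" for a y
    proof -
      obtain l x where y: "y = T (int l) *s x" "l < e" "x \<in> X" using y by (auto simp: X'_def)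
      have "T 1 *s y = T (int (Suc l)) *s x" by (simp add: y T(2))
      also have "\<dots> \<in> G" using y gen[of "Suc l" x] top[of x] by (cases "Suc l = e") force+
      finally show ?thesis using scale a by blast
    qed
  qed (use that G_def in auto)
  have down: "T (- 1) *s v \<in> G" if "v \<in> G" for v
  proof (rule gens)
    show "a *s (T (- 1) *s y) \<in> G" if a: "a \<in> B" and y: "y \<in> X'" for a y
    proof -
      obtain l x where y: "y = T (int l) *s x" "l < e" "x \<in> X" using y by (auto simp: X'_def)
      have "T (- 1) *s y = T (int l - 1) *s x" by (simp add: y flip: T(2))
      also have "\<dots> \<in> G"
      proof (cases l)
        case (Suc k)
        then show ?thesis using y gen[of k x] by simp
      qed (use bottom y in simp)
      finally show ?thesis using scale a by blast
    qed
  qed (use that G_def in auto)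
  have base: "x \<in> G" if "x \<in> X" for x
    using top[OF that] gen[of 0 x] that by (cases e) (simp_all add: T)
  have pos: "T (int l) *s x \<in> G" if "x \<in> X" for l x
  proof (induction l)
    case (Suc l)
    then show ?case using up[OF Suc] by (simp add: T(2))
  qed (simp add: T base that)
  have neg: "T (- int l) *s x \<in> G" if "x \<in> X" for l x
  proof (induction l)
    case (Suc l)
    then show ?case using down[OF Suc] by (simp flip: T(2))
  qed (simp add: T base that)
  have all: "T j *s x \<in> G" if "x \<in> X" for j x
    using pos[OF that] neg[OF that] by (cases j rule: int_cases2) auto
  have "v \<in> G" if v: "v \<in> gspan A S N X" for v
  proof -
    have "1 *s v \<in> G"
    proof (rule gens[OF _ v])
      fix a x assume "a \<in> A" "x \<in> X"
      then obtain F q where F: "finite F" "\<forall>j\<in>F. q j \<in> B" "a = (\<Sum>j\<in>F. q j * T j)"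
        using A by blast
      have "a *s x = (\<Sum>j\<in>F. q j *s (T j *s x))" by (simp add: F scale_sum_left)
      also have "\<dots> \<in> G" by (rule gsum, rule scale) (use F all \<open>x \<in> X\<close> in auto)
      finally show "a *s (1 *s x) \<in> G" by simp
    qed
    then show ?thesis by simp
  qed
  then show ?thesis by (auto simp: G_def X'_def)
qed

end

section \<open>Integrality from a relation of bounded degree\<close>

lemma power_cong_ideal:
  assumes J: "ideal_set J" and "a - b \<in> J"
  shows "a ^ k - b ^ k \<in> J"
proof (induction k)
  case (Suc k)
  have "a * (a ^ k - b ^ k) + (a - b) * b ^ k \<in> J"
    using ideal_closed(2)[OF J ideal_closed(4)[OF J Suc] ideal_closed(5)[OF J assms(2)]] .
  then show ?case by (simp add: algebra_simps)
qed (simp add: ideal_closed[OF J])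

lemma mult_cong_ideal:
  assumes J: "ideal_set J" and "a - b \<in> J" "c - d \<in> J"
  shows "a * c - b * d \<in> J"
proof -
  have "(a - b) * c + b * (c - d) \<in> J"
    using ideal_closed(2)[OF J ideal_closed(5)[OF J assms(2)] ideal_closed(4)[OF J assms(3)]] .
  then show ?thesis by (simp add: algebra_simps)
qed

text \<open>
This is the step that bounds the exponent \<open>r\<close> of a root. In valuation terms, let \<open>kap\<close> have valuation 1,
so that by the assumption on \<open>kap ^ e\<close> the valuation of \<open>u\<close> is at most \<open>e\<close> and that of \<open>z\<close> is at most
\<open>e d / r\<close>, hence less than \<open>1 / m\<close>. If \<open>u\<close>, and with it \<open>z\<close>, had positive valuation, then in the relation
the terms below \<open>m0\<close> would be divisible by \<open>kap\<close>, which has larger valuation than \<open>z ^ m0\<close>, and the terms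
above \<open>m0\<close> would have larger valuation as well; so \<open>c0\<close> could not be a unit.

No valuation is constructed. The element \<open>th = kap / z ^ (m + 1)\<close> is integral over \<open>D[z]\<close>, because
\<open>th ^ (e d)\<close> lies in \<open>D[z]\<close> as soon as \<open>r \<ge> e d (m + 1)\<close>. Dividing the relation by \<open>z ^ m0\<close> shows that \<open>c0\<close>
is a multiple of \<open>z\<close> in the ring \<open>L = D[z, th] + J\<close>, so \<open>c0 ^ r\<close> is a multiple of \<open>z ^ r = u ^ d\<close>, hence
of \<open>u\<close>. Since \<open>L\<close> is a finitely generated module over \<open>D\<close> modulo \<open>J\<close>, \<open>nakayama_elimination\<close> applies.
\<close>

lemma root_relation_integrality:
  fixes J :: "'a::comm_ring_1 set"
  assumes D: "unital_subring D" and J: "ideal_set J"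
    and u: "u \<in> D" and zw: "z * w - 1 \<in> J" and zr: "z ^ r - u ^ d \<in> J"
    and kap: "kap \<in> D" "h0 \<in> D" "kap ^ e - u * h0 \<in> J"
    and r: "e * d * (m + 1) \<le> r" "0 < e" "0 < d"
    and rel: "(\<Sum>b\<le>m. c b * z ^ b) \<in> J" and m0: "m0 \<le> m"
    and below: "\<And>b. b < m0 \<Longrightarrow> c' b \<in> D \<and> c b - kap * c' b \<in> J"
    and at: "c0 \<in> D" "c' m0 \<in> D" "c m0 - (c0 + kap * c' m0) \<in> J"
    and above: "\<And>b. m0 < b \<Longrightarrow> b \<le> m \<Longrightarrow> c b \<in> D"
  shows "\<exists>K. \<exists>h\<in>D. c0 ^ K + u * h \<in> J"
proof -
  interpret reg: scalar_module "(*) :: 'a \<Rightarrow> 'a \<Rightarrow> 'a" by (rule scalar_module_mult)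
  note reg.scale_scale [simp del]
  have JS: "reg.subspace J" by (simp add: subspace_mult_iff J)
  note [simp] = subring_closed[OF D]
  define th where "th = kap * w ^ (m + 1)"
  define E where "E = e * d"
  have rpos: "0 < r" and Epos: "0 < E" using r by (auto simp: E_def intro: Nat.gr0I)
  define Y where "Y = (\<lambda>(a, b). z ^ a * th ^ b) ` ({..<r} \<times> {..<E})"
  have fY: "finite Y" by (simp add: Y_def)
  define L where "L = reg.gspan D {1} J Y"
  have S: "mult_closed {1 :: 'a}" "{1} \<subseteq> D" by (simp_all add: mult_closed_def)
  note L_bspan = reg.gspan_bspan[OF D S JS, of _ Y, folded L_def]
    and L_J = reg.gspan_N[OF D S JS, of _ Y, folded L_def]
    and L_add = reg.gspan_add[OF D S JS, of _ Y, folded L_def]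
    and L_scale = reg.gspan_scale[OF D S JS, of _ _ Y, folded L_def]
  have L_cong: "v \<in> L" if "v - l \<in> J" "l \<in> L" for v l
    using reg.gspan_cong[OF D S JS, of l v Y] ideal_closed(6)[OF J that(1)] that(2)
    by (simp add: L_def)
  have L_lift: "g * v \<in> L" if "\<And>y. y \<in> Y \<Longrightarrow> g * y \<in> L" "v \<in> L" for g v
    using reg.gspan_mono_generators[OF D S JS, of D Y g Y v] that L_scale by (simp add: L_def)
  have gen: "z ^ a * th ^ b \<in> L" if "a < r" "b < E" for a b
    by (rule L_bspan, rule reg.bspan_base[OF D fY]) (use that in \<open>auto simp: Y_def\<close>)
  have one: "1 \<in> L" using gen[of 0 0] rpos Epos by simp
  have z_L: "z * v \<in> L" if "v \<in> L" for v
  proof (rule L_lift[OF _ that])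
    fix y assume "y \<in> Y"
    then obtain a b where y: "y = z ^ a * th ^ b" "a < r" "b < E" by (auto simp: Y_def)
    show "z * y \<in> L"
    proof (cases "Suc a = r")
      case True
      have "z * y - u ^ d * th ^ b = (z ^ r - u ^ d) * th ^ b"
        using True by (auto simp: y algebra_simps)
      also have "\<dots> \<in> J" using ideal_closed(5)[OF J zr] .
      finally show ?thesis
        by (rule L_cong) (use gen[of 0 b] rpos y u in \<open>auto intro!: L_scale\<close>)
    next
      case False
      then show ?thesis using gen[of "Suc a" b] y by (simp add: mult.assoc)
    qed
  qed
  have zp_L: "z ^ k * v \<in> L" if "v \<in> L" for k v
    using that by (induction k) (simp_all add: z_L mult.assoc)
  have zwk: "z ^ k * w ^ k - 1 \<in> J" for k
    using power_cong_ideal[OF J zw, of k] by (simp add: power_mult_distrib)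
  have zk_w: "z ^ k * w ^ l - z ^ (k - l) \<in> J" if "l \<le> k" for k l
  proof -
    have "z ^ k = z ^ (k - l) * z ^ l" using that by (simp flip: power_add)
    then have "z ^ k * w ^ l - z ^ (k - l) = z ^ (k - l) * (z ^ l * w ^ l - 1)"
      by (simp only: right_diff_distrib mult_1_right mult_1_left ac_simps)
    then show ?thesis using ideal_closed(4)[OF J zwk] by simp
  qed
  have thE: "th ^ E - h0 ^ d * z ^ (r - E * (m + 1)) \<in> J"
  proof -
    have "kap ^ E - (u * h0) ^ d \<in> J"
      using power_cong_ideal[OF J kap(3), of d] by (simp add: E_def power_mult)
    moreover have "(u * h0) ^ d - z ^ r * h0 ^ d \<in> J"
      using ideal_closed(6)[OF J ideal_closed(5)[OF J zr, of "h0 ^ d"]]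
      by (simp add: power_mult_distrib algebra_simps)
    ultimately have "kap ^ E - z ^ r * h0 ^ d \<in> J"
      using ideal_closed(2)[OF J] by fastforce
    then have "kap ^ E * w ^ (E * (m + 1)) - z ^ r * h0 ^ d * w ^ (E * (m + 1)) \<in> J"
      using ideal_closed(5)[OF J] by (metis left_diff_distrib)
    moreover have "h0 ^ d * (z ^ r * w ^ (E * (m + 1)) - z ^ (r - E * (m + 1))) \<in> J"
      by (rule ideal_closed(4)[OF J zk_w]) (use r in \<open>simp add: E_def\<close>)
    ultimately have "kap ^ E * w ^ (E * (m + 1)) - z ^ r * h0 ^ d * w ^ (E * (m + 1))
        + h0 ^ d * (z ^ r * w ^ (E * (m + 1)) - z ^ (r - E * (m + 1))) \<in> J"
      by (rule ideal_closed(2)[OF J])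
    moreover have "th ^ E = kap ^ E * w ^ (E * (m + 1))"
      by (simp only: th_def power_mult_distrib mult.commute[of E] power_mult)
    ultimately show ?thesis by (simp add: algebra_simps)
  qed
  have th_L: "th * v \<in> L" if "v \<in> L" for v
  proof (rule L_lift[OF _ that])
    fix y assume "y \<in> Y"
    then obtain a b where y: "y = z ^ a * th ^ b" "a < r" "b < E" by (auto simp: Y_def)
    show "th * y \<in> L"
    proof (cases "Suc b = E")
      case True
      have "th * y = z ^ a * th ^ E"
        using True by (auto simp: y algebra_simps)
      then have "th * y - z ^ a * (h0 ^ d * z ^ (r - E * (m + 1))) \<in> J"
        using ideal_closed(4)[OF J thE, of "z ^ a"] by (simp add: algebra_simps)
      moreover have "z ^ a * (h0 ^ d * z ^ (r - E * (m + 1))) \<in> L"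
        using one zp_L[OF one, of "r - E * (m + 1)"] kap by (intro zp_L L_scale) auto
      ultimately show ?thesis using L_cong by blast
    next
      case False
      then show ?thesis using gen[of a "Suc b"] y by (simp add: algebra_simps)
    qed
  qed
  have thp_L: "th ^ k * v \<in> L" if "v \<in> L" for k v
    using that by (induction k) (simp_all add: th_L mult.assoc)
  have mult_L: "v * v' \<in> L" if "v \<in> L" "v' \<in> L" for v v'
  proof (rule L_lift[OF _ that(2)])
    fix y assume "y \<in> Y"
    then obtain a b where "y = z ^ a * th ^ b" by (auto simp: Y_def)
    then show "v * y \<in> L"
      using zp_L[OF thp_L[OF that(1)], of a b] by (simp add: ac_simps)
  qed
  \<comment> \<open>Division by \<open>z ^ k\<close> with \<open>k \<le> m\<close> leaves a factor
    \<open>z\<close>, since \<open>th\<close> allows division by \<open>z ^ (m + 1)\<close>.\<close>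
  have kap_zL: "\<exists>y\<in>L. kap * w ^ k - z * y \<in> J" if "k \<le> m" for k
  proof
    show "th * z ^ (m - k) \<in> L" using th_L[OF zp_L[OF one, of "m - k"]] by simp
    have "z * (th * z ^ (m - k)) = kap * (z ^ (m + 1 - k) * w ^ (m + 1 - k)) * w ^ k"
    proof -
      have 1: "w ^ (m + 1) = w ^ (m + 1 - k) * w ^ k" using that by (simp flip: power_add)
      have 2: "z * z ^ (m - k) = z ^ (m + 1 - k)" using that by (simp add: Suc_diff_le)
      have "z * (th * z ^ (m - k)) = kap * w ^ (m + 1) * (z * z ^ (m - k))"
        unfolding th_def by (simp only: ac_simps)
      also have "\<dots> = kap * (z ^ (m + 1 - k) * w ^ (m + 1 - k)) * w ^ k"
        unfolding 1 2 by (simp only: ac_simps)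
      finally show ?thesis .
    qed
    then have "z * (th * z ^ (m - k)) - kap * w ^ k
        = (kap * w ^ k) * (z ^ (m + 1 - k) * w ^ (m + 1 - k) - 1)"
      by (simp add: algebra_simps)
    also have "\<dots> \<in> J" by (rule ideal_closed(4)[OF J zwk])
    finally show "kap * w ^ k - z * (th * z ^ (m - k)) \<in> J"
      using ideal_closed(6)[OF J] by fastforce
  qed
  define zL where "zL = {v. \<exists>y\<in>L. v - z * y \<in> J}"
  have zL_add: "v + v' \<in> zL" if vv: "v \<in> zL" "v' \<in> zL" for v v'
  proof -
    obtain l l' where "l \<in> L" "v - z * l \<in> J" "l' \<in> L" "v' - z * l' \<in> J"
      using vv by (auto simp: zL_def)
    then have "l + l' \<in> L" "(v + v') - z * (l + l') \<in> J"
      using L_add ideal_closed(2)[OF J, of "v - z * l" "v' - z * l'"]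
      by (auto simp: algebra_simps)
    then show ?thesis by (auto simp: zL_def)
  qed
  have zL_J: "v \<in> zL" if "v \<in> J" for v
    using that L_J[OF ideal_closed(1)[OF J]] by (auto simp: zL_def intro!: bexI[of _ 0])
  have zL_sum: "sum f I \<in> zL" if "\<And>i. i \<in> I \<Longrightarrow> f i \<in> zL" for f and I :: "nat set"
    using that by (induction I rule: infinite_finite_induct)
      (auto intro: zL_add zL_J ideal_closed(1)[OF J])
  have zL_scale: "b * v \<in> zL" if bv: "b \<in> D" "v \<in> zL" for b v
  proof -
    obtain l where "l \<in> L" "v - z * l \<in> J" using bv by (auto simp: zL_def)
    then have "b * l \<in> L" "b * v - z * (b * l) \<in> J"
      using L_scale[OF bv(1)] ideal_closed(4)[OF J, of "v - z * l" b]
      by (simp_all add: right_diff_distrib mult.left_commute)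
    then show ?thesis by (auto simp: zL_def)
  qed
  have zL_cong: "v \<in> zL" if "v - l \<in> J" "l \<in> zL" for v l
    using zL_add[OF that(2) zL_J[OF that(1)]] by simp
  have c0_zL: "c0 \<in> zL"
  proof -
    have lowmon: "c b * (z ^ b * w ^ m0) \<in> zL" if "b < m0" for b
    proof -
      have "w ^ m0 = w ^ (m0 - b) * w ^ b" using that by (simp flip: power_add)
      then have "z ^ b * w ^ m0 - w ^ (m0 - b) = w ^ (m0 - b) * (z ^ b * w ^ b - 1)"
        by (simp only: right_diff_distrib mult_1_right mult_1_left ac_simps)
      then have "z ^ b * w ^ m0 - w ^ (m0 - b) \<in> J"
        using ideal_closed(4)[OF J zwk] by simp
      then have "c b * (z ^ b * w ^ m0) - kap * c' b * w ^ (m0 - b) \<in> J"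
        using below[OF that] by (intro mult_cong_ideal J) auto
      moreover have "kap * c' b * w ^ (m0 - b) \<in> zL"
      proof -
        have "kap * w ^ (m0 - b) \<in> zL" using kap_zL[of "m0 - b"] m0 by (auto simp: zL_def)
        then have "c' b * (kap * w ^ (m0 - b)) \<in> zL" using below[OF that] zL_scale by blast
        then show ?thesis by (simp add: algebra_simps)
      qed
      ultimately show ?thesis by (rule zL_cong)
    qed
    have highmon: "c b * (z ^ b * w ^ m0) \<in> zL" if "m0 < b" "b \<le> m" for b
    proof (rule zL_scale)
      show "c b \<in> D" using above that by blast
      have "b - m0 = Suc (b - m0 - 1)" using that by simp
      then have "z ^ (b - m0) = z * z ^ (b - m0 - 1)" by (metis power_Suc)
      then have "z ^ b * w ^ m0 - z * z ^ (b - m0 - 1) \<in> J"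
        using zk_w[of m0 b] that by simp
      then show "z ^ b * w ^ m0 \<in> zL" using zp_L[OF one, of "b - m0 - 1"] by (auto simp: zL_def)
    qed
    have "(\<Sum>b\<in>{..m} - {m0}. c b * (z ^ b * w ^ m0)) \<in> zL"
    proof (rule zL_sum)
      fix b assume "b \<in> {..m} - {m0}"
      then have "b < m0 \<or> m0 < b \<and> b \<le> m" by auto
      then show "c b * (z ^ b * w ^ m0) \<in> zL" using lowmon highmon by blast
    qed
    from zL_scale[OF _ this, of "- 1"]
    have neg: "- (\<Sum>b\<in>{..m} - {m0}. c b * (z ^ b * w ^ m0)) \<in> zL" by simp
    have "w ^ m0 * (\<Sum>b\<le>m. c b * z ^ b) = (\<Sum>b\<le>m. c b * (z ^ b * w ^ m0))"
      unfolding sum_distrib_left by (rule sum.cong) (simp_all only: ac_simps)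
    also have "\<dots> = c m0 * (z ^ m0 * w ^ m0) + (\<Sum>b\<in>{..m} - {m0}. c b * (z ^ b * w ^ m0))"
      using m0 by (intro sum.remove) auto
    finally have "c m0 * (z ^ m0 * w ^ m0) - (- (\<Sum>b\<in>{..m} - {m0}. c b * (z ^ b * w ^ m0))) \<in> J"
      using ideal_closed(4)[OF J rel, of "w ^ m0"] by simp
    then have "c m0 * (z ^ m0 * w ^ m0) \<in> zL" using neg by (rule zL_cong)
    moreover have "c m0 - c m0 * (z ^ m0 * w ^ m0) \<in> J"
      using ideal_closed(6)[OF J ideal_closed(4)[OF J zwk[of m0], of "c m0"]]
      by (simp add: algebra_simps)
    ultimately have "c m0 \<in> zL" using zL_cong by blast
    moreover have "(c0 + kap * c' m0) - c m0 \<in> J" using ideal_closed(6)[OF J at(3)] by simp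
    ultimately have "c0 + kap * c' m0 \<in> zL" using zL_cong by blast
    moreover have "(- c' m0) * kap \<in> zL"
      using kap_zL[of 0] at by (intro zL_scale) (auto simp: zL_def)
    ultimately have "(c0 + kap * c' m0) + (- c' m0) * kap \<in> zL" by (rule zL_add)
    then show ?thesis by (simp add: algebra_simps)
  qed
  then obtain y where y: "y \<in> L" "c0 - z * y \<in> J" by (auto simp: zL_def)
  have ypow: "y ^ k \<in> L" for k by (induction k) (simp_all add: one mult_L y)
  have "c0 ^ r - (z * y) ^ r \<in> J" by (rule power_cong_ideal[OF J y(2)])
  moreover have "(z ^ r - u ^ d) * y ^ r \<in> J" by (rule ideal_closed(5)[OF J zr])
  ultimately have "c0 ^ r - (z * y) ^ r + (z ^ r - u ^ d) * y ^ r \<in> J"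
    by (rule ideal_closed(2)[OF J])
  moreover have ud: "u ^ d = u * u ^ (d - 1)" using r by (cases d) auto
  have "c0 ^ r - (z * y) ^ r + (z ^ r - u ^ d) * y ^ r
      = c0 ^ r - u * (u ^ (d - 1) * y ^ r)"
    unfolding ud power_mult_distrib by (simp only: left_diff_distrib mult.assoc) simp
  ultimately have c0r: "c0 ^ r - u * (u ^ (d - 1) * y ^ r) \<in> J" by simp
  define y' where "y' = u ^ (d - 1) * y ^ r"
  have y'L: "y' \<in> L" unfolding y'_def using u ypow by (intro L_scale) auto
  have "\<exists>l\<in>reg.bspan D Y. c0 ^ r * v - u * l \<in> J" if v: "v \<in> Y" for v
  proof -
    have "v \<in> L" by (rule L_bspan[OF reg.bspan_base[OF D fY v]])
    then have "y' * v \<in> L" by (rule mult_L[OF y'L])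
    then obtain l where l: "l \<in> reg.bspan D Y" "y' * v - l \<in> J"
      by (auto simp: L_def reg.gspan_def)
    have "v * (c0 ^ r - u * y') + u * (y' * v - l) \<in> J"
      using c0r l by (intro ideal_closed(2,4) J) (simp add: y'_def)
    then show ?thesis using l by (intro bexI[of _ l]) (simp_all add: algebra_simps)
  qed
  then have "\<exists>K. \<exists>h\<in>D. \<forall>v\<in>Y. ((c0 ^ r) ^ K + u * h) * v \<in> J"
    using at by (intro reg.nakayama_elimination[OF D u JS fY]) simp_all
  then obtain K h where h: "h \<in> D" "\<forall>v\<in>Y. ((c0 ^ r) ^ K + u * h) * v \<in> J"
    by blast
  have "z ^ 0 * th ^ 0 \<in> Y" unfolding Y_def using rpos Epos by (intro image_eqI[of _ _ "(0, 0)"]) simp_all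
  then have "1 \<in> Y" by simp
  then have "((c0 ^ r) ^ K + u * h) * 1 \<in> J" using h(2) by blast
  then have "c0 ^ (r * K) + u * h \<in> J" by (simp add: power_mult)
  then show ?thesis using h by blast
qed

section \<open>A torsion-free quotient modulo a prime ideal\<close>

context scalar_module
begin

definition linear_map :: "('b \<Rightarrow> 'b) \<Rightarrow> bool"
  where "linear_map f \<longleftrightarrow> (\<forall>x y. f (x + y) = f x + f y) \<and> (\<forall>c x. f (c *s x) = c *s f x)"

lemma linear_mapD:
  assumes "linear_map f"
  shows "f (x + y) = f x + f y" "f (c *s x) = c *s f x" "f 0 = 0" "f (x - y) = f x - f y"
    "f (sum g I) = (\<Sum>i\<in>I. f (g i))"
proof -
  show add: "f (x + y) = f x + f y" and scale: "f (c *s x) = c *s f x" for x y c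
    using assms by (simp_all add: linear_map_def)
  show 0: "f 0 = 0" using scale[of 0 0] by simp
  show "f (x - y) = f x - f y" using add[of "x - y" y] by (simp add: algebra_simps)
  show "f (sum g I) = (\<Sum>i\<in>I. f (g i))"
    by (induction I rule: infinite_finite_induct) (simp_all add: 0 add)
qed

text \<open>
Take \<open>P\<close> maximal among the ideals \<open>I\<close> for which no element of \<open>S\<close> maps the whole module into \<open>I M + N0\<close>;
Zorn's lemma applies since \<open>M\<close> is finitely generated modulo \<open>N0\<close>. If \<open>s M \<subseteq> P M + a M\<close> and
\<open>s' M \<subseteq> P M + b M\<close> with \<open>a b \<in> P\<close>, then \<open>s' s M \<subseteq> P M\<close>, so \<open>P\<close> is prime. The set \<open>N\<close> consists of the
vectors that are torsion modulo \<open>P M + N0\<close>; if it were everything, a single \<open>a \<notin> P\<close> would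
map \<open>M\<close> into \<open>P M + N0\<close>, and by maximality so would some element of \<open>S\<close>. Both \<open>P M + N0\<close> and \<open>N\<close> are defined
through the module structure and \<open>N0\<close> alone, so every linear map that preserves \<open>N0\<close> preserves them.
\<close>

lemma exists_prime_torsion_free_quotient:
  fixes N0 X :: "'b set"
  assumes N0: "subspace N0" and "finite X"
    and gen: "\<And>v. \<exists>l\<in>bspan UNIV X. v - l \<in> N0"
    and S: "mult_closed S" and S_N0: "\<forall>s\<in>S. \<exists>v. s *s v \<notin> N0"
  shows "\<exists>P N. prime_ideal_set P \<and> S \<inter> P = {} \<and> subspace N \<and> N \<noteq> UNIV \<and> N0 \<subseteq> N
    \<and> (\<forall>a\<in>P. \<forall>v. a *s v \<in> N) \<and> (\<forall>a v. a *s v \<in> N \<longrightarrow> a \<in> P \<or> v \<in> N)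
    \<and> (\<forall>f. linear_map f \<and> f ` N0 \<subseteq> N0 \<longrightarrow> f ` N \<subseteq> N)"
proof -
  define IM where "IM I = {v. \<exists>c. (\<forall>x\<in>X. c x \<in> I) \<and> v - (\<Sum>x\<in>X. c x *s x) \<in> N0}" for I
  have IM_sub: "subspace (IM I)" if I: "ideal_set I" for I
  proof (rule subspaceI)
    show "0 \<in> IM I"
      unfolding IM_def using ideal_closed(1)[OF I] subspace_0[OF N0]
      by (auto intro!: exI[of _ "\<lambda>_. 0"])
  next
    fix v v' assume "v \<in> IM I" "v' \<in> IM I"
    then obtain c c' where c: "\<forall>x\<in>X. c x \<in> I" "v - (\<Sum>x\<in>X. c x *s x) \<in> N0"
      "\<forall>x\<in>X. c' x \<in> I" "v' - (\<Sum>x\<in>X. c' x *s x) \<in> N0"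
      by (auto simp: IM_def)
    then have "v + v' - (\<Sum>x\<in>X. (c x + c' x) *s x) \<in> N0"
      using subspace_add[OF N0 c(2,4)] by (simp add: scale_left_distrib sum.distrib algebra_simps)
    then show "v + v' \<in> IM I"
      unfolding IM_def using c ideal_closed(2)[OF I] by (auto intro!: exI[of _ "\<lambda>x. c x + c' x"])
  next
    fix a v assume "v \<in> IM I"
    then obtain c where c: "\<forall>x\<in>X. c x \<in> I" "v - (\<Sum>x\<in>X. c x *s x) \<in> N0"
      by (auto simp: IM_def)
    then have "a *s v - (\<Sum>x\<in>X. (a * c x) *s x) \<in> N0"
      using subspace_scale[OF N0 c(2), of a] by (simp add: scale_right_diff_distrib scale_sum_right)
    then show "a *s v \<in> IM I"
      unfolding IM_def using c ideal_closed(4)[OF I] by (auto intro!: exI[of _ "\<lambda>x. a * c x"])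
  qed
  have IM_N0: "v \<in> IM I" if "v \<in> N0" "ideal_set I" for v I
    unfolding IM_def using that ideal_closed(1)[OF that(2)] by (auto intro!: exI[of _ "\<lambda>_. 0"])
  have gen': "\<exists>c. v - (\<Sum>x\<in>X. c x *s x) \<in> N0" for v
    using gen[of v] by (auto simp: bspan_def)
  have IM_scale: "a *s v \<in> IM I" if "a \<in> I" "ideal_set I" for a v I
  proof -
    obtain c where c: "v - (\<Sum>x\<in>X. c x *s x) \<in> N0" using gen' by blast
    have "a *s v - (\<Sum>x\<in>X. (a * c x) *s x) \<in> N0"
      using subspace_scale[OF N0 c, of a] by (simp add: scale_right_diff_distrib scale_sum_right)
    then show ?thesis
      unfolding IM_def using ideal_closed(5)[OF that(2,1)] by (auto intro!: exI[of _ "\<lambda>x. a * c x"])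
  qed
  have by_gens: "s *s v \<in> W" if W: "subspace W" "N0 \<subseteq> W" and s: "\<And>x. x \<in> X \<Longrightarrow> s *s x \<in> W" for s v W
  proof -
    obtain c where c: "v - (\<Sum>x\<in>X. c x *s x) \<in> N0" using gen' by blast
    have "(\<Sum>x\<in>X. c x *s (s *s x)) \<in> W"
      by (rule subspace_sum[OF W(1)], rule subspace_scale[OF W(1)], rule s)
    moreover have "s *s (v - (\<Sum>x\<in>X. c x *s x)) \<in> W"
      using subspace_scale[OF N0 c] W by blast
    ultimately have "s *s (v - (\<Sum>x\<in>X. c x *s x)) + (\<Sum>x\<in>X. c x *s (s *s x)) \<in> W"
      by (intro subspace_add[OF W(1)])
    then show ?thesis by (simp add: scale_right_diff_distrib scale_sum_right mult.commute)
  qed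
  define \<I> where "\<I> = {I. ideal_set I \<and> (\<forall>s\<in>S. \<exists>v. s *s v \<notin> IM I)}"
  have "{0} \<in> \<I>"
  proof -
    have "ideal_set {0::'a}" by (simp add: ideal_set_def)
    moreover have "IM {0} \<subseteq> N0" by (auto simp: IM_def)
    ultimately show ?thesis unfolding \<I>_def using S_N0 by blast
  qed
  moreover have "\<Union>\<C> \<in> \<I>" if ne: "\<C> \<noteq> {}" and ch: "subset.chain \<I> \<C>" for \<C>
  proof -
    have ideals: "ideal_set I" if "I \<in> \<C>" for I
      using ch that by (auto simp: subset.chain_def \<I>_def)
    have comp: "I \<subseteq> I' \<or> I' \<subseteq> I" if "I \<in> \<C>" "I' \<in> \<C>" for I I'
      using ch that by (auto simp: subset.chain_def)
    have "ideal_set (\<Union>\<C>)"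
      unfolding ideal_set_def
    proof (intro conjI ballI allI)
      show "0 \<in> \<Union>\<C>" using ne ideal_closed(1)[OF ideals] by blast
    next
      fix x y assume "x \<in> \<Union>\<C>" "y \<in> \<Union>\<C>"
      then obtain I I' where "I \<in> \<C>" "x \<in> I" "I' \<in> \<C>" "y \<in> I'" by blast
      moreover from this have "I \<subseteq> I' \<or> I' \<subseteq> I" using comp by blast
      ultimately obtain K where "K \<in> \<C>" "x \<in> K" "y \<in> K" by blast
      then show "x + y \<in> \<Union>\<C>" using ideal_closed(2)[OF ideals] by blast
    next
      fix c x assume "x \<in> \<Union>\<C>"
      then show "c * x \<in> \<Union>\<C>" using ideal_closed(4)[OF ideals] by blast
    qed
    moreover have "\<exists>v. s *s v \<notin> IM (\<Union>\<C>)" if s: "s \<in> S" for s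
    proof (rule ccontr)
      assume "\<nexists>v. s *s v \<notin> IM (\<Union>\<C>)"
      then have "\<forall>x. \<exists>c. (\<forall>y\<in>X. c y \<in> \<Union>\<C>) \<and> s *s x - (\<Sum>y\<in>X. c y *s y) \<in> N0"
        by (simp add: IM_def)
      from choice[OF this] obtain c where c: "\<And>x y. y \<in> X \<Longrightarrow> c x y \<in> \<Union>\<C>"
        "\<And>x. s *s x - (\<Sum>y\<in>X. c x y *s y) \<in> N0" by blast
      have finite_sub: "\<exists>I\<in>\<C>. F \<subseteq> I" if "finite F" "F \<subseteq> \<Union>\<C>" for F
        using that
      proof (induction F rule: finite_induct)
        case (insert x F)
        then obtain I I' where "I \<in> \<C>" "F \<subseteq> I" "I' \<in> \<C>" "x \<in> I'" by blast
        moreover from this have "I \<subseteq> I' \<or> I' \<subseteq> I" using comp by blast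
        ultimately have "insert x F \<subseteq> I' \<or> insert x F \<subseteq> I" by blast
        then show ?case using \<open>I \<in> \<C>\<close> \<open>I' \<in> \<C>\<close> by blast
      qed (use ne in auto)
      have "finite ((\<lambda>(x, y). c x y) ` (X \<times> X))" "(\<lambda>(x, y). c x y) ` (X \<times> X) \<subseteq> \<Union>\<C>"
        using \<open>finite X\<close> c(1) by auto
      from finite_sub[OF this] obtain I where I: "I \<in> \<C>" "(\<lambda>(x, y). c x y) ` (X \<times> X) \<subseteq> I" by blast
      have sX: "s *s x \<in> IM I" if "x \<in> X" for x
        unfolding IM_def mem_Collect_eq
      proof (rule exI[of _ "c x"], rule conjI[OF _ c(2)])
        show "\<forall>y\<in>X. c x y \<in> I" using I(2) that by force
      qed
      have "N0 \<subseteq> IM I" using IM_N0[OF _ ideals[OF I(1)]] by (rule subsetI)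
      from by_gens[OF IM_sub[OF ideals[OF I(1)]] this sX] have "s *s v \<in> IM I" for v .
      moreover have "I \<in> \<I>" using ch I(1) by (auto simp: subset.chain_def)
      then have "\<exists>v. s *s v \<notin> IM I" using s by (simp add: \<I>_def)
      ultimately show False by simp
    qed
    ultimately show ?thesis by (simp add: \<I>_def)
  qed
  ultimately obtain P where P\<I>: "P \<in> \<I>" and max: "\<And>I. I \<in> \<I> \<Longrightarrow> P \<subseteq> I \<Longrightarrow> I = P"
    using subset_Zorn_nonempty[of \<I>] by blast
  have P: "ideal_set P" and P_S: "\<And>s. s \<in> S \<Longrightarrow> \<exists>v. s *s v \<notin> IM P" using P\<I> by (auto simp: \<I>_def)
  note sub = IM_sub[OF P]
  have S1: "1 \<in> S" and SS: "\<And>x y. x \<in> S \<Longrightarrow> y \<in> S \<Longrightarrow> x * y \<in> S"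
    using S by (auto simp: mult_closed_def)
  have killed: "\<exists>s\<in>S. \<forall>v. \<exists>y. s *s v - a *s y \<in> IM P" if a: "a \<notin> P" for a
  proof -
    define I where "I = {p + b * a | p b. p \<in> P}"
    have mem: "p + b * a \<in> I" if "p \<in> P" for p b using that by (auto simp: I_def)
    have I: "ideal_set I"
      unfolding ideal_set_def
    proof (intro conjI ballI allI)
      show "0 \<in> I" using mem[OF ideal_closed(1)[OF P], of 0] by simp
    next
      fix x y assume "x \<in> I" "y \<in> I"
      then obtain p b p' b' where "x = p + b * a" "y = p' + b' * a" "p \<in> P" "p' \<in> P"
        by (auto simp: I_def)
      then show "x + y \<in> I"
        using mem[OF ideal_closed(2)[OF P], of p p' "b + b'"] by (simp add: algebra_simps)
    next
      fix c x assume "x \<in> I"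
      then obtain p b where "x = p + b * a" "p \<in> P" by (auto simp: I_def)
      then show "c * x \<in> I"
        using mem[OF ideal_closed(4)[OF P], of p c "c * b"] by (simp add: algebra_simps)
    qed
    have "P \<subseteq> I" using mem[of _ 0] by auto
    moreover have "a \<in> I" using mem[OF ideal_closed(1)[OF P], of 1] by simp
    ultimately have "I \<notin> \<I>" using max a by blast
    then obtain s where s: "s \<in> S" "\<And>v. s *s v \<in> IM I" using I by (auto simp: \<I>_def)
    have "\<exists>y. s *s v - a *s y \<in> IM P" for v
    proof -
      obtain c where c: "\<forall>x\<in>X. c x \<in> I" "s *s v - (\<Sum>x\<in>X. c x *s x) \<in> N0"
        using s(2)[of v] by (auto simp: IM_def)
      then have "\<forall>x\<in>X. \<exists>p b. c x = p + b * a \<and> p \<in> P" by (auto simp: I_def)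
      then obtain p b where pb: "\<And>x. x \<in> X \<Longrightarrow> c x = p x + b x * a" "\<And>x. x \<in> X \<Longrightarrow> p x \<in> P"
        by metis
      have "(\<Sum>x\<in>X. c x *s x) = (\<Sum>x\<in>X. p x *s x) + a *s (\<Sum>x\<in>X. b x *s x)"
        by (simp add: pb scale_left_distrib sum.distrib scale_sum_right mult.commute)
      then have "s *s v - a *s (\<Sum>x\<in>X. b x *s x) - (\<Sum>x\<in>X. p x *s x) \<in> N0"
        using c(2) by (simp add: algebra_simps)
      then show ?thesis unfolding IM_def using pb(2) by blast
    qed
    then show ?thesis using s(1) by blast
  qed
  have prime: "a \<in> P \<or> b \<in> P" if ab: "a * b \<in> P" for a b
  proof (rule ccontr)
    assume "\<not> ?thesis"
    then obtain s s' where s: "s \<in> S" "\<And>v. \<exists>y. s *s v - a *s y \<in> IM P"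
      "s' \<in> S" "\<And>v. \<exists>y. s' *s v - b *s y \<in> IM P"
      using killed by metis
    have "(s' * s) *s v \<in> IM P" for v
    proof -
      obtain y where y: "s *s v - a *s y \<in> IM P" using s by blast
      obtain y' where y': "s' *s y - b *s y' \<in> IM P" using s by blast
      have "s' *s (s *s v - a *s y) + a *s (s' *s y - b *s y') + (a * b) *s y' \<in> IM P"
        by (rule subspace_add[OF sub subspace_add[OF sub subspace_scale[OF sub y] subspace_scale[OF sub y']]
          IM_scale[OF ab P]])
      then show ?thesis by (simp add: algebra_simps)
    qed
    then show False using P_S SS[OF s(3,1)] by blast
  qed
  have one: "1 \<notin> P" using IM_scale[OF _ P, of 1] P_S[OF S1] by auto
  define N where "N = {v. \<exists>s. s \<notin> P \<and> s *s v \<in> IM P}"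
  have N: "subspace N"
  proof (rule subspaceI)
    show "0 \<in> N" unfolding N_def using one subspace_0[OF sub] by auto
  next
    fix x y assume "x \<in> N" "y \<in> N"
    then obtain s s' where s: "s \<notin> P" "s *s x \<in> IM P" "s' \<notin> P" "s' *s y \<in> IM P"
      by (auto simp: N_def)
    have "s' *s (s *s x) + s *s (s' *s y) \<in> IM P"
      by (rule subspace_add[OF sub subspace_scale[OF sub s(2)] subspace_scale[OF sub s(4)]])
    then have "(s * s') *s (x + y) \<in> IM P" by (simp add: algebra_simps)
    then show "x + y \<in> N" unfolding N_def using prime s by blast
  next
    fix c x assume "x \<in> N"
    then obtain s where s: "s \<notin> P" "s *s x \<in> IM P" by (auto simp: N_def)
    then have "c *s (s *s x) \<in> IM P" by (simp only: subspace_scale[OF sub])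
    then have "s *s (c *s x) \<in> IM P" by (simp add: mult.commute)
    then show "c *s x \<in> N" unfolding N_def using s by blast
  qed
  have IM_N: "IM P \<subseteq> N" unfolding N_def using one by auto
  have "N \<noteq> UNIV"
  proof
    assume "N = UNIV"
    then have "\<exists>s. s \<notin> P \<and> s *s x \<in> IM P" for x by (auto simp: N_def)
    then obtain s where s: "\<And>x. s x \<notin> P" "\<And>x. s x *s x \<in> IM P" by metis
    define a where "a = (\<Prod>x\<in>X. s x)"
    have a: "a \<notin> P" unfolding a_def using \<open>finite X\<close>
      by (induction X rule: finite_induct) (use one s prime in auto)
    have aV: "a *s v \<in> IM P" for v
    proof (rule by_gens[OF sub])
      fix x assume "x \<in> X"
      then have "a = (\<Prod>y\<in>X - {x}. s y) * s x"
        unfolding a_def using \<open>finite X\<close> by (simp add: prod.remove mult.commute)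
      then show "a *s x \<in> IM P" using subspace_scale[OF sub s(2)] by (metis scale_scale)
    qed (use IM_N0 P in blast)
    obtain r where r: "r \<in> S" "\<And>v. \<exists>y. r *s v - a *s y \<in> IM P" using killed[OF a] by blast
    have "r *s v \<in> IM P" for v
    proof -
      obtain y where "r *s v - a *s y \<in> IM P" using r by blast
      then show ?thesis using subspace_add[OF sub _ aV[of y]] by fastforce
    qed
    then show False using P_S r(1) by blast
  qed
  moreover have "S \<inter> P = {}" using IM_scale P P_S by blast
  moreover have "a \<in> P \<or> v \<in> N" if "a *s v \<in> N" for a v
    using that prime unfolding N_def by fastforce
  moreover have "f ` N \<subseteq> N" if f: "linear_map f" "f ` N0 \<subseteq> N0" for f
  proof -
    have "f v \<in> IM P" if v: "v \<in> IM P" for v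
    proof -
      obtain c where c: "\<forall>x\<in>X. c x \<in> P" "v - (\<Sum>x\<in>X. c x *s x) \<in> N0"
        using v by (auto simp: IM_def)
      then have "f (v - (\<Sum>x\<in>X. c x *s x)) \<in> IM P" using f IM_N0 P by blast
      then have "f v - (\<Sum>x\<in>X. c x *s f x) \<in> IM P" by (simp add: linear_mapD[OF f(1)])
      moreover have "(\<Sum>x\<in>X. c x *s f x) \<in> IM P"
        using c IM_scale P by (intro subspace_sum[OF sub]) auto
      ultimately show ?thesis using subspace_add[OF sub] by fastforce
    qed
    then show ?thesis unfolding N_def using linear_mapD(2)[OF f(1)] by fastforce
  qed
  ultimately show ?thesis
    using prime one P N IM_N IM_N0[OF _ P] IM_scale[OF _ P]
    by (intro exI[of _ P] exI[of _ N]) (auto simp: prime_ideal_set_def)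
qed

section \<open>Polynomials acting through an endomorphism\<close>

text \<open>
The value at \<open>v\<close> of the polynomial \<open>f\<close> in the operator \<open>z\<close>, in Horner form.
\<close>

definition poly_action :: "('b \<Rightarrow> 'b) \<Rightarrow> 'a poly \<Rightarrow> 'b \<Rightarrow> 'b"
  where "poly_action z f v = fold_coeffs (\<lambda>a w. a *s v + z w) f 0"

lemma poly_action_pCons:
  assumes "linear_map z"
  shows "poly_action z (pCons a f) v = a *s v + z (poly_action z f v)"
  by (cases "a = 0 \<and> f = 0") (auto simp: poly_action_def linear_mapD(3)[OF assms])

lemma poly_action_0 [simp]: "poly_action z 0 v = 0"
  by (simp add: poly_action_def)

lemma poly_action_add:
  assumes "linear_map z"
  shows "poly_action z (f + g) v = poly_action z f v + poly_action z g v"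
  by (induction f g rule: poly_induct2)
    (simp_all add: poly_action_pCons[OF assms] linear_mapD[OF assms] scale_left_distrib algebra_simps)

lemma poly_action_smult:
  assumes "linear_map z"
  shows "poly_action z (smult a f) v = a *s poly_action z f v"
  by (induction f) (simp_all add: poly_action_pCons[OF assms] linear_mapD[OF assms] scale_right_distrib)

lemma poly_action_mult:
  assumes "linear_map z"
  shows "poly_action z (f * g) v = poly_action z f (poly_action z g v)"
  by (induction f)
    (simp_all add: poly_action_pCons[OF assms] poly_action_add[OF assms] poly_action_smult[OF assms])

lemma poly_action_X_power:
  assumes "linear_map z"
  shows "poly_action z ([:0, 1:] ^ k) v = (z ^^ k) v"
proof (induction k)
  case 0
  show ?case using poly_action_pCons[OF assms, of 1 0 v] by (simp add: linear_mapD[OF assms] one_pCons)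
next
  case (Suc k)
  then show ?case
    by (simp add: poly_action_mult[OF assms] poly_action_pCons[OF assms] linear_mapD[OF assms])
qed

lemma poly_action_const:
  assumes "linear_map z"
  shows "poly_action z [:a:] v = a *s v"
  by (simp add: poly_action_pCons[OF assms] linear_mapD[OF assms])

lemma poly_action_sum:
  assumes "linear_map z"
  shows "poly_action z (sum f I) v = (\<Sum>i\<in>I. poly_action z (f i) v)"
  by (induction I rule: infinite_finite_induct) (simp_all add: poly_action_add[OF assms])

lemma poly_action_subspace:
  assumes z: "linear_map z" and N: "subspace N" "z ` N \<subseteq> N" and "v \<in> N"
  shows "poly_action z f v \<in> N"
  by (induction f)
    (use assms subspace_0 subspace_add subspace_scale in \<open>auto simp: poly_action_pCons[OF z]\<close>)

text \<open>
The polynomials \<open>f\<close> with \<open>f(z) x \<in> N\<close> form an ideal \<open>J\<close> that meets the constants in \<open>P\<close>. Working modulo \<open>J\<close>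
turns the operator \<open>z\<close> into an element of a commutative ring, with inverse \<open>z\<^sup>r\<^sup>-\<^sup>1 t\<^sup>d\<close>.
\<close>

lemma operator_root_integrality:
  fixes N :: "'b set"
  assumes N: "subspace N" and PN: "\<And>a v. a \<in> P \<Longrightarrow> a *s v \<in> N"
    and tf: "\<And>a. a *s x \<in> N \<Longrightarrow> a \<in> P"
    and z: "linear_map z" "z ` N \<subseteq> N" and zr: "\<And>v. (z ^^ r) v - u ^ d *s v \<in> N"
    and D: "unital_subring D" and u: "u \<in> D" "t * u = 1"
    and kap: "kap \<in> D" "h0 \<in> D" "kap ^ e - u * h0 \<in> P"
    and r: "e * d * (m + 1) \<le> r" "0 < e" "0 < d"
    and rel: "(\<Sum>b\<le>m. c b *s (z ^^ b) x) \<in> N" and m0: "m0 \<le> m"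
    and below: "\<And>b. b < m0 \<Longrightarrow> c' b \<in> D \<and> c b - kap * c' b \<in> P"
    and at: "c0 \<in> D" "c' m0 \<in> D" "c m0 - (c0 + kap * c' m0) \<in> P"
    and above: "\<And>b. m0 < b \<Longrightarrow> b \<le> m \<Longrightarrow> c b \<in> D"
  shows "\<exists>K. \<exists>h\<in>D. c0 ^ K + u * h \<in> P"
proof -
  note act = poly_action_add[OF z(1)] poly_action_mult[OF z(1)] poly_action_X_power[OF z(1)]
    poly_action_const[OF z(1)] poly_action_sum[OF z(1)]
  define J where "J = {f. poly_action z f x \<in> N}"
  have J: "ideal_set J"
    unfolding ideal_set_def J_def
    using poly_action_subspace[OF z(1) N z(2)] subspace_0[OF N] subspace_add[OF N] by (auto simp: act)
  have const: "[:a:] \<in> J \<longleftrightarrow> a \<in> P" for a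
    using PN tf by (auto simp: J_def act)
  let ?Z = "[:0, 1:] :: 'a poly"
  have cp: "[:a:] ^ k = [:a ^ k:]" for a :: 'a and k
    by (induction k) (simp_all add: one_pCons)
  have minus: "poly_action z (f - g) v = poly_action z f v - poly_action z g v" for f g v
    using act(1)[of "f - g" g v] by (simp add: algebra_simps)
  have Zr: "?Z ^ r - [:u:] ^ d \<in> J"
    using zr[of x] by (simp add: J_def minus act cp)
  have rpos: "0 < r" using r by (auto intro: Nat.gr0I)
  have "\<exists>K. \<exists>h\<in>(\<lambda>a. [:a:]) ` D. [:c0:] ^ K + [:u:] * h \<in> J"
  proof (rule root_relation_integrality[where r = r and d = d and e = e and m = m and m0 = m0])
    show "unital_subring ((\<lambda>a. [:a:]) ` D)"
      unfolding unital_subring_def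
      using subring_closed[OF D] by (auto simp: one_pCons image_iff)
    show "?Z * (?Z ^ (r - 1) * [:t ^ d:]) - 1 \<in> J"
    proof -
      have "[:t ^ d:] * (?Z ^ r - [:u:] ^ d) \<in> J" by (rule ideal_closed(4)[OF J Zr])
      moreover have "[:t ^ d:] * [:u:] ^ d = 1" using u(2) by (simp add: cp one_pCons mult.commute flip: power_mult_distrib)
      moreover have "?Z ^ r = ?Z * ?Z ^ (r - 1)" using rpos by (cases r) auto
      ultimately show ?thesis by (simp only: right_diff_distrib ac_simps)
    qed
    show "[:kap:] ^ e - [:u:] * [:h0:] \<in> J" using kap const by (simp add: cp mult.commute)
    show "(\<Sum>b\<le>m. [:c b:] * ?Z ^ b) \<in> J"
      using rel by (simp add: J_def act del: mult_pCons_left)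
    show "[:c' b:] \<in> (\<lambda>a. [:a:]) ` D \<and> [:c b:] - [:kap:] * [:c' b:] \<in> J" if "b < m0" for b
      using below[OF that] const by (simp add: mult.commute)
    show "[:c m0:] - ([:c0:] + [:kap:] * [:c' m0:]) \<in> J" using at const by (simp add: mult.commute)
  qed (use J u kap r at m0 above Zr in auto)
  then obtain K h where "h \<in> D" "[:c0:] ^ K + [:u:] * [:h:] \<in> J" by blast
  then have "c0 ^ K + u * h \<in> P" using const by (simp add: cp mult.commute)
  then show ?thesis using \<open>h \<in> D\<close> by blast
qed

end

section \<open>Laurent polynomials\<close>

abbreviation "lookup \<equiv> Poly_Mapping.lookup"
abbreviation "keys \<equiv> Poly_Mapping.keys"
abbreviation "single \<equiv> Poly_Mapping.single"

lemma poly_mapping_sum_single: "(\<Sum>e\<in>keys p. single e (lookup p e)) = p"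
proof (rule poly_mapping_eqI)
  fix k
  have "lookup (\<Sum>e\<in>keys p. single e (lookup p e)) k
      = (\<Sum>e\<in>keys p. if e = k then lookup p e else 0)"
    unfolding Poly_Mapping.lookup_sum by (rule sum.cong) (auto simp: lookup_single when_def)
  also have "\<dots> = lookup p k" by (simp add: in_keys_iff)
  finally show "lookup (\<Sum>e\<in>keys p. single e (lookup p e)) k = lookup p k" .
qed

lemma poly_mapping_additive_induct [case_names zero single add]:
  fixes p :: "'a \<Rightarrow>\<^sub>0 'b::comm_monoid_add"
  assumes "P 0" "\<And>e a. P (single e a)" "\<And>p q. P p \<Longrightarrow> P q \<Longrightarrow> P (p + q)"
  shows "P p"
proof -
  have "P (\<Sum>e\<in>K. single e (lookup p e))" for K
    by (induction K rule: infinite_finite_induct) (simp_all add: assms)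
  then show ?thesis by (metis poly_mapping_sum_single)
qed

lemma lookup_mult_single:
  fixes p :: "'a::ab_group_add \<Rightarrow>\<^sub>0 'b::semiring_1"
  shows "lookup (p * single a 1) e = lookup p (e - a)"
proof (induction p rule: poly_mapping_additive_induct)
  case (single b c)
  then show ?case by (auto simp: mult_single lookup_single when_def algebra_simps)
qed (simp_all add: lookup_add distrib_right)

definition var_power :: "nat \<Rightarrow> int \<Rightarrow> laurent"
  where "var_power k j = single (single k j) 1"

lemma var_power_0 [simp]: "var_power k 0 = 1"
  by (simp add: var_power_def)

lemma var_power_add: "var_power k (i + j) = var_power k i * var_power k j"
  by (simp add: var_power_def mult_single single_add)

lemma var_power_power: "var_power k j ^ n = var_power k (j * int n)"
  by (induction n) (simp_all add: algebra_simps flip: var_power_add)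

lemma lookup_mult_var_power: "lookup (p * var_power k j) e = lookup p (e - single k j)"
  by (simp add: var_power_def lookup_mult_single)

definition laurents :: "nat set \<Rightarrow> laurent set"
  where "laurents Z = {p. \<forall>e\<in>keys p. keys e \<subseteq> Z}"

lemma carrier_laurent_ring: "carrier (laurent_ring n) = laurents {1..n}"
  by (simp add: laurent_ring_def laurents_def)

text \<open>
For \<open>s = 1\<close> or \<open>s = - 1\<close> this is the ring of polynomials in \<open>u = t\<^sub>i\<^sup>-\<^sup>s\<close> over the Laurent polynomials in the
variables with index in \<open>Z\<close>. The sign lets one argument treat \<open>t\<^sub>i\<close> and \<open>t\<^sub>i\<^sup>-\<^sup>1\<close> at the same time.
\<close>

definition half_laurents :: "nat set \<Rightarrow> nat \<Rightarrow> int \<Rightarrow> laurent set"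
  where "half_laurents Z i s = {p. \<forall>e\<in>keys p. keys e \<subseteq> insert i Z \<and> s * lookup e i \<le> 0}"

lemma subring_keys:
  fixes Q :: "(nat \<Rightarrow>\<^sub>0 int) \<Rightarrow> bool"
  assumes "Q 0" "\<And>e f. Q e \<Longrightarrow> Q f \<Longrightarrow> Q (e + f)"
  shows "unital_subring {p :: laurent. \<forall>e\<in>keys p. Q e}"
  unfolding unital_subring_def
proof (safe)
  fix e :: "nat \<Rightarrow>\<^sub>0 int" assume "e \<in> keys (1 :: laurent)"
  then show "Q e" using assms by simp
next
  fix x y :: laurent and e
  assume "\<forall>e\<in>keys x. Q e" "\<forall>e\<in>keys y. Q e" "e \<in> keys (x - y)"
  then show "Q e" using keys_diff[of x y] by blast
next
  fix x y :: laurent and e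
  assume "\<forall>e\<in>keys x. Q e" "\<forall>e\<in>keys y. Q e" "e \<in> keys (x * y)"
  then show "Q e" using keys_mult[of x y] assms(2) by blast
qed

lemma subring_laurents: "unital_subring (laurents Z)"
  unfolding laurents_def
proof (rule subring_keys)
  fix e f :: "nat \<Rightarrow>\<^sub>0 int" assume "keys e \<subseteq> Z" "keys f \<subseteq> Z"
  then show "keys (e + f) \<subseteq> Z" using Poly_Mapping.keys_add[of e f] by blast
qed simp

lemma subring_half_laurents: "unital_subring (half_laurents Z i s)"
  unfolding half_laurents_def
proof (rule subring_keys)
  fix e f :: "nat \<Rightarrow>\<^sub>0 int"
  assume "keys e \<subseteq> insert i Z \<and> s * lookup e i \<le> 0" "keys f \<subseteq> insert i Z \<and> s * lookup f i \<le> 0"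
  then show "keys (e + f) \<subseteq> insert i Z \<and> s * lookup (e + f) i \<le> 0"
    using Poly_Mapping.keys_add[of e f] by (auto simp: lookup_add distrib_left)
qed simp

lemma laurents_mono: "Z \<subseteq> Z' \<Longrightarrow> laurents Z \<subseteq> laurents Z'"
  by (auto simp: laurents_def)

lemma half_laurents_mono: "Z \<subseteq> Z' \<Longrightarrow> half_laurents Z i s \<subseteq> half_laurents Z' i s"
  by (auto simp: half_laurents_def)

lemma half_laurents_subset: "half_laurents Z i s \<subseteq> laurents (insert i Z)"
  by (auto simp: half_laurents_def laurents_def)

lemma laurents_subset_half:
  assumes "i \<notin> Z"
  shows "laurents Z \<subseteq> half_laurents Z i s"
proof
  fix p assume p: "p \<in> laurents Z"
  have "keys e \<subseteq> insert i Z \<and> s * lookup e i \<le> 0" if "e \<in> keys p" for e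
  proof -
    have "keys e \<subseteq> Z" using p that by (simp add: laurents_def)
    moreover from this have "lookup e i = 0" using assms by (auto simp: in_keys_iff)
    ultimately show ?thesis by auto
  qed
  then show "p \<in> half_laurents Z i s" by (simp add: half_laurents_def)
qed

lemma var_power_laurents: "k \<in> Z \<Longrightarrow> var_power k j \<in> laurents Z"
  by (auto simp: var_power_def laurents_def)

lemma var_power_half_laurents: "s * j \<le> 0 \<Longrightarrow> var_power i j \<in> half_laurents Z i s"
  by (auto simp: var_power_def half_laurents_def)

lemma of_int_single: "(of_int a :: laurent) = single 0 a"
  by (simp flip: single_of_int)

lemma of_int_laurents: "of_int a \<in> laurents Z"
  unfolding of_int_single laurents_def by auto

lemma lookup_of_int_0 [simp]: "lookup (of_int a :: laurent) 0 = a"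
  unfolding of_int_single by simp

lemma lookup_of_int_mult: "lookup (of_int a * p :: laurent) e = a * lookup p e"
proof (induction p rule: poly_mapping_additive_induct)
  case (single b c)
  then show ?case unfolding of_int_single by (simp add: mult_single lookup_single when_def)
qed (simp_all add: lookup_add distrib_left)

lemma laurents_empty:
  assumes "c \<in> laurents {}"
  shows "c = of_int (lookup c 0)"
proof (rule poly_mapping_eqI)
  fix e
  show "lookup c e = lookup (of_int (lookup c 0)) e"
  proof (cases "e = 0")
    case False
    then have "e \<notin> keys c" using assms by (auto simp: laurents_def)
    then show ?thesis using False unfolding of_int_single by (simp add: in_keys_iff lookup_single)
  qed simp
qed

text \<open>
The coefficient of \<open>t\<^sub>k\<^sup>j\<close>, a Laurent polynomial in the other variables.
\<close>

definition slice :: "nat \<Rightarrow> laurent \<Rightarrow> int \<Rightarrow> laurent"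
  where "slice k p j = (\<Sum>e | e \<in> keys p \<and> lookup e k = j. single (e - single k j) (lookup p e))"

lemma lookup_slice:
  "lookup (slice k p j) b = (if lookup b k = 0 then lookup p (b + single k j) else 0)"
proof -
  have "lookup (slice k p j) b
      = (\<Sum>e | e \<in> keys p \<and> lookup e k = j. if e = b + single k j then lookup p e else 0)"
    unfolding slice_def Poly_Mapping.lookup_sum
    by (rule sum.cong) (auto simp: lookup_single when_def algebra_simps)
  also have "\<dots> = (if lookup b k = 0 then lookup p (b + single k j) else 0)"
    by (auto simp: lookup_add in_keys_iff)
  finally show ?thesis .
qed

lemma keys_slice: "b \<in> keys (slice k p j) \<longleftrightarrow> lookup b k = 0 \<and> b + single k j \<in> keys p"
  by (simp add: in_keys_iff lookup_slice)

lemma sum_slices: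
  assumes "finite F" "\<And>e. e \<in> keys p \<Longrightarrow> lookup e k \<in> F"
  shows "p = (\<Sum>j\<in>F. slice k p j * var_power k j)"
proof (rule poly_mapping_eqI)
  fix e
  have "lookup (\<Sum>j\<in>F. slice k p j * var_power k j) e
      = (\<Sum>j\<in>F. if j = lookup e k then lookup p e else 0)"
    unfolding Poly_Mapping.lookup_sum
    by (rule sum.cong) (auto simp: lookup_mult_var_power lookup_slice lookup_minus)
  also have "\<dots> = lookup p e" using assms by (auto simp: in_keys_iff)
  finally show "lookup p e = lookup (\<Sum>j\<in>F. slice k p j * var_power k j) e" by simp
qed

lemma keys_subset_slice:
  fixes b :: "nat \<Rightarrow>\<^sub>0 int"
  assumes "lookup b k = 0" "keys (b + single k j) \<subseteq> insert k Z"
  shows "keys b \<subseteq> Z"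
proof
  fix l assume l: "l \<in> keys b"
  then have "l \<noteq> k" using assms by (auto simp: in_keys_iff)
  then have "l \<in> keys (b + single k j)" using l by (simp add: in_keys_iff lookup_add lookup_single)
  then show "l \<in> Z" using assms \<open>l \<noteq> k\<close> by blast
qed

lemma slice_laurents:
  assumes "p \<in> laurents (insert k Z)"
  shows "slice k p j \<in> laurents Z"
  unfolding laurents_def
proof (intro CollectI ballI)
  fix e assume "e \<in> keys (slice k p j)"
  then have e: "lookup e k = 0" "e + single k j \<in> keys p" by (auto simp: keys_slice)
  then have "keys (e + single k j) \<subseteq> insert k Z" using assms by (simp add: laurents_def)
  then show "keys e \<subseteq> Z" by (rule keys_subset_slice[OF e(1)])
qed

lemma slice_half_laurents:
  assumes "p \<in> half_laurents (insert k Z) i s" "k \<noteq> i"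
  shows "slice k p j \<in> half_laurents Z i s"
  unfolding half_laurents_def
proof (intro CollectI ballI)
  fix e assume "e \<in> keys (slice k p j)"
  then have e: "lookup e k = 0" "e + single k j \<in> keys p" by (auto simp: keys_slice)
  then have "keys (e + single k j) \<subseteq> insert k (insert i Z)" "s * lookup (e + single k j) i \<le> 0"
    using assms(1) by (auto simp: half_laurents_def)
  then show "keys e \<subseteq> insert i Z \<and> s * lookup e i \<le> 0"
    using keys_subset_slice[OF e(1)] assms(2) by (auto simp: lookup_add lookup_single)
qed

lemma laurents_expansion:
  assumes "p \<in> laurents (insert k Z)"
  shows "\<exists>F q. finite F \<and> (\<forall>j\<in>F. q j \<in> laurents Z) \<and> p = (\<Sum>j\<in>F. q j * var_power k j)"
  using sum_slices[of "(\<lambda>e. lookup e k) ` keys p" p k] slice_laurents[OF assms]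
  by (intro exI[of _ "(\<lambda>e. lookup e k) ` keys p"] exI[of _ "slice k p"]) auto

section \<open>Algebraic dependence modulo a prime ideal\<close>

text \<open>
The class of \<open>t\<^sub>k\<close> modulo \<open>P\<close> is transcendental over the image of \<open>laurents Z\<close>.
\<close>

definition transcendental_over :: "laurent set \<Rightarrow> nat set \<Rightarrow> nat \<Rightarrow> bool"
  where "transcendental_over P Z k \<longleftrightarrow> (\<forall>F b. finite F \<longrightarrow> (\<forall>j\<in>F. b j \<in> laurents Z) \<longrightarrow>
    (\<Sum>j\<in>F. b j * var_power k j) \<in> P \<longrightarrow> (\<forall>j\<in>F. b j \<in> P))"

lemma transcendental_overD:
  assumes "transcendental_over P Z k" "finite F" "\<forall>j\<in>F. b j \<in> laurents Z"
    and "(\<Sum>j\<in>F. b j * var_power k j) \<in> P" "j \<in> F"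
  shows "b j \<in> P"
  using assms unfolding transcendental_over_def by blast

text \<open>
Dropping the terms with coefficient in \<open>P\<close> and multiplying by a power of the unit gives a relation of
the shape required by \<open>gspan_eliminate_unit\<close>.
\<close>

lemma shift_relation:
  fixes T :: "int \<Rightarrow> 'a::comm_ring_1"
  assumes P: "ideal_set P" and T: "T 0 = 1" "\<And>i j. T (i + j) = T i * T j"
    and B: "0 \<in> B" and F: "finite F" "\<And>j. j \<in> F \<Longrightarrow> b j \<in> B" "(\<Sum>j\<in>F. b j * T j) \<in> P"
    and ex: "j0 \<in> F" "b j0 \<notin> P"
  shows "\<exists>e b'. (\<forall>j\<le>e. b' j \<in> B) \<and> b' 0 \<in> B - P \<and> b' e \<in> B - P \<and> (\<Sum>j\<le>e. b' j * T (int j)) \<in> P"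
proof -
  define F' where "F' = {j\<in>F. b j \<notin> P}"
  have F': "finite F'" "F' \<noteq> {}" using F ex by (auto simp: F'_def)
  define lo hi where "lo = Min F'" and "hi = Max F'"
  have lohi: "lo \<in> F'" "hi \<in> F'" "\<And>j. j \<in> F' \<Longrightarrow> lo \<le> j \<and> j \<le> hi"
    using F' by (auto simp: lo_def hi_def)
  define b' where "b' j = (if lo + int j \<in> F' then b (lo + int j) else 0)" for j
  define e where "e = nat (hi - lo)"
  have "(\<Sum>j\<in>F - F'. b j * T j) \<in> P"
    by (rule ideal_sum[OF P], rule ideal_closed(5)[OF P]) (auto simp: F'_def)
  moreover have "(\<Sum>j\<in>F. b j * T j) = (\<Sum>j\<in>F - F'. b j * T j) + (\<Sum>j\<in>F'. b j * T j)"
    by (rule sum.subset_diff) (auto simp: F'_def F)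
  ultimately have "(\<Sum>j\<in>F'. b j * T j) \<in> P"
    using F(3) ideal_closed(3)[OF P, of "\<Sum>j\<in>F. b j * T j" "\<Sum>j\<in>F - F'. b j * T j"] by simp
  then have "T (- lo) * (\<Sum>j\<in>F'. b j * T j) \<in> P" by (rule ideal_closed(4)[OF P])
  also have "T (- lo) * (\<Sum>j\<in>F'. b j * T j) = (\<Sum>j\<in>F'. b j * T (j - lo))"
    by (simp add: sum_distrib_left algebra_simps diff_conv_add_uminus T del: add_uminus_conv_diff)
  also have "\<dots> = (\<Sum>l\<in>(\<lambda>j. nat (j - lo)) ` F'. b' l * T (int l))"
    by (subst sum.reindex) (use lohi in \<open>force simp: inj_on_def b'_def intro!: sum.cong\<close>)+
  also have "\<dots> = (\<Sum>l\<le>e. b' l * T (int l))"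
  proof (rule sum.mono_neutral_left)
    show "(\<lambda>j. nat (j - lo)) ` F' \<subseteq> {..e}"
      unfolding e_def using lohi(3) by (auto intro!: nat_mono diff_right_mono)
    show "\<forall>l\<in>{..e} - (\<lambda>j. nat (j - lo)) ` F'. b' l * T (int l) = 0"
    proof
      fix l assume l: "l \<in> {..e} - (\<lambda>j. nat (j - lo)) ` F'"
      then have "lo + int l \<notin> F'" by (force simp: image_iff)
      then show "b' l * T (int l) = 0" by (simp add: b'_def)
    qed
  qed simp
  finally have "(\<Sum>l\<le>e. b' l * T (int l)) \<in> P" .
  moreover have "lo + int e = hi" using lohi by (auto simp: e_def)
  moreover have "b' j \<in> B" for j using B F by (auto simp: b'_def F'_def)
  moreover have "b' 0 \<notin> P" "b' e \<notin> P"
    using lohi(1,2) \<open>lo + int e = hi\<close> by (simp_all add: b'_def) (simp_all add: F'_def)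
  ultimately show ?thesis
    by (intro exI[of _ e] exI[of _ b']) simp
qed

lemma algebraic_relation:
  assumes P: "ideal_set P" and "\<not> transcendental_over P Z k"
  shows "\<exists>e b. (\<forall>j\<le>e. b j \<in> laurents Z) \<and> b 0 \<in> laurents Z - P \<and> b e \<in> laurents Z - P
    \<and> (\<Sum>j\<le>e. b j * var_power k (int j)) \<in> P"
proof -
  obtain F b j0 where "finite F" "\<And>j. j \<in> F \<Longrightarrow> b j \<in> laurents Z"
    "(\<Sum>j\<in>F. b j * var_power k j) \<in> P" "j0 \<in> F" "b j0 \<notin> P"
    using assms(2) unfolding transcendental_over_def by blast
  then show ?thesis
    using shift_relation[OF P, of "var_power k" "laurents Z" F b j0]
      subring_closed(2)[OF subring_laurents]
    by (simp add: var_power_add)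
qed

text \<open>
The variables in the list, together with \<open>t\<^sub>i\<close> as a possibly algebraic bottom element, are added one at a
time as transcendental elements. A list of maximal length is thus a transcendence basis of the
residue ring relative to \<open>t\<^sub>i\<close>.
\<close>

fun tower :: "laurent set \<Rightarrow> nat \<Rightarrow> nat list \<Rightarrow> bool" where
  "tower P i [] \<longleftrightarrow> True"
| "tower P i (k # ks) \<longleftrightarrow> k \<notin> insert i (set ks) \<and> transcendental_over P (insert i (set ks)) k \<and> tower P i ks"

lemma tower_distinct: "tower P i ks \<Longrightarrow> distinct ks \<and> i \<notin> set ks"
  by (induction ks) auto

lemma maximal_tower:
  assumes "finite W"
  shows "\<exists>ks. tower P i ks \<and> set ks \<subseteq> W \<and>
    (\<forall>k\<in>W - insert i (set ks). \<not> transcendental_over P (insert i (set ks)) k)"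
proof -
  define Q where "Q ks \<longleftrightarrow> tower P i ks \<and> set ks \<subseteq> W" for ks
  have "length ks \<le> card W" if "Q ks" for ks
    using that tower_distinct[of P i ks] assms card_mono[of W "set ks"]
    by (auto simp: Q_def distinct_card)
  moreover have "Q []" by (simp add: Q_def)
  ultimately have "\<exists>ks. Q ks \<and> (\<forall>ks'. Q ks' \<longrightarrow> length ks' \<le> length ks)"
    by (intro ex_has_greatest_nat[where b = "Suc (card W)"]) (auto simp: less_Suc_eq_le)
  then obtain ks where ks: "Q ks" "\<And>ks'. Q ks' \<Longrightarrow> length ks' \<le> length ks" by blast
  have "\<not> transcendental_over P (insert i (set ks)) k" if "k \<in> W - insert i (set ks)" for k
  proof
    assume "transcendental_over P (insert i (set ks)) k"
    then have "Q (k # ks)" using ks(1) that by (simp add: Q_def)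
    then show False using ks(2) by fastforce
  qed
  then show ?thesis using ks(1) by (auto simp: Q_def)
qed

text \<open>
Membership in \<open>P\<close> can be tested on the coefficients with respect to the variables of the tower, one
variable after the other. What remains is a statement about integers and \<open>t\<^sub>i\<close>.
\<close>

lemma tower_coefficients:
  assumes P: "ideal_set P" and "tower P i ks"
    and "c \<in> laurents (set ks)" "h \<in> half_laurents (set ks) i s"
    and "c + var_power i j * h \<in> P"
  shows "\<exists>h0\<in>half_laurents {} i s. of_int (lookup c b) + var_power i j * h0 \<in> P"
  using assms(2-)
proof (induction ks arbitrary: c h b)
  case Nil
  show ?case
  proof (cases "b = 0")
    case True
    have "c \<in> laurents {}" using Nil.prems(2) by simp
    from laurents_empty[OF this, symmetric] have "of_int (lookup c b) = c" unfolding True .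
    then have "of_int (lookup c b) + var_power i j * h \<in> P" using Nil.prems(4) by simp
    then show ?thesis using Nil.prems(3) by auto
  next
    case False
    then have "lookup c b = 0" using Nil by (auto simp: laurents_def in_keys_iff)
    then show ?thesis
      using ideal_closed(1)[OF P] subring_closed(2)[OF subring_half_laurents]
      by (intro bexI[of _ 0]) auto
  qed
next
  case (Cons k ks)
  let ?u = "var_power i j"
  define F where "F = insert (lookup b k) ((\<lambda>e. lookup e k) ` (keys c \<union> keys h))"
  have F: "finite F" by (simp add: F_def)
  have c: "c = (\<Sum>l\<in>F. slice k c l * var_power k l)"
    by (rule sum_slices[OF F]) (unfold F_def, blast)
  have h: "h = (\<Sum>l\<in>F. slice k h l * var_power k l)"
    by (rule sum_slices[OF F]) (unfold F_def, blast)
  have sc: "slice k c l \<in> laurents (set ks)" for l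
    using Cons.prems(2) by (intro slice_laurents) simp
  have "k \<noteq> i" using Cons.prems(1) by simp
  then have sh: "slice k h l \<in> half_laurents (set ks) i s" for l
    using Cons.prems(3) by (intro slice_half_laurents) simp_all
  have "c + ?u * h = (\<Sum>l\<in>F. slice k c l * var_power k l) + ?u * (\<Sum>l\<in>F. slice k h l * var_power k l)"
    by (rule arg_cong2[where f = "\<lambda>x y. x + ?u * y", OF c h])
  also have "\<dots> = (\<Sum>l\<in>F. (slice k c l + ?u * slice k h l) * var_power k l)"
    by (simp add: sum_distrib_left distrib_right sum.distrib mult.assoc)
  finally have "(\<Sum>l\<in>F. (slice k c l + ?u * slice k h l) * var_power k l) \<in> P"
    using Cons.prems by simp
  moreover have "\<forall>l\<in>F. slice k c l + ?u * slice k h l \<in> laurents (insert i (set ks))"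
  proof
    fix l
    have "slice k c l \<in> laurents (insert i (set ks))"
      using sc[of l] laurents_mono[of "set ks" "insert i (set ks)"] by auto
    moreover have "slice k h l \<in> laurents (insert i (set ks))"
      using sh[of l] half_laurents_subset by blast
    ultimately show "slice k c l + ?u * slice k h l \<in> laurents (insert i (set ks))"
      using subring_closed(3)[OF subring_laurents
        _ subring_closed(5)[OF subring_laurents var_power_laurents[OF insertI1]]]
      by simp
  qed
  moreover have "transcendental_over P (insert i (set ks)) k" using Cons.prems(1) by simp
  moreover have "lookup b k \<in> F" by (simp add: F_def)
  ultimately have "slice k c (lookup b k) + ?u * slice k h (lookup b k) \<in> P"
    using transcendental_overD[OF _ F, of P _ k "\<lambda>l. slice k c l + ?u * slice k h l"] by blast
  with Cons.prems(1) have "\<exists>h0\<in>half_laurents {} i s.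
      of_int (lookup (slice k c (lookup b k)) (b - single k (lookup b k))) + ?u * h0 \<in> P"
    by (intro Cons.IH[OF _ sc sh]) simp_all
  then show ?case by (simp add: lookup_slice lookup_minus)
qed

section \<open>Divisibility of coefficients by a prime number\<close>

text \<open>
Gauss's lemma for Laurent polynomials. Among the exponents whose coefficients are prime to \<open>p\<close>, take the
largest one of each factor in the linear order on exponent vectors: no other pair has the same sum.
\<close>

lemma prime_dvd_coefficients:
  fixes p :: int and a b :: laurent
  assumes p: "prime p" and a: "\<not> p dvd lookup a e" and b: "\<not> p dvd lookup b f"
  shows "\<exists>g. \<not> p dvd lookup (a * b) g"
proof -
  define reduce where "reduce c = (\<Sum>e | e \<in> keys c \<and> \<not> p dvd lookup c e. single e (lookup c e))" for c :: laurent
  have lookup_reduce: "lookup (reduce c) e = (if p dvd lookup c e then 0 else lookup c e)" for c e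
  proof -
    have "lookup (reduce c) e = (\<Sum>f | f \<in> keys c \<and> \<not> p dvd lookup c f. if f = e then lookup c f else 0)"
      unfolding reduce_def Poly_Mapping.lookup_sum by (rule sum.cong) (auto simp: lookup_single when_def)
    also have "\<dots> = (if p dvd lookup c e then 0 else lookup c e)" by (auto simp: in_keys_iff)
    finally show ?thesis .
  qed
  define divisible where "divisible = (\<lambda>c::laurent. \<forall>e. p dvd lookup c e)"
  have divisible_add: "divisible (x + y)" if "divisible x" "divisible y" for x y using that by (simp add: divisible_def lookup_add)
  have divisible_mult: "divisible (x * y)" if "divisible x" for x y
  proof (induction y rule: poly_mapping_additive_induct)
    case (single e c)
    have "lookup (x * single e c) g = lookup (of_int c * (x * single e 1)) g" for g
      unfolding of_int_single by (simp add: mult.left_commute mult_single)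
    then show ?case using that by (simp add: divisible_def lookup_of_int_mult lookup_mult_single)
  qed (use divisible_add in \<open>auto simp: divisible_def distrib_left\<close>)
  have divisible_reduce: "divisible (c - reduce c)" for c by (simp add: divisible_def lookup_minus lookup_reduce)
  define K where "K c = {e \<in> keys c. \<not> p dvd lookup c e}" for c :: laurent
  have fK: "finite (K c)" for c by (simp add: K_def)
  have "e \<in> K a" "f \<in> K b" using a b by (auto simp: K_def in_keys_iff)
  then have max: "Max (K a) \<in> K a" "Max (K b) \<in> K b" using fK Max_in by blast+
  let ?g = "Max (K a) + Max (K b)"
  have "lookup (reduce a * reduce b) ?g = lookup a (Max (K a)) * lookup b (Max (K b))"
  proof -
    have "reduce a * reduce b
        = (\<Sum>e\<in>K a. \<Sum>f\<in>K b. single (e + f) (lookup a e * lookup b f))"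
      by (simp add: reduce_def K_def sum_product mult_single)
    then have "lookup (reduce a * reduce b) ?g
        = (\<Sum>e\<in>K a. \<Sum>f\<in>K b. lookup a e * lookup b f when e + f = ?g)"
      by (simp add: Poly_Mapping.lookup_sum lookup_single)
    also have "\<dots> = (\<Sum>e\<in>K a. if e = Max (K a) then lookup a e * lookup b (Max (K b)) else 0)"
    proof (rule sum.cong[OF refl])
      fix e assume e: "e \<in> K a"
      have iff: "e + f = ?g \<longleftrightarrow> e = Max (K a) \<and> f = Max (K b)" if "f \<in> K b" for f
        using Max_ge[OF fK e] Max_ge[OF fK that]
          add_less_le_mono[of e "Max (K a)" f "Max (K b)"] add_le_less_mono[of e "Max (K a)" f "Max (K b)"]
        by (auto simp: order_le_less)
      have "(\<Sum>f\<in>K b. lookup a e * lookup b f when e + f = ?g)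
          = (\<Sum>f\<in>K b. if f = Max (K b) then (if e = Max (K a) then lookup a e * lookup b f else 0) else 0)"
        by (rule sum.cong) (auto simp: iff when_def)
      then show "(\<Sum>f\<in>K b. lookup a e * lookup b f when e + f = ?g)
          = (if e = Max (K a) then lookup a e * lookup b (Max (K b)) else 0)"
        using fK max by simp
    qed
    also have "\<dots> = lookup a (Max (K a)) * lookup b (Max (K b))" using fK max by simp
    finally show ?thesis .
  qed
  then have "\<not> p dvd lookup (reduce a * reduce b) ?g"
    using max p by (auto simp: K_def prime_dvd_mult_iff)
  moreover have "divisible (a * b - reduce a * reduce b)"
  proof -
    have "divisible ((a - reduce a) * b + (b - reduce b) * reduce a)"
      by (intro divisible_add divisible_mult divisible_reduce)
    then show ?thesis by (simp add: algebra_simps)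
  qed
  then have "p dvd lookup (a * b) ?g - lookup (reduce a * reduce b) ?g"
    by (simp add: divisible_def lookup_minus)
  ultimately have "\<not> p dvd lookup (a * b) ?g"
    using dvd_diff[of p "lookup (a * b) ?g" "lookup (a * b) ?g - lookup (reduce a * reduce b) ?g"]
    by auto
  then show ?thesis by blast
qed

section \<open>Denominators and leading coefficients modulo a prime ideal\<close>

text \<open>
A nonzero element of an algebraic extension divides a nonzero element of the base: take a linear
relation between its powers and cancel the lowest power.
\<close>

lemma algebraic_inverse:
  assumes P: "prime_ideal_set P"
    and b: "\<And>j. j \<le> e \<Longrightarrow> b j \<in> laurents Z" "b 0 \<in> laurents Z - P" "b e \<in> laurents Z - P"
    and rel: "(\<Sum>j\<le>e. b j * var_power i (int j)) \<in> P"
    and s: "s \<in> laurents (insert i Z) - P"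
  shows "\<exists>s'\<in>laurents (insert i Z). \<exists>c\<in>laurents Z - P. s * s' - c \<in> P"
proof -
  interpret reg: scalar_module "(*) :: laurent \<Rightarrow> laurent \<Rightarrow> laurent" by (rule scalar_module_mult)
  note reg.scale_scale [simp del]
  note LZ = subring_laurents[of Z] and LiZ = subring_laurents[of "insert i Z"]
  have Pid: "ideal_set P" using prime_idealD[OF P] by blast
  have PS: "reg.subspace P" by (simp add: subspace_mult_iff Pid)
  have mc: "mult_closed (laurents Z - P)" by (rule mult_closed_compl_prime[OF P LZ])
  define X where "X = (\<lambda>(l, x). var_power i (int l) * x) ` ({..<e} \<times> {1 :: laurent})"
  have "finite X" by (simp add: X_def)
  have sub: "reg.gspan (laurents (insert i Z)) (laurents Z - P) P {1} \<subseteq> reg.gspan (laurents Z) (laurents Z - P) P X"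
    unfolding X_def
  proof (rule reg.gspan_eliminate_unit[OF LZ mc _ PS])
    show "(\<Sum>j\<le>e. b j * var_power i (int j)) * v \<in> P" for v
      by (rule ideal_closed(5)[OF Pid rel])
    show "\<exists>F q. finite F \<and> (\<forall>j\<in>F. q j \<in> laurents Z) \<and> a = (\<Sum>j\<in>F. q j * var_power i j)"
      if "a \<in> laurents (insert i Z)" for a
      by (rule laurents_expansion[OF that])
  qed (use b in \<open>simp_all add: var_power_add\<close>)
  have pow: "s ^ a \<in> reg.gspan (laurents Z) (laurents Z - P) P X" for a
  proof -
    have "s ^ a \<in> laurents (insert i Z)" using s subring_closed(7)[OF LiZ] by blast
    then have "s ^ a \<in> reg.bspan (laurents (insert i Z)) {1}"
      unfolding reg.bspan_def by (auto intro!: exI[of _ "\<lambda>_. s ^ a"])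
    moreover have "1 \<in> laurents Z - P" using mc by (simp add: mult_closed_def)
    ultimately have "s ^ a \<in> reg.gspan (laurents (insert i Z)) (laurents Z - P) P {1}"
      unfolding reg.gspan_def mem_Collect_eq
      by (intro bexI[of _ 1] bexI[of _ "s ^ a"]) (simp_all add: ideal_closed(1)[OF Pid])
    then show ?thesis using sub by blast
  qed
  have "\<exists>c. (\<forall>a\<in>{..card X}. c a \<in> laurents Z) \<and> (\<exists>a\<in>{..card X}. c a \<notin> P)
      \<and> (\<Sum>a\<in>{..card X}. c a * s ^ a) \<in> P"
    using ideal_closed(5)[OF Pid] \<open>finite X\<close> pow
    by (intro reg.dependent_of_card[OF P LZ PS, of X]) auto
  then obtain c a1 where c: "\<And>a. a \<le> card X \<Longrightarrow> c a \<in> laurents Z" "a1 \<le> card X" "c a1 \<notin> P"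
    "(\<Sum>a\<le>card X. c a * s ^ a) \<in> P" by auto
  define a0 where "a0 = (LEAST a. c a \<notin> P)"
  have a0: "c a0 \<notin> P" unfolding a0_def by (rule LeastI[of "\<lambda>a. c a \<notin> P", OF c(3)])
  have a0_le: "a0 \<le> card X"
    using Least_le[of "\<lambda>a. c a \<notin> P", OF c(3)] c(2) unfolding a0_def by linarith
  have a0_below: "c a \<in> P" if "a < a0" for a
    using not_less_Least[of a "\<lambda>a. c a \<notin> P"] that unfolding a0_def by blast
  define q where "q = (\<Sum>a\<in>{a0<..card X}. c a * s ^ (a - Suc a0))"
  have disjoint: "{..<a0} \<inter> {a0<..card X} = {}" by auto
  have "{..card X} = {..<a0} \<union> {a0} \<union> {a0<..card X}" using a0_le by auto
  then have "(\<Sum>a\<le>card X. c a * s ^ a)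
      = (\<Sum>a<a0. c a * s ^ a) + c a0 * s ^ a0 + (\<Sum>a\<in>{a0<..card X}. c a * s ^ a)"
    by (simp add: sum.union_disjoint[OF _ _ disjoint] ac_simps)
  also have "(\<Sum>a\<in>{a0<..card X}. c a * s ^ a) = s ^ a0 * (s * q)"
    unfolding q_def sum_distrib_left
  proof (rule sum.cong[OF refl])
    fix a assume "a \<in> {a0<..card X}"
    then obtain l where "a = Suc (a0 + l)" using less_imp_Suc_add[of a0 a] by auto
    then have "s ^ a = s ^ a0 * (s * s ^ (a - Suc a0))" by (simp add: power_add ac_simps)
    then show "c a * s ^ a = s ^ a0 * (s * (c a * s ^ (a - Suc a0)))" by (simp only: ac_simps)
  qed
  finally have split: "(\<Sum>a\<le>card X. c a * s ^ a)
      = (\<Sum>a<a0. c a * s ^ a) + c a0 * s ^ a0 + s ^ a0 * (s * q)" .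
  have "(\<Sum>a<a0. c a * s ^ a) \<in> P"
    using ideal_closed(5)[OF Pid a0_below] by (intro ideal_sum[OF Pid]) simp
  from ideal_closed(3)[OF Pid c(4) this]
  have "c a0 * s ^ a0 + s ^ a0 * (s * q) \<in> P" unfolding split by (simp add: add.assoc)
  also have "c a0 * s ^ a0 + s ^ a0 * (s * q) = s ^ a0 * (c a0 + s * q)"
    by (simp only: distrib_left mult.commute)
  finally have "s ^ a0 * (c a0 + s * q) \<in> P" .
  then have "c a0 + s * q \<in> P" using prime_idealD(3,4)[OF P] s by blast
  moreover have "s * (- q) - c a0 = - (c a0 + s * q)" by simp
  ultimately have "s * (- q) - c a0 \<in> P" using ideal_closed(6)[OF Pid] by metis
  moreover have "- q \<in> laurents (insert i Z)"
  proof -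
    have "c a * s ^ (a - Suc a0) \<in> laurents (insert i Z)" if "a \<in> {a0<..card X}" for a
      using c(1)[of a] that s laurents_mono[of Z "insert i Z"]
      by (intro subring_closed(5,7)[OF LiZ]) auto
    then show ?thesis unfolding q_def
      by (intro subring_closed(6)[OF LiZ] subring_sum[OF LiZ])
  qed
  ultimately show ?thesis using c(1)[OF a0_le] a0 by blast
qed

lemma integer_ideal_prime:
  fixes I :: "int set"
  assumes I: "\<And>a b. a \<in> I \<Longrightarrow> b \<in> I \<Longrightarrow> a - b \<in> I" "\<And>a c. a \<in> I \<Longrightarrow> c * a \<in> I" and "1 \<notin> I"
  shows "\<exists>p. prime p \<and> (\<forall>a\<in>I. p dvd a)"
proof (cases "I \<subseteq> {0}")
  case True
  then show ?thesis by (intro exI[of _ 2]) auto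
next
  case False
  then obtain a0 where "a0 \<in> I \<and> a0 \<noteq> 0" by blast
  then obtain a where a: "a \<in> I" "a \<noteq> 0" "\<And>b. b \<in> I \<Longrightarrow> b \<noteq> 0 \<Longrightarrow> nat \<bar>a\<bar> \<le> nat \<bar>b\<bar>"
    using ex_has_least_nat[of "\<lambda>a. a \<in> I \<and> a \<noteq> 0" a0 "\<lambda>a. nat \<bar>a\<bar>"] by blast
  have dvd: "a dvd b" if "b \<in> I" for b
  proof (rule ccontr)
    assume "\<not> a dvd b"
    have "b - b div a * a \<in> I" using I that a by blast
    then have "b mod a \<in> I" by (simp add: minus_div_mult_eq_mod)
    moreover have "b mod a \<noteq> 0" using \<open>\<not> a dvd b\<close> by (simp add: dvd_eq_mod_eq_0)
    ultimately have "\<bar>a\<bar> \<le> \<bar>b mod a\<bar>" using a(3)[of "b mod a"] by linarith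
    then show False using abs_mod_less[of a b] a(2) by linarith
  qed
  have "\<not> a dvd 1"
  proof
    assume "a dvd 1"
    then obtain c where "1 = a * c" unfolding dvd_def by blast
    then have "1 = c * a" by (simp add: mult.commute)
    then show False using I(2)[OF a(1), of c] \<open>1 \<notin> I\<close> by simp
  qed
  then obtain p where "prime p" "p dvd a" using prime_divisor_exists[of a] a(2) by auto
  then show ?thesis using dvd dvd_trans by blast
qed

lemma dividing_coefficients:
  fixes p :: int
  assumes "\<And>e. p dvd lookup c e" "c \<in> laurents Z"
  shows "\<exists>c'\<in>laurents Z. c = of_int p * c'"
proof
  let ?c' = "\<Sum>e\<in>keys c. single e (lookup c e div p)"
  have lc: "lookup ?c' e = lookup c e div p" for e
  proof -
    have "lookup ?c' e = (\<Sum>f\<in>keys c. if f = e then lookup c f div p else 0)"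
      unfolding Poly_Mapping.lookup_sum by (rule sum.cong) (auto simp: lookup_single when_def)
    also have "\<dots> = lookup c e div p" by (simp add: in_keys_iff)
    finally show ?thesis .
  qed
  show "c = of_int p * ?c'"
    by (rule poly_mapping_eqI) (simp add: lookup_of_int_mult lc assms(1))
  have "keys ?c' \<subseteq> keys c" by (auto simp: in_keys_iff lc)
  then show "?c' \<in> laurents Z" using assms(2) by (auto simp: laurents_def)
qed

lemma prime_dvd_coefficients_power:
  fixes p :: int and a :: laurent
  assumes "prime p" "\<not> p dvd lookup a e"
  shows "\<exists>g. \<not> p dvd lookup (a ^ K) g"
proof (induction K)
  case 0
  show ?case using assms(1) by (intro exI[of _ 0]) auto
next
  case (Suc K)
  then show ?case using prime_dvd_coefficients[OF assms] by auto
qed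

lemma coefficients_in_ideal:
  fixes c :: laurent
  assumes P: "ideal_set P" and "\<And>e. of_int (lookup c e) \<in> P"
  shows "c \<in> P"
proof -
  have "c = (\<Sum>e\<in>keys c. single e 1 * of_int (lookup c e))"
    unfolding of_int_single by (simp add: mult_single poly_mapping_sum_single)
  also have "\<dots> \<in> P" using assms by (intro ideal_sum ideal_closed(4))
  finally show ?thesis .
qed

text \<open>
The element \<open>a + t\<^sub>i\<^sup>-\<^sup>s h\<close> is a polynomial in \<open>t\<^sub>i\<^sup>-\<^sup>s\<close> with constant term \<open>a\<close>, and
transcendence forces each of its coefficients into \<open>P\<close>.
\<close>

lemma transcendental_constant_term:
  assumes P: "ideal_set P" and tr: "transcendental_over P {} i"
    and h: "h \<in> half_laurents {} i s" and s: "s = 1 \<or> s = - 1"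
    and in_P: "of_int a + var_power i (- s) * h \<in> P"
  shows "of_int a \<in> P"
proof -
  let ?p = "of_int a + var_power i (- s) * h"
  have p: "?p \<in> laurents {i}"
    using h half_laurents_subset[of "{}" i s]
    by (intro subring_closed(3,5)[OF subring_laurents] of_int_laurents var_power_laurents) auto
  define F where "F = insert 0 ((\<lambda>e. lookup e i) ` keys ?p)"
  have F: "finite F" by (simp add: F_def)
  have "?p = (\<Sum>j\<in>F. slice i ?p j * var_power i j)"
    by (rule sum_slices[OF F]) (unfold F_def, blast)
  then have "(\<Sum>j\<in>F. slice i ?p j * var_power i j) \<in> P" using in_P by metis
  then have "slice i ?p 0 \<in> P"
    using transcendental_overD[OF tr F, of "slice i ?p" 0] slice_laurents[OF p] by (simp add: F_def)
  moreover have "slice i ?p 0 = of_int (lookup ?p 0)"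
    using laurents_empty[OF slice_laurents[OF p], of 0] by (simp add: lookup_slice)
  moreover have "lookup h (single i s) = 0"
  proof (rule ccontr)
    assume "lookup h (single i s) \<noteq> 0"
    then have "single i s \<in> keys h" by (simp add: in_keys_iff)
    then have "s * lookup (single i s) i \<le> 0" using h unfolding half_laurents_def by blast
    then show False using s by auto
  qed
  then have "lookup ?p 0 = a"
    using lookup_mult_var_power[of h i "- s" 0] by (simp add: lookup_add mult.commute single_uminus)
  ultimately show ?thesis by simp
qed

text \<open>
An integer relation \<open>k t\<^sup>N + \<dots> \<equiv> 0\<close> for \<open>t = t\<^sub>i\<^sup>s\<close>, divided by \<open>t\<^sup>N\<close>. As a
relation for \<open>t\<^sub>i\<close> it has \<open>k\<close> as its leading coefficient if \<open>s = 1\<close> and as its trailing one if \<open>s = - 1\<close>.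
\<close>

lemma algebraic_leading_coefficient:
  assumes P: "ideal_set P" and alg: "\<not> transcendental_over P {} i" and s: "s = 1 \<or> s = - 1"
  shows "\<exists>k. \<exists>h\<in>half_laurents {} i s. of_int k + var_power i (- s) * h \<in> P \<and> of_int k \<notin> P"
proof -
  note LH = subring_half_laurents[of "{}" i s]
  obtain e b where b: "\<And>j. j \<le> e \<Longrightarrow> b j \<in> laurents {}" "b 0 \<notin> P" "b e \<notin> P"
    "(\<Sum>j\<le>e. b j * var_power i (int j)) \<in> P"
    using algebraic_relation[OF P alg] by blast
  have bh: "b j \<in> half_laurents {} i s" if "j \<le> e" for j
    using b(1)[OF that] laurents_subset_half[of i "{}"] by auto
  have bk: "b j = of_int (lookup (b j) 0)" if "j \<le> e" for j
    by (rule laurents_empty[OF b(1)[OF that]])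
  have "\<exists>j h. j \<le> e \<and> b j \<notin> P \<and> h \<in> half_laurents {} i s \<and> b j + var_power i (- s) * h \<in> P"
    using s
  proof
    assume s1: "s = 1"
    define h where "h = (\<Sum>j<e. b j * var_power i (1 + int j - int e))"
    have "var_power i (- int e) * (\<Sum>j\<le>e. b j * var_power i (int j))
        = (\<Sum>j\<le>e. b j * var_power i (int j - int e))"
      unfolding sum_distrib_left
    proof (rule sum.cong[OF refl])
      fix j
      have "var_power i (int j - int e) = var_power i (- int e) * var_power i (int j)"
        using var_power_add[of i "- int e" "int j"] by simp
      then show "var_power i (- int e) * (b j * var_power i (int j)) = b j * var_power i (int j - int e)"
        by (simp only: ac_simps)
    qed
    also have "\<dots> = b e + (\<Sum>j<e. b j * var_power i (int j - int e))"
      unfolding lessThan_Suc_atMost[symmetric] sum.lessThan_Suc by simp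
    also have "(\<Sum>j<e. b j * var_power i (int j - int e)) = var_power i (- s) * h"
      unfolding h_def sum_distrib_left
    proof (rule sum.cong[OF refl])
      fix j
      have "var_power i (int j - int e) = var_power i (- s) * var_power i (1 + int j - int e)"
        using var_power_add[of i "- s" "1 + int j - int e"] by (simp add: s1)
      then show "b j * var_power i (int j - int e)
          = var_power i (- s) * (b j * var_power i (1 + int j - int e))"
        by (simp only: ac_simps)
    qed
    finally have "b e + var_power i (- s) * h \<in> P" using ideal_closed(4)[OF P b(4)] by metis
    moreover have "h \<in> half_laurents {} i s"
      unfolding h_def
    proof (rule subring_sum[OF LH])
      fix j assume j: "j \<in> {..<e}"
      then have "var_power i (1 + int j - int e) \<in> half_laurents {} i s"
        by (intro var_power_half_laurents) (simp add: s1)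
      then show "b j * var_power i (1 + int j - int e) \<in> half_laurents {} i s"
        using subring_closed(5)[OF LH bh] j by simp
    qed
    ultimately show ?thesis using b by blast
  next
    assume s1: "s = - 1"
    define h where "h = (\<Sum>j<e. b (Suc j) * var_power i (int j))"
    have "(\<Sum>j<e. b (Suc j) * var_power i (int (Suc j))) = var_power i (- s) * h"
      unfolding h_def sum_distrib_left
      by (rule sum.cong) (simp_all add: s1 var_power_add ac_simps)
    then have "(\<Sum>j\<le>e. b j * var_power i (int j)) = b 0 + var_power i (- s) * h"
      unfolding sum.atMost_shift by simp
    then have "b 0 + var_power i (- s) * h \<in> P" using b(4) by metis
    moreover have "h \<in> half_laurents {} i s"
      unfolding h_def
    proof (rule subring_sum[OF LH])
      fix j assume j: "j \<in> {..<e}"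
      then have "var_power i (int j) \<in> half_laurents {} i s"
        by (intro var_power_half_laurents) (simp add: s1)
      then show "b (Suc j) * var_power i (int j) \<in> half_laurents {} i s"
        using subring_closed(5)[OF LH bh] j by simp
    qed
    ultimately show ?thesis using b by blast
  qed
  then obtain j h where j: "j \<le> e" "b j \<notin> P" "h \<in> half_laurents {} i s" "b j + var_power i (- s) * h \<in> P"
    by blast
  have "of_int (lookup (b j) 0) = b j" using bk[OF j(1)] by (rule sym)
  then show ?thesis using j by (intro exI[of _ "lookup (b j) 0"] bexI[of _ h]) simp_all
qed

section \<open>Unbounded roots force integrality\<close>

locale laurent_module = scalar_module scale
  for scale :: "laurent \<Rightarrow> 'v::ab_group_add \<Rightarrow> 'v" (infixr \<open>*s\<close> 75)
begin

lemma gspan_remove_variables: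
  fixes N X :: "'v set"
  assumes N: "subspace N" and S: "mult_closed S" "S \<subseteq> laurents Z" and "finite W" "finite X"
    and rel: "\<And>k. k \<in> W \<Longrightarrow> \<exists>e b. (\<forall>j\<le>e. b j \<in> laurents Z) \<and> b 0 \<in> S \<and> b e \<in> S
      \<and> (\<forall>v. (\<Sum>j\<le>e. b j * var_power k (int j)) *s v \<in> N)"
  shows "\<exists>X'. finite X' \<and> gspan (laurents (Z \<union> W)) S N X \<subseteq> gspan (laurents Z) S N X'"
  using assms(4-)
proof (induction W arbitrary: X rule: finite_induct)
  case empty
  then show ?case by auto
next
  case (insert k W)
  have mono: "laurents Z \<subseteq> laurents (Z \<union> W)" by (rule laurents_mono) simp
  obtain e b where b: "\<forall>j\<le>e. b j \<in> laurents Z" "b 0 \<in> S" "b e \<in> S"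
    "\<And>v. (\<Sum>j\<le>e. b j * var_power k (int j)) *s v \<in> N"
    using insert.prems(2)[of k] by blast
  define X1 where "X1 = (\<lambda>(l, x). var_power k (int l) *s x) ` ({..<e} \<times> X)"
  have "gspan (laurents (insert k (Z \<union> W))) S N X \<subseteq> gspan (laurents (Z \<union> W)) S N X1"
    unfolding X1_def
  proof (rule gspan_eliminate_unit[OF subring_laurents S(1) _ N])
    show "\<exists>F q. finite F \<and> (\<forall>j\<in>F. q j \<in> laurents (Z \<union> W)) \<and> a = (\<Sum>j\<in>F. q j * var_power k j)"
      if "a \<in> laurents (insert k (Z \<union> W))" for a
      by (rule laurents_expansion[OF that])
    show "(\<Sum>j\<le>e. b j * var_power k (int j)) *s v \<in> N" for v by (rule b(4))
  qed (use b S mono insert.prems in \<open>auto simp: var_power_add\<close>)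
  moreover have "\<exists>X'. finite X' \<and> gspan (laurents (Z \<union> W)) S N X1 \<subseteq> gspan (laurents Z) S N X'"
    by (rule insert.IH) (use insert.prems in \<open>auto simp: X1_def\<close>)
  ultimately show ?case unfolding Un_insert_right by (meson subset_trans)
qed

text \<open>
Dividing by \<open>p\<close> as long as possible terminates because a fixed nonzero coefficient becomes smaller.
\<close>

lemma remove_content:
  fixes p :: int and N :: "'v set"
  assumes p: "prime p" and tf: "\<And>v. of_int p *s v \<in> N \<Longrightarrow> v \<in> N"
    and c: "\<And>a. a \<in> T \<Longrightarrow> c a \<in> laurents Z" "(\<Sum>a\<in>T. c a *s f a) \<in> N" "a0 \<in> T" "lookup (c a0) e0 \<noteq> 0"
  shows "\<exists>c'. (\<forall>a\<in>T. c' a \<in> laurents Z) \<and> (\<Sum>a\<in>T. c' a *s f a) \<in> N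
    \<and> (\<exists>a\<in>T. \<exists>e. \<not> p dvd lookup (c' a) e)"
  using c
proof (induction "nat \<bar>lookup (c a0) e0\<bar>" arbitrary: c rule: less_induct)
  case less
  show ?case
  proof (cases "\<exists>a\<in>T. \<exists>e. \<not> p dvd lookup (c a) e")
    case True
    then show ?thesis using less.prems by blast
  next
    case False
    then have "\<forall>a\<in>T. \<exists>c'\<in>laurents Z. c a = of_int p * c'"
      using dividing_coefficients less.prems(1) by blast
    then obtain c' where c': "\<And>a. a \<in> T \<Longrightarrow> c' a \<in> laurents Z" "\<And>a. a \<in> T \<Longrightarrow> c a = of_int p * c' a"
      by metis
    have "(\<Sum>a\<in>T. c a *s f a) = of_int p *s (\<Sum>a\<in>T. c' a *s f a)"
      unfolding scale_sum_right by (rule sum.cong) (simp_all add: c'(2))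
    then have "(\<Sum>a\<in>T. c' a *s f a) \<in> N" using less.prems(2) tf by simp
    moreover have eq: "lookup (c a0) e0 = p * lookup (c' a0) e0"
      by (simp add: c'(2)[OF less.prems(3)] lookup_of_int_mult)
    moreover have "lookup (c' a0) e0 \<noteq> 0" using eq less.prems(4) by auto
    moreover have "nat \<bar>lookup (c' a0) e0\<bar> < nat \<bar>lookup (c a0) e0\<bar>"
    proof -
      have "\<bar>lookup (c' a0) e0\<bar> * 2 \<le> \<bar>lookup (c' a0) e0\<bar> * p"
        using prime_ge_2_int[OF p] by (intro mult_left_mono) auto
      also have "\<dots> = \<bar>lookup (c a0) e0\<bar>"
        using prime_ge_2_int[OF p] by (simp add: eq abs_mult mult.commute)
      finally show ?thesis using \<open>lookup (c' a0) e0 \<noteq> 0\<close> by linarith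
    qed
    ultimately show ?thesis using less.hyps[of c'] c'(1) less.prems(3) by blast
  qed
qed

text \<open>
Here the valuation is the order in \<open>u = t\<^sub>i\<^sup>-\<^sup>s\<close>, so \<open>u\<close> itself serves as the uniformizer in
\<open>operator_root_integrality\<close>. The resulting membership \<open>c\<^sub>0\<^sup>K + u g \<in> P\<close> contradicts the transcendence of
\<open>t\<^sub>i\<close> and of the tower, as \<open>c\<^sub>0 \<notin> P\<close> does not involve \<open>t\<^sub>i\<close>.
\<close>

lemma no_large_root_if_transcendental:
  fixes N X :: "'v set"
  assumes P: "prime_ideal_set P" and N: "subspace N"
    and PN: "\<And>a v. a \<in> P \<Longrightarrow> a *s v \<in> N" and tf: "\<And>a. a *s x \<in> N \<Longrightarrow> a \<in> P"
    and "finite X" and span: "\<And>v. v \<in> gspan (laurents (insert i (set ks))) (laurents (insert i (set ks)) - P) N X"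
    and tower: "tower P i ks" and tr: "transcendental_over P {} i" and s: "s = 1 \<or> s = - 1"
    and z: "linear_map z" "z ` N \<subseteq> N" and zr: "\<And>v. (z ^^ r) v - var_power i (- s) ^ d *s v \<in> N"
    and r: "d * (card X + 1) \<le> r" "0 < d"
  shows False
proof -
  define u where "u = var_power i (- s)"
  define m where "m = card X"
  define D where "D = half_laurents (set ks) i s"
  have Pid: "ideal_set P" using prime_idealD[OF P] by blast
  note LY = subring_laurents[of "insert i (set ks)"]
  have D: "unital_subring D" unfolding D_def by (rule subring_half_laurents)
  have i: "i \<notin> set ks" using tower_distinct[OF tower] by blast
  have LD: "laurents (set ks) \<subseteq> D" unfolding D_def by (rule laurents_subset_half[OF i])
  have uD: "u \<in> D" unfolding u_def D_def by (rule var_power_half_laurents) (use s in auto)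
  have "\<exists>c. (\<forall>a\<in>{..m}. c a \<in> laurents (insert i (set ks))) \<and> (\<exists>a\<in>{..m}. c a \<notin> P)
      \<and> (\<Sum>a\<in>{..m}. c a *s (z ^^ a) x) \<in> N"
    by (rule dependent_of_card[OF P LY N PN \<open>finite X\<close>]) (use span in \<open>simp_all add: m_def\<close>)
  then obtain c a1 where cL: "\<forall>a\<in>{..m}. c a \<in> laurents (insert i (set ks))"
    and c: "a1 \<in> {..m}" "c a1 \<notin> P" "(\<Sum>a\<le>m. c a *s (z ^^ a) x) \<in> N" by blast
  note c = cL[rule_format, unfolded atMost_iff] c(1)[unfolded atMost_iff] c(2,3)
  define q where "q a l = slice i (c a) (s * l)" for a l
  define F where "F = (\<Union>a\<le>m. (\<lambda>e. s * lookup e i) ` keys (c a))"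
  have F: "finite F" by (simp add: F_def)
  have ss: "s * (s * l) = l" for l :: int using s by auto
  have cq: "c a = (\<Sum>l\<in>F. q a l * var_power i (s * l))" if "a \<le> m" for a
  proof -
    have "c a = (\<Sum>j\<in>(\<lambda>l. s * l) ` F. slice i (c a) j * var_power i j)"
    proof (rule sum_slices)
      fix e assume "e \<in> keys (c a)"
      then have "s * lookup e i \<in> F" using that by (auto simp: F_def)
      then have "s * (s * lookup e i) \<in> (\<lambda>l. s * l) ` F" by (rule imageI)
      then show "lookup e i \<in> (\<lambda>l. s * l) ` F" by (simp only: ss)
    qed (simp add: F)
    also have "\<dots> = (\<Sum>l\<in>F. q a l * var_power i (s * l))"
      by (subst sum.reindex) (use s in \<open>auto simp: inj_on_def q_def\<close>)
    finally show ?thesis .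
  qed
  have qL: "q a l \<in> laurents (set ks)" if "a \<le> m" for a l
    unfolding q_def by (rule slice_laurents[OF c(1)[OF that]])
  \<comment> \<open>The exponents \<open>l\<close> of \<open>t\<^sub>i\<^sup>s\<close> with a
    coefficient outside \<open>P\<close>. Multiplying the relation by
    \<open>t\<^sub>i\<^sup>-\<^sup>s\<^sup>l\<close> for the largest one makes all coefficients
    polynomials in \<open>u\<close> modulo \<open>P\<close>, and not all constant terms
    vanish.\<close>
  define \<Lambda> where "\<Lambda> = {l\<in>F. \<exists>a\<le>m. q a l \<notin> P}"
  have "\<Lambda> \<noteq> {}"
  proof
    assume "\<Lambda> = {}"
    then have "(\<Sum>l\<in>F. q a1 l * var_power i (s * l)) \<in> P"
      using c(2) by (intro ideal_sum[OF Pid] ideal_closed(5)[OF Pid]) (auto simp: \<Lambda>_def)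
    then show False using cq[OF c(2)] c(3) by simp
  qed
  moreover have "finite \<Lambda>" using F by (simp add: \<Lambda>_def)
  moreover define l0 where "l0 = Max \<Lambda>"
  ultimately have l0: "l0 \<in> \<Lambda>" "\<And>l. l \<in> \<Lambda> \<Longrightarrow> l \<le> l0" by simp_all
  define h where "h a = (\<Sum>l\<in>{l\<in>F. l < l0}. q a l * var_power i (s * (l - l0 + 1)))" for a
  define c' where "c' a = q a l0 + u * h a" for a
  have hD: "h a \<in> D" if "a \<le> m" for a
    unfolding h_def
  proof (rule subring_sum[OF D])
    fix l assume l: "l \<in> {l \<in> F. l < l0}"
    have "var_power i (s * (l - l0 + 1)) \<in> D"
      unfolding D_def by (rule var_power_half_laurents) (use l in \<open>simp add: ss\<close>)
    then show "q a l * var_power i (s * (l - l0 + 1)) \<in> D"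
      using qL[OF that] LD by (intro subring_closed(5)[OF D]) auto
  qed
  have shift: "c a * var_power i (- s * l0) - c' a \<in> P" if a: "a \<le> m" for a
  proof -
    have "c a * var_power i (- s * l0) = (\<Sum>l\<in>F. q a l * var_power i (s * (l - l0)))"
      unfolding cq[OF a] sum_distrib_right
    proof (rule sum.cong[OF refl])
      fix l
      have "var_power i (s * (l - l0)) = var_power i (s * l) * var_power i (- s * l0)"
        unfolding var_power_add[symmetric] by (simp add: algebra_simps)
      then show "q a l * var_power i (s * l) * var_power i (- s * l0) = q a l * var_power i (s * (l - l0))"
        by (simp only: mult.assoc)
    qed
    also have "\<dots> = (\<Sum>l\<in>{l\<in>F. l \<le> l0}. q a l * var_power i (s * (l - l0)))
        + (\<Sum>l\<in>{l\<in>F. l0 < l}. q a l * var_power i (s * (l - l0)))"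
    proof -
      have split: "F = {l\<in>F. l \<le> l0} \<union> {l\<in>F. l0 < l}" by auto
      have disjoint: "{l\<in>F. l \<le> l0} \<inter> {l\<in>F. l0 < l} = {}" by auto
      show ?thesis using sum.union_disjoint[OF _ _ disjoint] F unfolding split[symmetric] by simp
    qed
    also have "(\<Sum>l\<in>{l\<in>F. l \<le> l0}. q a l * var_power i (s * (l - l0))) = c' a"
    proof -
      have "{l\<in>F. l \<le> l0} = insert l0 {l\<in>F. l < l0}" using l0(1) by (auto simp: \<Lambda>_def)
      then have "(\<Sum>l\<in>{l\<in>F. l \<le> l0}. q a l * var_power i (s * (l - l0)))
          = q a l0 + (\<Sum>l\<in>{l\<in>F. l < l0}. q a l * var_power i (s * (l - l0)))"
        using F by simp
      also have "(\<Sum>l\<in>{l\<in>F. l < l0}. q a l * var_power i (s * (l - l0))) = u * h a"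
        unfolding h_def sum_distrib_left
      proof (rule sum.cong[OF refl])
        fix l
        have "var_power i (s * (l - l0)) = u * var_power i (s * (l - l0 + 1))"
          unfolding u_def var_power_add[symmetric] by (simp add: algebra_simps)
        then show "q a l * var_power i (s * (l - l0)) = u * (q a l * var_power i (s * (l - l0 + 1)))"
          by (simp only: ac_simps)
      qed
      finally show ?thesis by (simp add: c'_def)
    qed
    finally have "c a * var_power i (- s * l0) - c' a
        = (\<Sum>l\<in>{l\<in>F. l0 < l}. q a l * var_power i (s * (l - l0)))" by simp
    also have "\<dots> \<in> P"
    proof (rule ideal_sum[OF Pid], rule ideal_closed(5)[OF Pid])
      fix l assume "l \<in> {l \<in> F. l0 < l}"
      then show "q a l \<in> P" using l0(2)[of l] a by (force simp: \<Lambda>_def)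
    qed
    finally show ?thesis .
  qed
  have rel: "(\<Sum>a\<le>m. c' a *s (z ^^ a) x) \<in> N"
  proof -
    have "var_power i (- s * l0) *s (\<Sum>a\<le>m. c a *s (z ^^ a) x) \<in> N"
      by (rule subspace_scale[OF N c(4)])
    moreover have "(\<Sum>a\<le>m. (c a * var_power i (- s * l0) - c' a) *s (z ^^ a) x) \<in> N"
      by (rule subspace_sum[OF N], rule PN, rule shift) simp
    ultimately have "var_power i (- s * l0) *s (\<Sum>a\<le>m. c a *s (z ^^ a) x)
        - (\<Sum>a\<le>m. (c a * var_power i (- s * l0) - c' a) *s (z ^^ a) x) \<in> N"
      by (rule subspace_diff[OF N])
    then show ?thesis
      by (simp add: scale_sum_right scale_left_diff_distrib sum_subtractf mult.commute)
  qed
  obtain a2 where a2: "a2 \<le> m" "q a2 l0 \<notin> P" using l0(1) by (auto simp: \<Lambda>_def)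
  define m0 where "m0 = (LEAST a. q a l0 \<notin> P)"
  have m0: "q m0 l0 \<notin> P" unfolding m0_def by (rule LeastI[of "\<lambda>a. q a l0 \<notin> P", OF a2(2)])
  have m0_le: "m0 \<le> m"
    using Least_le[of "\<lambda>a. q a l0 \<notin> P", OF a2(2)] a2(1) unfolding m0_def by linarith
  have m0_below: "q a l0 \<in> P" if "a < m0" for a
    using not_less_Least[of a "\<lambda>a. q a l0 \<notin> P"] that unfolding m0_def by blast
  have "\<exists>K. \<exists>g\<in>D. q m0 l0 ^ K + u * g \<in> P"
  proof (rule operator_root_integrality[OF N PN tf z, where t = "var_power i s" and kap = u
        and ?h0.0 = 1 and e = 1 and m = m and ?m0.0 = m0 and c = c' and c' = h])
    show "(z ^^ r) v - u ^ d *s v \<in> N" for v unfolding u_def by (rule zr)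
    show "var_power i s * u = 1" unfolding u_def var_power_add[symmetric] by simp
    show "u ^ 1 - u * 1 \<in> P" using ideal_closed(1)[OF Pid] by simp
    show "1 * d * (m + 1) \<le> r" using r by (simp add: m_def)
    show "h b \<in> D \<and> c' b - u * h b \<in> P" if "b < m0" for b
      using hD[of b] m0_below[OF that] m0_le that by (simp add: c'_def)
    show "c' m0 - (q m0 l0 + u * h m0) \<in> P" using ideal_closed(1)[OF Pid] by (simp add: c'_def)
    show "q m0 l0 \<in> D" using qL[OF m0_le] LD by blast
    show "c' b \<in> D" if "m0 < b" "b \<le> m" for b
    proof -
      have "q b l0 \<in> D" using qL[OF that(2)] LD by blast
      then show ?thesis
        unfolding c'_def
        by (rule subring_closed(3)[OF D _ subring_closed(5)[OF D uD hD[OF that(2)]]])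
    qed
  qed (use D uD r rel m0_le hD[OF m0_le] subring_closed(1)[OF D] in simp_all)
  then obtain K g where g: "g \<in> D" "q m0 l0 ^ K + u * g \<in> P" by blast
  have qK: "q m0 l0 ^ K \<in> laurents (set ks)"
    by (rule subring_closed(7)[OF subring_laurents qL[OF m0_le]])
  have "q m0 l0 ^ K \<in> P"
  proof (rule coefficients_in_ideal[OF Pid])
    fix e
    obtain h0 where "h0 \<in> half_laurents {} i s" "of_int (lookup (q m0 l0 ^ K) e) + u * h0 \<in> P"
      using tower_coefficients[OF Pid tower qK g(1)[unfolded D_def] g(2)[unfolded u_def], of e]
      unfolding u_def by blast
    then show "of_int (lookup (q m0 l0 ^ K) e) \<in> P"
      using transcendental_constant_term[OF Pid tr _ s] unfolding u_def by blast
  qed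
  then show False using prime_idealD(4)[OF P] m0 by blast
qed

text \<open>
Here the valuation is the \<open>p\<close>-adic one on the Laurent polynomials in the tower, extended by Gauss's
lemma. If \<open>p\<^sup>e k'\<close> is the leading coefficient of an integer relation for \<open>t = t\<^sub>i\<^sup>s\<close>, a power of \<open>p k'\<close>
is a multiple of \<open>u = t\<^sup>-\<^sup>1\<close> in \<open>\<int>[u]\<close> modulo \<open>P\<close>; the factor \<open>k'\<close>, a unit for the valuation, is carried
along because the ring is not localized. The outcome is an integer relation for \<open>t\<close> whose leading
coefficient is prime to \<open>p\<close>.
\<close>

lemma no_large_root_if_algebraic:
  fixes N X :: "'v set" and p k' :: int
  assumes P: "prime_ideal_set P" and N: "subspace N"
    and PN: "\<And>a v. a \<in> P \<Longrightarrow> a *s v \<in> N" and tf: "\<And>a v. a *s v \<in> N \<Longrightarrow> a \<in> P \<or> v \<in> N"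
    and "x \<notin> N"
    and "finite X" and span: "\<And>v. v \<in> gspan (laurents (set ks)) (laurents (set ks) - P) N X"
    and tower: "tower P i ks" and s: "s = 1 \<or> s = - 1"
    and p: "prime p" "\<not> p dvd k'" "0 < e" "h1 \<in> half_laurents {} i s"
      "of_int (p ^ e * k') + var_power i (- s) * h1 \<in> P" "of_int p \<notin> P"
    and lead: "\<And>a h. h \<in> half_laurents {} i s \<Longrightarrow> of_int a + var_power i (- s) * h \<in> P \<Longrightarrow> p dvd a"
    and z: "linear_map z" "z ` N \<subseteq> N" and zr: "\<And>v. (z ^^ r) v - var_power i (- s) ^ d *s v \<in> N"
    and r: "e * d * (card X + 1) \<le> r" "0 < d"
  shows False
proof -
  define u where "u = var_power i (- s)"
  define m where "m = card X"
  define D where "D = half_laurents (set ks) i s"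
  have Pid: "ideal_set P" using prime_idealD[OF P] by blast
  note LY = subring_laurents[of "set ks"]
  have D: "unital_subring D" unfolding D_def by (rule subring_half_laurents)
  have i: "i \<notin> set ks" using tower_distinct[OF tower] by blast
  have LD: "laurents (set ks) \<subseteq> D" unfolding D_def by (rule laurents_subset_half[OF i])
  have uD: "u \<in> D" unfolding u_def D_def by (rule var_power_half_laurents) (use s in auto)
  have h1D: "h1 \<in> D" using p(4) half_laurents_mono[of "{}" "set ks" i s] by (auto simp: D_def)
  have intD: "of_int a \<in> D" for a using of_int_laurents LD by blast
  have tfx: "a \<in> P" if "a *s x \<in> N" for a using tf[OF that] \<open>x \<notin> N\<close> by blast
  have "\<exists>c. (\<forall>a\<in>{..m}. c a \<in> laurents (set ks)) \<and> (\<exists>a\<in>{..m}. c a \<notin> P)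
      \<and> (\<Sum>a\<in>{..m}. c a *s (z ^^ a) x) \<in> N"
    by (rule dependent_of_card[OF P LY N PN \<open>finite X\<close>]) (use span in \<open>simp_all add: m_def\<close>)
  then obtain c a1 where c: "\<And>a. a \<in> {..m} \<Longrightarrow> c a \<in> laurents (set ks)"
    "(\<Sum>a\<in>{..m}. c a *s (z ^^ a) x) \<in> N" "a1 \<in> {..m}" "c a1 \<notin> P" by blast
  have "\<exists>e1. lookup (c a1) e1 \<noteq> 0"
  proof (rule ccontr)
    assume "\<nexists>e1. lookup (c a1) e1 \<noteq> 0"
    then have "c a1 = 0" by (intro poly_mapping_eqI) simp
    then show False using c(4) ideal_closed(1)[OF Pid] by simp
  qed
  then obtain e1 where e1: "lookup (c a1) e1 \<noteq> 0" by blast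
  have tfp: "v \<in> N" if "of_int p *s v \<in> N" for v using tf[OF that] p(6) by blast
  obtain q where q: "\<And>a. a \<in> {..m} \<Longrightarrow> q a \<in> laurents (set ks)" "(\<Sum>a\<in>{..m}. q a *s (z ^^ a) x) \<in> N"
    and qex: "\<exists>a\<in>{..m}. \<exists>f. \<not> p dvd lookup (q a) f"
    using remove_content[OF p(1) tfp c(1-3) e1] by blast
  define bad where "bad a \<longleftrightarrow> (\<exists>f. \<not> p dvd lookup (q a) f)" for a
  obtain a2 where a2: "a2 \<le> m" "bad a2" using qex by (auto simp: bad_def)
  define m0 where "m0 = (LEAST a. bad a)"
  have m0: "bad m0" unfolding m0_def by (rule LeastI[of bad, OF a2(2)])
  have m0_le: "m0 \<le> m" using Least_le[of bad, OF a2(2)] a2(1) unfolding m0_def by linarith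
  have m0_below: "\<not> bad a" if "a < m0" for a
    using not_less_Least[of a bad] that unfolding m0_def by blast
  have "\<forall>a. \<exists>q'. a < m0 \<longrightarrow> q' \<in> laurents (set ks) \<and> q a = of_int p * q'"
  proof
    fix a
    show "\<exists>q'. a < m0 \<longrightarrow> q' \<in> laurents (set ks) \<and> q a = of_int p * q'"
    proof (cases "a < m0")
      case True
      then have "\<And>f. p dvd lookup (q a) f" using m0_below by (auto simp: bad_def)
      then show ?thesis using dividing_coefficients[of p "q a"] q(1)[of a] True m0_le by auto
    qed simp
  qed
  from choice[OF this] obtain q' where
    q': "\<And>a. a < m0 \<Longrightarrow> q' a \<in> laurents (set ks)" "\<And>a. a < m0 \<Longrightarrow> q a = of_int p * q' a" by blast
  define kap :: laurent where "kap = of_int (p * k')"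
  define c' where "c' a = of_int k' * q a" for a
  define d' where "d' a = (if a < m0 then q' a else 0)" for a
  have "\<exists>K. \<exists>g\<in>D. c' m0 ^ K + u * g \<in> P"
  proof (rule operator_root_integrality[OF N PN tfx z, where t = "var_power i s" and kap = kap
        and ?h0.0 = "- (h1 * of_int (k' ^ (e - 1)))" and e = e and m = m and ?m0.0 = m0 and c = c'
        and c' = d'])
    show "(z ^^ r) v - u ^ d *s v \<in> N" for v unfolding u_def by (rule zr)
    show "var_power i s * u = 1" unfolding u_def var_power_add[symmetric] by simp
    have "kap ^ e = of_int (k' ^ (e - 1)) * of_int (p ^ e * k')"
    proof -
      have "(p * k') ^ e = k' ^ (e - 1) * (p ^ e * k')"
        using \<open>0 < e\<close> by (cases e) (simp_all add: power_mult_distrib)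
      then show ?thesis unfolding kap_def by (metis of_int_mult of_int_power)
    qed
    then have "kap ^ e - u * (- (h1 * of_int (k' ^ (e - 1))))
        = of_int (k' ^ (e - 1)) * (of_int (p ^ e * k') + u * h1)"
      by (simp add: distrib_left ac_simps)
    then show "kap ^ e - u * (- (h1 * of_int (k' ^ (e - 1)))) \<in> P"
      using ideal_closed(4)[OF Pid p(5)] unfolding u_def by metis
    show "e * d * (m + 1) \<le> r" using r by (simp add: m_def)
    show "(\<Sum>b\<le>m. c' b *s (z ^^ b) x) \<in> N"
      using subspace_scale[OF N q(2), of "of_int k'"] by (simp add: c'_def scale_sum_right)
    show "d' b \<in> D \<and> c' b - kap * d' b \<in> P" if "b < m0" for b
      using q'[OF that] LD ideal_closed(1)[OF Pid] that
      by (auto simp: c'_def d'_def kap_def ac_simps)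
    show "c' m0 - (c' m0 + kap * d' m0) \<in> P" using ideal_closed(1)[OF Pid] by (simp add: d'_def)
    show "- (h1 * of_int (k' ^ (e - 1))) \<in> D"
      by (rule subring_closed(6)[OF D subring_closed(5)[OF D h1D intD]])
    show "kap \<in> D" unfolding kap_def by (rule intD)
    have c'D: "c' b \<in> D" if "b \<le> m" for b
      unfolding c'_def using q(1)[of b] that LD intD by (intro subring_closed(5)[OF D]) auto
    then show "c' m0 \<in> D" using m0_le by blast
    show "c' b \<in> D" if "m0 < b" "b \<le> m" for b using c'D that by blast
    show "d' m0 \<in> D" using subring_closed(2)[OF D] by (simp add: d'_def)
  qed (use D uD r p(3) m0_le in auto)
  then obtain K g where g: "g \<in> D" "c' m0 ^ K + u * g \<in> P" by blast
  have c'K: "c' m0 ^ K \<in> laurents (set ks)"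
    unfolding c'_def using q(1)[of m0] m0_le of_int_laurents
    by (intro subring_closed(7)[OF LY] subring_closed(5)[OF LY]) auto
  obtain f where "\<not> p dvd lookup (q m0) f" using m0 by (auto simp: bad_def)
  then have "\<not> p dvd lookup (c' m0) f"
    using p(1,2) by (simp add: c'_def lookup_of_int_mult prime_dvd_mult_iff)
  then obtain f' where f': "\<not> p dvd lookup (c' m0 ^ K) f'"
    using prime_dvd_coefficients_power[OF p(1)] by blast
  obtain h0 where "h0 \<in> half_laurents {} i s" "of_int (lookup (c' m0 ^ K) f') + u * h0 \<in> P"
    using tower_coefficients[OF Pid tower c'K g(1)[unfolded D_def] g(2)[unfolded u_def], of f']
    unfolding u_def by blast
  then show False using lead f' unfolding u_def by blast
qed

text \<open>
With \<open>u = t\<^sub>i\<^sup>-\<^sup>s\<close>, the conclusion says that \<open>t\<^sub>i\<^sup>s\<close> is integral over \<open>\<int>\<close> on the quotient by \<open>N0\<close>: multiply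
\<open>1 + u h(u)\<close> by a power of \<open>t\<^sub>i\<^sup>s\<close> to obtain a monic polynomial. The number of generators \<open>X1\<close> or \<open>X2\<close> over
the coefficient ring is fixed before the root is chosen, which is why one sufficiently high root
suffices for the contradiction.
\<close>

theorem unbounded_roots_integral:
  fixes N0 X :: "'v set"
  assumes N0: "subspace N0" and "finite X"
    and gen: "\<And>v. \<exists>l\<in>bspan (laurents W) X. v - l \<in> N0"
    and "finite W" "i \<in> W" and s: "s = 1 \<or> s = - 1" and "0 < d"
    and roots: "\<And>R. \<exists>r\<ge>R. \<exists>z. linear_map z \<and> z ` N0 \<subseteq> N0
      \<and> (\<forall>v. (z ^^ r) v - var_power i (- s) ^ d *s v \<in> N0)"
  shows "\<exists>h\<in>half_laurents {} i s. \<forall>v. (1 + var_power i (- s) * h) *s v \<in> N0"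
proof (rule ccontr)
  assume contra: "\<not> ?thesis"
  define u where "u = var_power i (- s)"
  define D0 where "D0 = half_laurents {} i s"
  have D0: "unital_subring D0" unfolding D0_def by (rule subring_half_laurents)
  have uD0: "u \<in> D0" unfolding u_def D0_def by (rule var_power_half_laurents) (use s in auto)
  define S where "S = {1 + u * h | h. h \<in> D0}"
  have mcS: "mult_closed S"
    unfolding mult_closed_def
  proof (intro conjI ballI)
    show "1 \<in> S" unfolding S_def using subring_closed(2)[OF D0] by (auto intro!: exI[of _ 0])
    fix x y assume "x \<in> S" "y \<in> S"
    then obtain g h where gh: "x = 1 + u * g" "y = 1 + u * h" "g \<in> D0" "h \<in> D0" by (auto simp: S_def)
    then have "x * y = 1 + u * (g + h + u * g * h)" by (simp add: algebra_simps)
    moreover have "g + h + u * g * h \<in> D0"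
      using gh uD0 subring_closed[OF D0] by simp
    ultimately show "x * y \<in> S" by (auto simp: S_def)
  qed
  have S_N0: "\<forall>a\<in>S. \<exists>v. a *s v \<notin> N0"
  proof
    fix a assume a: "a \<in> S"
    obtain h where "h \<in> D0" "a = 1 + u * h" using a by (auto simp: S_def)
    then show "\<exists>v. a *s v \<notin> N0" using contra unfolding u_def D0_def by blast
  qed
  have genU: "\<exists>l\<in>bspan UNIV X. v - l \<in> N0" for v
    using gen[of v] unfolding bspan_def by blast
  from exists_prime_torsion_free_quotient[OF N0 \<open>finite X\<close> genU mcS S_N0]
  obtain P N where P: "prime_ideal_set P" and SP: "S \<inter> P = {}" and N: "subspace N"
    and "N \<noteq> UNIV" "N0 \<subseteq> N" and PN': "\<forall>a\<in>P. \<forall>v. a *s v \<in> N"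
    and tf': "\<forall>a v. a *s v \<in> N \<longrightarrow> a \<in> P \<or> v \<in> N"
    and inv: "\<forall>f. linear_map f \<and> f ` N0 \<subseteq> N0 \<longrightarrow> f ` N \<subseteq> N"
    by (elim exE conjE) (rule that; assumption)
  have PN: "a *s v \<in> N" if "a \<in> P" for a v using PN' that by blast
  have tf: "a \<in> P \<or> v \<in> N" if "a *s v \<in> N" for a v using tf' that by blast
  have Pid: "ideal_set P" using prime_idealD[OF P] by blast
  obtain x where x: "x \<notin> N" using \<open>N \<noteq> UNIV\<close> by blast
  have roots': "\<exists>r\<ge>R. \<exists>z. linear_map z \<and> z ` N \<subseteq> N \<and> (\<forall>v. (z ^^ r) v - u ^ d *s v \<in> N)" for R
  proof -
    obtain r z where rz: "r \<ge> R" "linear_map z" "z ` N0 \<subseteq> N0" "\<forall>v. (z ^^ r) v - u ^ d *s v \<in> N0"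
      using roots[of R] unfolding u_def by blast
    have "z ` N \<subseteq> N" using inv rz(2,3) by blast
    moreover have "\<forall>v. (z ^^ r) v - u ^ d *s v \<in> N" using rz(4) \<open>N0 \<subseteq> N\<close> by blast
    ultimately show ?thesis using rz(1,2) by blast
  qed
  obtain ks where tower: "tower P i ks" and ksW: "set ks \<subseteq> W"
    and alg: "\<And>k. k \<in> W - insert i (set ks) \<Longrightarrow> \<not> transcendental_over P (insert i (set ks)) k"
    using maximal_tower[OF \<open>finite W\<close>, of P i] by blast
  define Y where "Y = insert i (set ks)"
  have mcY: "mult_closed (laurents Y - P)" by (rule mult_closed_compl_prime[OF P subring_laurents])
  have "\<exists>X1. finite X1 \<and> gspan (laurents (Y \<union> (W - Y))) (laurents Y - P) N X
      \<subseteq> gspan (laurents Y) (laurents Y - P) N X1"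
  proof (rule gspan_remove_variables[OF N mcY])
    fix k assume "k \<in> W - Y"
    then show "\<exists>e b. (\<forall>j\<le>e. b j \<in> laurents Y) \<and> b 0 \<in> laurents Y - P \<and> b e \<in> laurents Y - P
        \<and> (\<forall>v. (\<Sum>j\<le>e. b j * var_power k (int j)) *s v \<in> N)"
      using algebraic_relation[OF Pid alg, of k] PN unfolding Y_def by blast
  qed (use \<open>finite W\<close> \<open>finite X\<close> in auto)
  moreover have "Y \<union> (W - Y) = W" using ksW \<open>i \<in> W\<close> by (auto simp: Y_def)
  ultimately obtain X1 where "finite X1"
    and X1: "gspan (laurents W) (laurents Y - P) N X \<subseteq> gspan (laurents Y) (laurents Y - P) N X1"
    by auto
  have spanX1: "v \<in> gspan (laurents Y) (laurents Y - P) N X1" for v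
  proof -
    obtain l where l: "l \<in> bspan (laurents W) X" "v - l \<in> N0" using gen by blast
    then have "1 *s v - l \<in> N" using \<open>N0 \<subseteq> N\<close> by auto
    moreover have "1 \<in> laurents Y - P" using mcY by (simp add: mult_closed_def)
    ultimately have "v \<in> gspan (laurents W) (laurents Y - P) N X"
      using l(1) unfolding gspan_def by blast
    then show ?thesis using X1 by blast
  qed
  show False
  proof (cases "transcendental_over P {} i")
    case True
    obtain r z where "r \<ge> d * (card X1 + 1)" "linear_map z" "z ` N \<subseteq> N"
      "\<And>v. (z ^^ r) v - u ^ d *s v \<in> N" using roots' by blast
    then show False
      using no_large_root_if_transcendental[OF P N PN _ \<open>finite X1\<close> spanX1[unfolded Y_def] tower True s, of x z r d]
        tf x \<open>0 < d\<close> unfolding u_def by blast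
  next
    case False
    \<comment> \<open>The leading coefficients of integer relations for
      \<open>t\<^sub>i\<^sup>s\<close> form an ideal of \<open>\<int>\<close>. It is proper, so all
      of them share a prime divisor.\<close>
    define I where "I = {a. \<exists>h\<in>D0. of_int a + u * h \<in> P}"
    have I_diff: "a - b \<in> I" if ab: "a \<in> I" "b \<in> I" for a b
    proof -
      obtain g h where gh: "g \<in> D0" "h \<in> D0" "of_int a + u * g \<in> P" "of_int b + u * h \<in> P"
        using ab by (auto simp: I_def)
      have "of_int (a - b) + u * (g - h) = (of_int a + u * g) - (of_int b + u * h)"
        by (simp add: algebra_simps)
      also have "\<dots> \<in> P" by (rule ideal_closed(3)[OF Pid gh(3,4)])
      finally show ?thesis unfolding I_def using subring_closed(4)[OF D0 gh(1,2)] by blast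
    qed
    have I_mult: "c * a \<in> I" if a: "a \<in> I" for a c
    proof -
      obtain g where g: "g \<in> D0" "of_int a + u * g \<in> P" using a by (auto simp: I_def)
      have "of_int (c * a) + u * (of_int c * g) = of_int c * (of_int a + u * g)"
        by (simp add: distrib_left ac_simps)
      also have "\<dots> \<in> P" by (rule ideal_closed(4)[OF Pid g(2)])
      finally have "of_int (c * a) + u * (of_int c * g) \<in> P" .
      moreover have "of_int c \<in> D0"
        unfolding D0_def using of_int_laurents[of c "{}"] laurents_subset_half[of i "{}" s] by blast
      ultimately show ?thesis
        unfolding I_def using subring_closed(5)[OF D0 _ g(1)] by blast
    qed
    have "1 \<notin> I" using SP by (auto simp: I_def S_def)
    with integer_ideal_prime[of I] I_diff I_mult
    obtain p where p: "prime p" "\<And>a. a \<in> I \<Longrightarrow> p dvd a" by blast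
    obtain k h1 where k: "h1 \<in> D0" "of_int k + u * h1 \<in> P" "of_int k \<notin> P"
      using algebraic_leading_coefficient[OF Pid False s] unfolding u_def D0_def by blast
    have "p dvd k" using k p(2) by (auto simp: I_def)
    have "k \<noteq> 0" using k(3) ideal_closed(1)[OF Pid] by auto
    have pP: "of_int p \<notin> P"
    proof
      assume "of_int p \<in> P"
      obtain k' where "k = p * k'" using \<open>p dvd k\<close> by (rule dvdE)
      then show False using ideal_closed(5)[OF Pid \<open>of_int p \<in> P\<close>, of "of_int k'"] k(3) by simp
    qed
    obtain k' where k': "k = p ^ multiplicity p k * k'" "\<not> p dvd k'"
      using multiplicity_decompose'[of k p] \<open>k \<noteq> 0\<close> p(1) not_prime_unit by blast
    define e where "e = multiplicity p k"
    have "0 < e"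
    proof (rule ccontr)
      assume "\<not> 0 < e"
      then have "multiplicity p k = 0" by (simp add: e_def)
      then have "k = k'" using k'(1) by (metis mult_1 power_0)
      then show False using k'(2) \<open>p dvd k\<close> by blast
    qed
    \<comment> \<open>As \<open>t\<^sub>i\<close> is algebraic, denominators that involve
      \<open>t\<^sub>i\<close> can be replaced by denominators that do not, and then
      \<open>t\<^sub>i\<close> can be eliminated from the coefficients.\<close>
    have mcks: "mult_closed (laurents (set ks) - P)"
      by (rule mult_closed_compl_prime[OF P subring_laurents])
    have "laurents {} \<subseteq> laurents (set ks)" by (rule laurents_mono) simp
    then obtain e0 b where b: "\<And>j. j \<le> e0 \<Longrightarrow> b j \<in> laurents (set ks)" "b 0 \<in> laurents (set ks) - P"
      "b e0 \<in> laurents (set ks) - P" "(\<Sum>j\<le>e0. b j * var_power i (int j)) \<in> P"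
      using algebraic_relation[OF Pid False] by blast
    have spanX1': "v \<in> gspan (laurents Y) (laurents (set ks) - P) N X1" for v
    proof -
      obtain a l where a: "a \<in> laurents Y - P" "l \<in> bspan (laurents Y) X1" "a *s v - l \<in> N"
        using spanX1[of v] unfolding gspan_def by blast
      obtain a' c where c: "a' \<in> laurents Y" "c \<in> laurents (set ks) - P" "a * a' - c \<in> P"
        using algebraic_inverse[OF P b a(1)[unfolded Y_def]] unfolding Y_def by blast
      have "a' *s (a *s v - l) - (a * a' - c) *s v \<in> N"
        by (rule subspace_diff[OF N subspace_scale[OF N a(3)] PN[OF c(3)]])
      then have "c *s v - a' *s l \<in> N" by (simp add: algebra_simps)
      then show ?thesis
        unfolding gspan_def using c(2) bspan_scale[OF subring_laurents c(1) a(2)] by blast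
    qed
    have "\<exists>X2. finite X2 \<and> gspan (laurents (set ks \<union> {i})) (laurents (set ks) - P) N X1
        \<subseteq> gspan (laurents (set ks)) (laurents (set ks) - P) N X2"
    proof (rule gspan_remove_variables[OF N mcks])
      fix k assume "k \<in> {i}"
      then show "\<exists>e b. (\<forall>j\<le>e. b j \<in> laurents (set ks)) \<and> b 0 \<in> laurents (set ks) - P
          \<and> b e \<in> laurents (set ks) - P \<and> (\<forall>v. (\<Sum>j\<le>e. b j * var_power k (int j)) *s v \<in> N)"
        using b PN by blast
    qed (use \<open>finite X1\<close> in auto)
    then obtain X2 where X2: "finite X2" "gspan (laurents (set ks \<union> {i})) (laurents (set ks) - P) N X1
        \<subseteq> gspan (laurents (set ks)) (laurents (set ks) - P) N X2" by blast
    have spanX2: "v \<in> gspan (laurents (set ks)) (laurents (set ks) - P) N X2" for v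
      using spanX1'[of v] X2(2) by (auto simp: Y_def)
    obtain r z where rz: "r \<ge> e * d * (card X2 + 1)" "linear_map z" "z ` N \<subseteq> N"
      "\<And>v. (z ^^ r) v - u ^ d *s v \<in> N" using roots' by blast
    show False
    proof (rule no_large_root_if_algebraic[OF P N PN tf x X2(1) spanX2 tower s p(1) k'(2) \<open>0 < e\<close>, where z = z and r = r and d = d])
      show "h1 \<in> half_laurents {} i s" using k(1) by (simp add: D0_def)
      show "of_int (p ^ e * k') + var_power i (- s) * h1 \<in> P"
        using k(2) unfolding e_def k'(1)[symmetric] u_def .
      show "p dvd a" if "h \<in> half_laurents {} i s" "of_int a + var_power i (- s) * h \<in> P" for a h
        using p(2)[of a] that by (auto simp: I_def D0_def u_def)
    qed (use pP rz \<open>0 < d\<close> in \<open>auto simp: u_def\<close>)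
  qed
qed

end

section \<open>Setting variables equal to one\<close>

definition restrict_exponent :: "nat set \<Rightarrow> (nat \<Rightarrow>\<^sub>0 int) \<Rightarrow> (nat \<Rightarrow>\<^sub>0 int)"
  where "restrict_exponent Z e = Poly_Mapping.mapp (\<lambda>k v. if k \<in> Z then v else 0) e"

lemma lookup_restrict_exponent:
  "lookup (restrict_exponent Z e) k = (if k \<in> Z then lookup e k else 0)"
  by (auto simp: restrict_exponent_def lookup_mapp in_keys_iff when_def)

lemma restrict_exponent_add: "restrict_exponent Z (e + f) = restrict_exponent Z e + restrict_exponent Z f"
  by (rule poly_mapping_eqI) (simp add: lookup_restrict_exponent lookup_add)

lemma keys_restrict_exponent: "keys (restrict_exponent Z e) \<subseteq> Z"
  by (auto simp: in_keys_iff lookup_restrict_exponent split: if_splits)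

lemma restrict_exponent_id:
  assumes "keys e \<subseteq> Z"
  shows "restrict_exponent Z e = e"
proof (rule poly_mapping_eqI)
  fix k
  show "lookup (restrict_exponent Z e) k = lookup e k"
    using assms by (cases "k \<in> Z") (auto simp: lookup_restrict_exponent in_keys_iff)
qed

text \<open>
The ring homomorphism that sends \<open>t\<^sub>k\<close> to 1 for all \<open>k \<notin> Z\<close>. Through it a module over the ring in
finitely many variables becomes a module over the whole type.
\<close>

definition specialize :: "nat set \<Rightarrow> laurent \<Rightarrow> laurent"
  where "specialize Z p = (\<Sum>e\<in>keys p. single (restrict_exponent Z e) (lookup p e))"

lemma specialize_superset:
  assumes "finite K" "keys p \<subseteq> K"
  shows "specialize Z p = (\<Sum>e\<in>K. single (restrict_exponent Z e) (lookup p e))"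
  unfolding specialize_def
  by (rule sum.mono_neutral_left) (use assms in \<open>auto simp: in_keys_iff\<close>)

lemma specialize_add: "specialize Z (p + q) = specialize Z p + specialize Z q"
  using specialize_superset[of "keys p \<union> keys q" p Z] specialize_superset[of "keys p \<union> keys q" q Z]
    specialize_superset[of "keys p \<union> keys q" "p + q" Z] Poly_Mapping.keys_add[of p q]
  by (simp add: lookup_add single_add sum.distrib)

lemma specialize_single: "specialize Z (single e a) = single (restrict_exponent Z e) a"
  by (simp add: specialize_def)

lemma specialize_0 [simp]: "specialize Z 0 = 0"
  by (simp add: specialize_def)

lemma specialize_mult: "specialize Z (p * q) = specialize Z p * specialize Z q"
proof (induction p rule: poly_mapping_additive_induct)
  case (single e a)
  show ?case
    by (induction q rule: poly_mapping_additive_induct)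
      (simp_all add: mult_single specialize_single restrict_exponent_add specialize_add distrib_left)
qed (simp_all add: specialize_add distrib_right)

lemma specialize_laurents: "specialize Z p \<in> laurents Z"
  unfolding specialize_def
  by (rule subring_sum[OF subring_laurents])
    (use keys_restrict_exponent in \<open>auto simp: laurents_def\<close>)

lemma specialize_id:
  assumes "p \<in> laurents Z"
  shows "specialize Z p = p"
proof -
  have "specialize Z p = (\<Sum>e\<in>keys p. single e (lookup p e))"
    unfolding specialize_def
    by (rule sum.cong) (use assms in \<open>auto simp: restrict_exponent_id laurents_def\<close>)
  then show ?thesis by (simp add: poly_mapping_sum_single)
qed

section \<open>Combining the relations for a variable and its inverse\<close>

lemma lookup_half_laurents_zero:
  assumes "h \<in> half_laurents Z i s" "s * lookup e i > 0"
  shows "lookup h e = 0"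
proof (rule ccontr)
  assume "lookup h e \<noteq> 0"
  then have "e \<in> keys h" by (simp add: in_keys_iff)
  then show False using assms by (fastforce simp: half_laurents_def)
qed

text \<open>
The element formed with \<open>h\<close> has top coefficient 1 and the one formed with \<open>g\<close> has bottom coefficient 1.
After a shift of the first one by a power of \<open>t\<^sub>i\<close> so large that neither reaches the extreme degree
of the other, their sum has both.
\<close>

lemma bimonic_combination:
  assumes h: "h \<in> half_laurents {} i 1" and g: "g \<in> half_laurents {} i (- 1)"
  shows "\<exists>e b a. (\<forall>j\<le>e. b j \<in> laurents {}) \<and> b 0 = 1 \<and> b e = 1 \<and>
    (\<Sum>j\<le>e. b j * var_power i (int j)) = a * (1 + var_power i (- 1) * h) + (1 + var_power i 1 * g)"
proof -
  define p where "p = 1 + var_power i (- 1) * h"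
  define p' where "p' = 1 + var_power i 1 * g"
  have pL: "p \<in> laurents {i}" and p'L: "p' \<in> laurents {i}"
    unfolding p_def p'_def using h g half_laurents_subset[of "{}" i]
    by (auto intro!: subring_closed(1,3,5)[OF subring_laurents] var_power_laurents)
  have lp: "lookup p e = (1 when e = 0) + lookup h (e + single i 1)" for e
    unfolding p_def lookup_add lookup_one mult.commute[of "var_power i (- 1)"] lookup_mult_var_power
    by (simp add: single_uminus)
  have lp': "lookup p' e = (1 when e = 0) + lookup g (e - single i 1)" for e
    unfolding p'_def lookup_add lookup_one mult.commute[of "var_power i 1"] lookup_mult_var_power
    by simp
  define B where "B = (\<Sum>e\<in>keys p \<union> keys p'. nat \<bar>lookup e i\<bar>)"
  have B: "\<bar>lookup e i\<bar> \<le> int B" if "e \<in> keys p \<union> keys p'" for e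
  proof -
    have "nat \<bar>lookup e i\<bar> \<le> B" unfolding B_def by (rule member_le_sum) (use that in auto)
    then show ?thesis by linarith
  qed
  define N where "N = Suc B"
  define q where "q = p * var_power i (int N) + p'"
  have qL: "q \<in> laurents {i}"
    unfolding q_def using pL p'L
    by (auto intro!: subring_closed(3,5)[OF subring_laurents] var_power_laurents)
  have lq: "lookup q e = lookup p (e - single i (int N)) + lookup p' e" for e
    by (simp add: q_def lookup_add lookup_mult_var_power)
  have range: "0 \<le> lookup e i \<and> lookup e i \<le> int N" if e: "e \<in> keys q" for e
  proof -
    have "lookup p (e - single i (int N)) \<noteq> 0 \<or> lookup p' e \<noteq> 0"
      using e by (auto simp: in_keys_iff lq)
    then show ?thesis
    proof
      assume *: "lookup p (e - single i (int N)) \<noteq> 0"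
      then have "\<bar>lookup e i - int N\<bar> \<le> int B"
        using B[of "e - single i (int N)"] by (simp add: in_keys_iff lookup_minus)
      moreover have "lookup e i \<le> int N"
      proof (rule ccontr)
        assume "\<not> lookup e i \<le> int N"
        then have "e - single i (int N) \<noteq> 0" by (auto simp: lookup_minus dest: arg_cong[where f = "\<lambda>e. lookup e i"])
        moreover have "lookup h (e - single i (int N) + single i 1) = 0"
          by (rule lookup_half_laurents_zero[OF h]) (use \<open>\<not> lookup e i \<le> int N\<close> in \<open>simp add: lookup_add lookup_minus\<close>)
        ultimately show False using * by (simp add: lp)
      qed
      ultimately show ?thesis by (simp add: N_def)
    next
      assume *: "lookup p' e \<noteq> 0"
      then have "\<bar>lookup e i\<bar> \<le> int B" using B[of e] by (simp add: in_keys_iff)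
      moreover have "0 \<le> lookup e i"
      proof (rule ccontr)
        assume "\<not> 0 \<le> lookup e i"
        then have "e \<noteq> 0" by auto
        moreover have "lookup g (e - single i 1) = 0"
          by (rule lookup_half_laurents_zero[OF g]) (use \<open>\<not> 0 \<le> lookup e i\<close> in \<open>simp add: lookup_minus\<close>)
        ultimately show False using * by (simp add: lp')
      qed
      ultimately show ?thesis by (simp add: N_def)
    qed
  qed
  define b where "b j = slice i q (int j)" for j
  have bL: "b j \<in> laurents {}" for j unfolding b_def by (rule slice_laurents[OF qL])
  have bl: "b j = of_int (lookup q (single i (int j)))" for j
    using laurents_empty[OF bL[of j]] by (simp add: b_def lookup_slice)
  have h0: "lookup h (single i 1) = 0" by (rule lookup_half_laurents_zero[OF h]) simp
  have g0: "lookup g (- single i 1) = 0" by (rule lookup_half_laurents_zero[OF g]) simp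
  have p0: "lookup p 0 = 1" using h0 by (simp add: lp)
  have p'0: "lookup p' 0 = 1" using g0 by (simp add: lp')
  have "lookup p (- single i (int N)) = 0"
  proof (rule ccontr)
    assume "lookup p (- single i (int N)) \<noteq> 0"
    then show False using B[of "- single i (int N)"] by (simp add: in_keys_iff N_def)
  qed
  then have b0: "b 0 = 1" using p'0 by (simp add: bl lq)
  have "lookup p' (single i (int N)) = 0"
  proof (rule ccontr)
    assume "lookup p' (single i (int N)) \<noteq> 0"
    then show False using B[of "single i (int N)"] by (simp add: in_keys_iff N_def)
  qed
  then have bN: "b N = 1" using p0 by (simp add: bl lq)
  have "q = (\<Sum>j\<in>int ` {..N}. slice i q j * var_power i j)"
  proof (rule sum_slices)
    fix e assume "e \<in> keys q"
    from range[OF this] show "lookup e i \<in> int ` {..N}"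
      by (intro image_eqI[of _ _ "nat (lookup e i)"]) auto
  qed simp
  also have "\<dots> = (\<Sum>j\<le>N. b j * var_power i (int j))"
    by (subst sum.reindex) (simp_all add: b_def)
  finally have "(\<Sum>j\<le>N. b j * var_power i (int j)) = var_power i (int N) * p + p'"
    by (simp add: q_def mult.commute)
  then show ?thesis using bL b0 bN unfolding p_def p'_def by blast
qed

section \<open>Roots in the automorphism group\<close>

lemma laurent_ring_ops:
  "a \<otimes>\<^bsub>laurent_ring n\<^esub> b = a * b" "a \<oplus>\<^bsub>laurent_ring n\<^esub> b = a + b"
  "\<one>\<^bsub>laurent_ring n\<^esub> = 1" "\<zero>\<^bsub>laurent_ring n\<^esub> = 0"
  by (simp_all add: laurent_ring_def)

lemma ModuleAutoGroup_simps:
  assumes "v \<in> carrier (ModuleAutoGroup R M)" "w \<in> carrier (ModuleAutoGroup R M)" "x \<in> carrier M"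
  shows "(v \<otimes>\<^bsub>ModuleAutoGroup R M\<^esub> w) x = v (w x)" "w x \<in> carrier M"
    "\<one>\<^bsub>ModuleAutoGroup R M\<^esub> x = x"
proof -
  have b: "v \<in> Bij (carrier M)" "w \<in> Bij (carrier M)"
    using assms by (auto simp: ModuleAutoGroup_def module_auto_def)
  then show "(v \<otimes>\<^bsub>ModuleAutoGroup R M\<^esub> w) x = v (w x)"
    using assms(3) by (simp add: ModuleAutoGroup_def BijGroup_def compose_eq)
  show "w x \<in> carrier M" using Bij_imp_funcset[OF b(2)] assms(3) by blast
  show "\<one>\<^bsub>ModuleAutoGroup R M\<^esub> x = x" using assms(3) by (simp add: ModuleAutoGroup_def BijGroup_def)
qed

lemma ModuleAutoGroup_pow:
  assumes M: "Module.module R M" and w: "w \<in> carrier (ModuleAutoGroup R M)" and x: "x \<in> carrier M"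
  shows "(w [^]\<^bsub>ModuleAutoGroup R M\<^esub> (k::nat)) x = (w ^^ k) x"
  using x
proof (induction k arbitrary: x)
  case 0
  then show ?case using ModuleAutoGroup_simps(3)[OF w w] by simp
next
  case (Suc k)
  interpret group "ModuleAutoGroup R M" by (rule group_ModuleAutoGroup[OF M])
  have "w x \<in> carrier M" by (rule ModuleAutoGroup_simps(2)[OF w w Suc.prems])
  then show ?case
    using ModuleAutoGroup_simps(1)[OF nat_pow_closed[OF w] w Suc.prems] Suc.IH
    by (simp add: funpow_swap1)
qed

text \<open>
If \<open>d\<close> has the wrong sign, the inverse of \<open>w\<close> is a root of the power with the opposite exponent.
\<close>

lemma exists_root_of_sign:
  assumes M: "Module.module (laurent_ring n) M" and i: "i \<in> {1..n}" and s: "s = 1 \<or> s = - 1"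
    and w: "w \<in> carrier (ModuleAutoGroup (laurent_ring n) M)"
    and pow: "w [^]\<^bsub>ModuleAutoGroup (laurent_ring n) M\<^esub> int r
      = (\<lambda>x\<in>carrier M. (laurent_var i [^]\<^bsub>laurent_ring n\<^esub> (d::int)) \<odot>\<^bsub>M\<^esub> x)"
  shows "\<exists>z\<in>carrier (ModuleAutoGroup (laurent_ring n) M).
    \<forall>x\<in>carrier M. (z ^^ r) x = var_power i (- s) ^ nat \<bar>d\<bar> \<odot>\<^bsub>M\<^esub> x"
proof -
  interpret Module.module "laurent_ring n" M by fact
  interpret G: group "ModuleAutoGroup (laurent_ring n) M" by (rule group_ModuleAutoGroup[OF M])
  let ?G = "ModuleAutoGroup (laurent_ring n) M"
  have vc: "var_power i j \<in> carrier (laurent_ring n)" for j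
    using i by (simp add: carrier_laurent_ring var_power_laurents)
  have wr: "(w ^^ r) x = var_power i d \<odot>\<^bsub>M\<^esub> x" if "x \<in> carrier M" for x
  proof -
    have "(w ^^ r) x = (w [^]\<^bsub>?G\<^esub> int r) x"
      using ModuleAutoGroup_pow[OF M w that, of r] by (simp add: int_pow_int)
    then show ?thesis unfolding pow laurent_var_int_pow[OF i] using that by (simp add: var_power_def)
  qed
  have vp: "var_power i (- s) ^ nat \<bar>d\<bar> = var_power i (- s * \<bar>d\<bar>)" by (simp add: var_power_power)
  show ?thesis
  proof (cases "- s * \<bar>d\<bar> = d")
    case True
    then show ?thesis unfolding vp using wr w by auto
  next
    case False
    then have d: "- s * \<bar>d\<bar> = - d" using s by auto
    let ?v = "inv\<^bsub>?G\<^esub> w"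
    have v: "?v \<in> carrier ?G" using w by simp
    have "(?v ^^ r) x = var_power i (- d) \<odot>\<^bsub>M\<^esub> x" if x: "x \<in> carrier M" for x
    proof -
      let ?y = "(?v ^^ r) x"
      have vr: "?v [^]\<^bsub>?G\<^esub> r \<in> carrier ?G" "w [^]\<^bsub>?G\<^esub> r \<in> carrier ?G" using v w by simp_all
      have y: "?y = (?v [^]\<^bsub>?G\<^esub> r) x" using ModuleAutoGroup_pow[OF M v x] by simp
      have yM: "?y \<in> carrier M" unfolding y by (rule ModuleAutoGroup_simps(2)[OF vr(1) vr(1) x])
      have "w [^]\<^bsub>?G\<^esub> r \<otimes>\<^bsub>?G\<^esub> ?v [^]\<^bsub>?G\<^esub> r = \<one>\<^bsub>?G\<^esub>"
        using w by (simp add: G.nat_pow_inv)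
      then have "(w [^]\<^bsub>?G\<^esub> r) ((?v [^]\<^bsub>?G\<^esub> r) x) = x"
        using ModuleAutoGroup_simps(1)[OF vr(2,1) x] ModuleAutoGroup_simps(3)[OF w w x] by simp
      then have "var_power i d \<odot>\<^bsub>M\<^esub> ?y = x"
        using wr[OF yM] ModuleAutoGroup_pow[OF M w yM] unfolding y by simp
      then have "var_power i (- d) \<odot>\<^bsub>M\<^esub> x = var_power i (- d) \<odot>\<^bsub>M\<^esub> (var_power i d \<odot>\<^bsub>M\<^esub> ?y)" by simp
      also have "\<dots> = (var_power i (- d) * var_power i d) \<odot>\<^bsub>M\<^esub> ?y"
        using smult_assoc1[OF vc vc yM] by (simp add: laurent_ring_ops)
      also have "\<dots> = ?y" using smult_one[OF yM] unfolding var_power_add[symmetric]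
        by (simp add: laurent_ring_ops)
      finally show ?thesis by simp
    qed
    then show ?thesis unfolding vp d using v by blast
  qed
qed

section \<open>Finite generation over the integers\<close>

lemma smult_of_int:
  fixes M (structure)
  assumes M: "Module.module (laurent_ring n) M" and x: "x \<in> carrier M"
  shows "of_int k \<odot> x = [k] \<cdot> x"
proof -
  interpret Module.module "laurent_ring n" M by fact
  have c: "of_int k \<in> carrier (laurent_ring n)" for k
    unfolding carrier_laurent_ring by (rule of_int_laurents)
  have nat: "of_int (int m) \<odot> x = [m] \<cdot> x" for m :: nat
  proof (induction m)
    case 0
    show ?case using smult_l_null[OF x] by (simp add: laurent_ring_ops)
  next
    case (Suc m)
    have "of_int (int (Suc m)) \<odot> x = (of_int (int m) \<oplus>\<^bsub>laurent_ring n\<^esub> \<one>\<^bsub>laurent_ring n\<^esub>) \<odot> x"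
      by (simp add: laurent_ring_ops add.commute)
    also have "\<dots> = of_int (int m) \<odot> x \<oplus> x"
      by (subst smult_l_distr) (use c[of "int m"] x in auto)
    finally show ?case using Suc by simp
  qed
  show ?thesis
  proof (cases "0 \<le> k")
    case True
    then show ?thesis using nat[of "nat k"] by (simp add: add_pow_int_ge)
  next
    case False
    have "of_int k \<odot> x \<oplus> of_int (- k) \<odot> x = \<zero>"
      using smult_l_distr[OF c[of k] c[of "- k"] x] smult_l_null[OF x] by (simp add: laurent_ring_ops)
    then have "of_int k \<odot> x = \<ominus> (of_int (- k) \<odot> x)"
      by (rule minus_equality[symmetric]) (use x in \<open>simp_all only: smult_closed[OF c]\<close>)
    then show ?thesis using False nat[of "nat (- k)"] by (simp add: add_pow_int_lt)
  qed
qed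

text \<open>
The generators \<open>y b\<close> may coincide for different \<open>b\<close>, whereas \<open>fin_gen_module\<close> asks for a set of generators.
\<close>

lemma fin_gen_over_int:
  fixes M :: "(laurent, 'm) module" (structure)
  assumes M: "Module.module (laurent_ring n) M"
    and T: "finite T" "T \<subseteq> carrier M"
    and gen: "\<And>x. x \<in> carrier M \<Longrightarrow> \<exists>X y k. finite X \<and> (\<forall>b\<in>X. y b \<in> T)
      \<and> x = (\<Oplus>b\<in>(X :: 'b set). of_int (k b) \<odot> y b)"
  shows "fin_gen_module int_ring (int_module M)"
proof -
  interpret Module.module "laurent_ring n" M by fact
  have cl: "of_int k \<in> carrier (laurent_ring n)" for k
    unfolding carrier_laurent_ring by (rule of_int_laurents)
  have sc: "of_int k \<odot> t \<in> carrier M" if "t \<in> carrier M" for k t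
    by (rule smult_closed[OF cl that])
  define C where "C = {\<Oplus>t\<in>T. of_int (c t) \<odot> t | c :: 'm \<Rightarrow> int. True}"
  have C_I: "(\<Oplus>t\<in>T. of_int (c t) \<odot> t) \<in> C" for c unfolding C_def by blast
  have C_zero: "\<zero> \<in> C"
  proof -
    have "(\<Oplus>t\<in>T. of_int 0 \<odot> t) = (\<Oplus>t\<in>T. \<zero>)"
      by (rule finsum_cong') (use T smult_l_null in \<open>auto simp: laurent_ring_ops\<close>)
    then show ?thesis using C_I[of "\<lambda>_. 0"] by simp
  qed
  have C_add: "u \<oplus> v \<in> C" if uv: "u \<in> C" "v \<in> C" for u v
  proof -
    obtain c c' where c: "u = (\<Oplus>t\<in>T. of_int (c t) \<odot> t)" "v = (\<Oplus>t\<in>T. of_int (c' t) \<odot> t)"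
      using uv by (auto simp: C_def)
    have "u \<oplus> v = (\<Oplus>t\<in>T. of_int (c t) \<odot> t \<oplus> of_int (c' t) \<odot> t)"
      unfolding c by (rule finsum_addf[symmetric]) (use T sc in auto)
    also have "\<dots> = (\<Oplus>t\<in>T. of_int (c t + c' t) \<odot> t)"
    proof (rule finsum_cong')
      fix t assume "t \<in> T"
      then have t: "t \<in> carrier M" using T by blast
      show "of_int (c t) \<odot> t \<oplus> of_int (c' t) \<odot> t = of_int (c t + c' t) \<odot> t"
        using smult_l_distr[OF cl[of "c t"] cl[of "c' t"] t] by (simp add: laurent_ring_ops)
    qed (use T in \<open>auto simp del: of_int_add intro!: sc\<close>)
    finally show ?thesis using C_I[of "\<lambda>t. c t + c' t"] by simp
  qed
  have C_single: "of_int k \<odot> t \<in> C" if t: "t \<in> T" for k t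
  proof -
    have tM: "t \<in> carrier M" using t T by blast
    have "(\<Oplus>t'\<in>T. of_int (if t' = t then k else 0) \<odot> t')
        = (\<Oplus>t'\<in>T. if t = t' then of_int k \<odot> t' else \<zero>)"
    proof (rule finsum_cong')
      fix t' assume "t' \<in> T"
      then show "of_int (if t' = t then k else 0) \<odot> t'
          = (if t = t' then of_int k \<odot> t' else \<zero>)"
        using T smult_l_null[of t'] by (auto simp: laurent_ring_ops)
    qed (use T sc in auto)
    also have "\<dots> = of_int k \<odot> t"
      by (rule finsum_singleton[OF t T(1)]) (use T sc in auto)
    finally show ?thesis using C_I[of "\<lambda>t'. if t' = t then k else 0"] by simp
  qed
  have all: "x \<in> C" if x: "x \<in> carrier M" for x
  proof -
    obtain X y k where X: "finite (X :: 'b set)" "\<forall>b\<in>X. y b \<in> T"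
      "x = (\<Oplus>b\<in>X. of_int (k b) \<odot> y b)" using gen[OF x] by blast
    have "(\<Oplus>b\<in>X. of_int (k b) \<odot> y b) \<in> C" using X(1,2)
    proof (induction X rule: finite_induct)
      case (insert b X)
      then have "(\<Oplus>b\<in>insert b X. of_int (k b) \<odot> y b)
          = of_int (k b) \<odot> y b \<oplus> (\<Oplus>b\<in>X. of_int (k b) \<odot> y b)"
        using T sc by (intro finsum_insert) auto
      then show ?case using insert C_add C_single by auto
    qed (use C_zero in simp)
    then show ?thesis using X(3) by simp
  qed
  have fs: "finsum (int_module M) f A = finsum M f A" for f :: "'m \<Rightarrow> 'm" and A
    unfolding finsum_def finprod_def by (simp add: int_module_def)
  show ?thesis
    unfolding fin_gen_module_def
  proof (intro exI[of _ T] conjI ballI)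
    show "finite T" "T \<subseteq> carrier (int_module M)" using T by (simp_all add: int_module_def)
    fix x assume "x \<in> carrier (int_module M)"
    then have "x \<in> C" using all by (simp add: int_module_def)
    then obtain c where "x = (\<Oplus>t\<in>T. of_int (c t) \<odot> t)" by (auto simp: C_def)
    also have "\<dots> = (\<Oplus>t\<in>T. [c t] \<cdot> t)"
    proof (rule finsum_cong')
      fix t assume "t \<in> T"
      then show "of_int (c t) \<odot> t = [c t] \<cdot> t" using T smult_of_int[OF M] by blast
    qed (use T in auto)
    finally have "x = (\<Oplus>\<^bsub>int_module M\<^esub>t\<in>T. c t \<odot>\<^bsub>int_module M\<^esub> t)"
      unfolding fs by (simp add: int_module_def)
    then show "\<exists>c\<in>T \<rightarrow> carrier int_ring. x = (\<Oplus>\<^bsub>int_module M\<^esub>t\<in>T. c t \<odot>\<^bsub>int_module M\<^esub> t)"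
      by (intro bexI[of _ c]) auto
  qed
qed

theorem theorem1p4:
  fixes n :: nat
    and M :: "(laurent, 'm) module"
  assumes "Module.module (laurent_ring n) M"
    and "fin_gen_module (laurent_ring n) M"
    and "\<forall>i \<in> {1..n}. \<exists>(d::int) (r :: nat \<Rightarrow> int) (w :: nat \<Rightarrow> 'm \<Rightarrow> 'm).
      d \<noteq> 0 \<and> filterlim r at_top sequentially \<and>
      (\<forall>j. w j \<in> carrier (ModuleAutoGroup (laurent_ring n) M) \<and>
        w j [^]\<^bsub>ModuleAutoGroup (laurent_ring n) M\<^esub> r j
          = (\<lambda>x \<in> carrier M. (laurent_var i [^]\<^bsub>laurent_ring n\<^esub> d) \<odot>\<^bsub>M\<^esub> x))"
  shows "fin_gen_module int_ring (int_module M)"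
proof -
  interpret Module.module "laurent_ring n" M by fact
  let ?W = "{1..n}"
  obtain S where S: "finite S" "S \<subseteq> carrier M"
    and gen: "\<And>x. x \<in> carrier M \<Longrightarrow> \<exists>c\<in>S \<rightarrow> carrier (laurent_ring n). x = (\<Oplus>\<^bsub>M\<^esub>s\<in>S. c s \<odot>\<^bsub>M\<^esub> s)"
    using assms(2) unfolding fin_gen_module_def by blast
  \<comment> \<open>The type of functions from \<open>'m\<close> to Laurent polynomials is a
    module over all Laurent polynomials; \<open>phi\<close> maps it onto \<open>M\<close>, and
    \<open>N0\<close> is the kernel.\<close>
  define sc :: "laurent \<Rightarrow> ('m \<Rightarrow> laurent) \<Rightarrow> ('m \<Rightarrow> laurent)" where "sc a f = (\<lambda>y. a * f y)" for a f
  interpret V: laurent_module sc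
    by unfold_locales (auto simp: sc_def fun_eq_iff algebra_simps)
  define psi where "psi = specialize ?W"
  have psi_c: "psi a \<in> carrier (laurent_ring n)" for a
    unfolding psi_def carrier_laurent_ring by (rule specialize_laurents)
  have psi_id: "psi a = a" if "a \<in> carrier (laurent_ring n)" for a
    using specialize_id that unfolding psi_def carrier_laurent_ring by blast
  have psi_add: "psi (a + b) = psi a + psi b" and psi_mult: "psi (a * b) = psi a * psi b"
    and psi_0: "psi 0 = 0" for a b
    by (simp_all add: psi_def specialize_add specialize_mult)
  define phi where "phi f = (\<Oplus>\<^bsub>M\<^esub>s\<in>S. psi (f s) \<odot>\<^bsub>M\<^esub> s)" for f
  have term_c: "psi a \<odot>\<^bsub>M\<^esub> s \<in> carrier M" if "s \<in> carrier M" for a s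
    by (rule smult_closed[OF psi_c that])
  have phi_c: "phi f \<in> carrier M" for f
    unfolding phi_def by (rule finsum_closed) (use S term_c in auto)
  have phi_add: "phi (f + g) = phi f \<oplus>\<^bsub>M\<^esub> phi g" for f g
  proof -
    have "phi (f + g) = (\<Oplus>\<^bsub>M\<^esub>s\<in>S. psi (f s) \<odot>\<^bsub>M\<^esub> s \<oplus>\<^bsub>M\<^esub> psi (g s) \<odot>\<^bsub>M\<^esub> s)"
      unfolding phi_def
    proof (rule finsum_cong')
      fix s assume "s \<in> S"
      then have s: "s \<in> carrier M" using S by blast
      show "psi ((f + g) s) \<odot>\<^bsub>M\<^esub> s = psi (f s) \<odot>\<^bsub>M\<^esub> s \<oplus>\<^bsub>M\<^esub> psi (g s) \<odot>\<^bsub>M\<^esub> s"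
        using smult_l_distr[OF psi_c psi_c s, of "f s" "g s"] by (simp add: psi_add laurent_ring_ops)
    qed (use S term_c in auto)
    also have "\<dots> = phi f \<oplus>\<^bsub>M\<^esub> phi g"
      unfolding phi_def by (rule finsum_addf) (use S term_c in auto)
    finally show ?thesis .
  qed
  have phi_sc: "phi (sc a f) = psi a \<odot>\<^bsub>M\<^esub> phi f" for a f
  proof -
    have "psi a \<odot>\<^bsub>M\<^esub> phi f = (\<Oplus>\<^bsub>M\<^esub>s\<in>S. psi a \<odot>\<^bsub>M\<^esub> (psi (f s) \<odot>\<^bsub>M\<^esub> s))"
      unfolding phi_def by (rule finsum_smult_ldistr[OF S(1) psi_c]) (use S term_c in auto)
    also have "\<dots> = phi (sc a f)"
      unfolding phi_def
    proof (rule finsum_cong')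
      fix s assume "s \<in> S"
      then have s: "s \<in> carrier M" using S by blast
      show "psi a \<odot>\<^bsub>M\<^esub> (psi (f s) \<odot>\<^bsub>M\<^esub> s) = psi (sc a f s) \<odot>\<^bsub>M\<^esub> s"
        using smult_assoc1[OF psi_c psi_c s, of a "f s"] by (simp add: psi_mult laurent_ring_ops sc_def)
    qed (use S term_c in auto)
    finally show ?thesis ..
  qed
  have phi_0: "phi 0 = \<zero>\<^bsub>M\<^esub>"
    using phi_sc[of 0 0] smult_l_null[OF phi_c, of 0] by (simp add: psi_0 laurent_ring_ops)
  have phi_sum: "phi (sum g I) = (\<Oplus>\<^bsub>M\<^esub>i\<in>I. phi (g i))" if "finite I" for g :: "'i \<Rightarrow> 'm \<Rightarrow> laurent" and I
    using that
  proof (induction I rule: finite_induct)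
    case (insert i I)
    then show ?case by (subst finsum_insert) (use phi_c in \<open>auto simp: phi_add\<close>)
  qed (use phi_0 in \<open>simp add: zero_fun_def\<close>)
  have phi_eq: "phi f = phi g" if "phi (f - g) = \<zero>\<^bsub>M\<^esub>" for f g
    using phi_add[of "f - g" g] that phi_c[of g] by simp
  have phi_diff: "phi (f - g) = \<zero>\<^bsub>M\<^esub>" if "phi f = phi g" for f g
  proof -
    have "phi (f - g) \<oplus>\<^bsub>M\<^esub> phi g = \<zero>\<^bsub>M\<^esub> \<oplus>\<^bsub>M\<^esub> phi g"
      using phi_add[of "f - g" g] that phi_c by simp
    then show ?thesis using phi_c by (metis add.right_cancel zero_closed)
  qed
  define N0 where "N0 = {f. phi f = \<zero>\<^bsub>M\<^esub>}"
  have N0: "V.subspace N0"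
    by (rule V.subspaceI) (use psi_c in \<open>auto simp: N0_def phi_0 phi_add phi_sc smult_r_null\<close>)
  define del where "del s = (\<lambda>y. if y = s then 1 else 0 :: laurent)" for s :: 'm
  have phi_del: "phi (del s) = s" if "s \<in> S" for s
  proof -
    have sM: "s \<in> carrier M" using that S by blast
    have "phi (del s) = (\<Oplus>\<^bsub>M\<^esub>t\<in>S. if s = t then t else \<zero>\<^bsub>M\<^esub>)"
      unfolding phi_def
    proof (rule finsum_cong')
      fix t assume "t \<in> S"
      then have t: "t \<in> carrier M" using S by blast
      show "psi (del s t) \<odot>\<^bsub>M\<^esub> t = (if s = t then t else \<zero>\<^bsub>M\<^esub>)"
        using smult_one[OF t] smult_l_null[OF t] psi_id[OF one_closed]
        by (auto simp: del_def psi_0 laurent_ring_ops)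
    qed (use S in auto)
    also have "\<dots> = s" by (rule finsum_singleton[OF that S(1)]) (use S in auto)
    finally show ?thesis .
  qed
  have phi_comb: "phi (\<Sum>s\<in>S. sc (c s) (v s)) = (\<Oplus>\<^bsub>M\<^esub>s\<in>S. psi (c s) \<odot>\<^bsub>M\<^esub> phi (v s))" for c v
    by (simp add: phi_sum[OF S(1)] phi_sc)
  have phi_del_comb: "phi (\<Sum>s\<in>S. sc (c s) (del s)) = (\<Oplus>\<^bsub>M\<^esub>s\<in>S. psi (c s) \<odot>\<^bsub>M\<^esub> s)" for c
    unfolding phi_comb by (rule finsum_cong') (use S phi_del term_c in auto)
  have surj: "\<exists>f. phi f = x" if x: "x \<in> carrier M" for x
  proof -
    obtain c where c: "c \<in> S \<rightarrow> carrier (laurent_ring n)" "x = (\<Oplus>\<^bsub>M\<^esub>s\<in>S. c s \<odot>\<^bsub>M\<^esub> s)"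
      using gen[OF x] by blast
    have "phi c = x"
      unfolding phi_def c(2)
    proof (rule finsum_cong')
      fix s assume "s \<in> S"
      then show "psi (c s) \<odot>\<^bsub>M\<^esub> s = c s \<odot>\<^bsub>M\<^esub> s" using c(1) psi_id by (metis Pi_mem)
    qed (use S c(1) in \<open>auto intro!: smult_closed\<close>)
    then show ?thesis by blast
  qed
  define X where "X = del ` S"
  have fX: "finite X" using S by (simp add: X_def)
  have genX: "\<exists>l\<in>V.bspan (laurents ?W) X. v - l \<in> N0" for v
  proof
    let ?l = "\<Sum>s\<in>S. sc (psi (v s)) (del s)"
    show "?l \<in> V.bspan (laurents ?W) X"
    proof (rule V.bspan_sum[OF subring_laurents])
      fix s assume "s \<in> S"
      then have "del s \<in> V.bspan (laurents ?W) X"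
        by (intro V.bspan_base[OF subring_laurents fX]) (simp add: X_def)
      then show "sc (psi (v s)) (del s) \<in> V.bspan (laurents ?W) X"
        using psi_c[of "v s"] unfolding carrier_laurent_ring
        by (intro V.bspan_scale[OF subring_laurents])
    qed
    have "phi ?l = (\<Oplus>\<^bsub>M\<^esub>s\<in>S. psi (psi (v s)) \<odot>\<^bsub>M\<^esub> s)" by (rule phi_del_comb)
    also have "\<dots> = phi v" by (simp add: phi_def psi_id[OF psi_c])
    finally have "phi ?l = phi v" .
    then show "v - ?l \<in> N0" unfolding N0_def using phi_diff by simp
  qed
  \<comment> \<open>An automorphism of \<open>M\<close> lifts to a linear map of functions: choose
    preimages of the images of the generators.\<close>
  have lift: "\<exists>f. V.linear_map f \<and> f ` N0 \<subseteq> N0 \<and> (\<forall>v. phi (f v) = z (phi v))"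
    if z: "z \<in> carrier (ModuleAutoGroup (laurent_ring n) M)" for z
  proof -
    have zc: "z x \<in> carrier M" if "x \<in> carrier M" for x by (rule ModuleAutoGroup_simps(2)[OF z z that])
    have z_add: "z (x \<oplus>\<^bsub>M\<^esub> y) = z x \<oplus>\<^bsub>M\<^esub> z y" if "x \<in> carrier M" "y \<in> carrier M" for x y
      using z that by (simp add: ModuleAutoGroup_def module_auto_def)
    have z_smult: "z (a \<odot>\<^bsub>M\<^esub> x) = a \<odot>\<^bsub>M\<^esub> z x" if "a \<in> carrier (laurent_ring n)" "x \<in> carrier M" for a x
      using z that by (simp add: ModuleAutoGroup_def module_auto_def)
    have z_zero: "z \<zero>\<^bsub>M\<^esub> = \<zero>\<^bsub>M\<^esub>"
      using z_smult[of "\<zero>\<^bsub>laurent_ring n\<^esub>" "\<zero>\<^bsub>M\<^esub>"] smult_l_null[OF zc[OF zero_closed]] by simp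
    have z_sum: "z (\<Oplus>\<^bsub>M\<^esub>s\<in>T. g s) = (\<Oplus>\<^bsub>M\<^esub>s\<in>T. z (g s))"
      if "finite T" "g \<in> T \<rightarrow> carrier M" for g and T :: "'m set"
      using that
    proof (induction T rule: finite_induct)
      case (insert s T)
      then have "z (g s \<oplus>\<^bsub>M\<^esub> (\<Oplus>\<^bsub>M\<^esub>s\<in>T. g s)) = z (g s) \<oplus>\<^bsub>M\<^esub> z (\<Oplus>\<^bsub>M\<^esub>s\<in>T. g s)"
        by (intro z_add finsum_closed) auto
      with insert show ?case using zc by (auto simp: finsum_insert Pi_iff)
    qed (simp add: z_zero)
    have "\<forall>s. \<exists>f. s \<in> S \<longrightarrow> phi f = z s" using surj zc S by blast
    from choice[OF this] obtain eta where eta: "\<And>s. s \<in> S \<Longrightarrow> phi (eta s) = z s" by blast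
    define f where "f v = (\<Sum>s\<in>S. sc (v s) (eta s))" for v
    have "V.linear_map f"
      unfolding V.linear_map_def f_def
      by (auto simp: V.scale_left_distrib sum.distrib V.scale_sum_right sc_def[of _ "_ :: 'm \<Rightarrow> laurent", symmetric]
        intro!: sum.cong) (auto simp: sc_def mult.assoc)
    moreover have phi_f: "phi (f v) = z (phi v)" for v
    proof -
      have "phi (f v) = (\<Oplus>\<^bsub>M\<^esub>s\<in>S. psi (v s) \<odot>\<^bsub>M\<^esub> phi (eta s))" unfolding f_def by (rule phi_comb)
      also have "\<dots> = (\<Oplus>\<^bsub>M\<^esub>s\<in>S. z (psi (v s) \<odot>\<^bsub>M\<^esub> s))"
      proof (rule finsum_cong')
        fix s assume s: "s \<in> S"
        then show "psi (v s) \<odot>\<^bsub>M\<^esub> phi (eta s) = z (psi (v s) \<odot>\<^bsub>M\<^esub> s)"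
          using z_smult[OF psi_c, of s "v s"] S by (auto simp: eta)
      qed (use S term_c zc in auto)
      also have "\<dots> = z (phi v)" unfolding phi_def by (rule z_sum[symmetric]) (use S term_c in auto)
      finally show ?thesis .
    qed
    moreover have "f ` N0 \<subseteq> N0" by (auto simp: N0_def phi_f z_zero)
    ultimately show ?thesis by blast
  qed
  have integral: "\<exists>h\<in>half_laurents {} i s. \<forall>v. sc (1 + var_power i (- s) * h) v \<in> N0"
    if i: "i \<in> ?W" and s: "s = 1 \<or> s = - 1" for i s
  proof -
    obtain d r w where d: "d \<noteq> 0" and r: "filterlim r at_top sequentially"
      and w: "\<And>j. w j \<in> carrier (ModuleAutoGroup (laurent_ring n) M)"
      and wr: "\<And>j. w j [^]\<^bsub>ModuleAutoGroup (laurent_ring n) M\<^esub> (r j :: int)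
          = (\<lambda>x \<in> carrier M. (laurent_var i [^]\<^bsub>laurent_ring n\<^esub> (d :: int)) \<odot>\<^bsub>M\<^esub> x)"
      using bspec[OF assms(3) i] by blast
    show ?thesis
    proof (rule V.unbounded_roots_integral[OF N0 fX genX _ i s])
      show "0 < nat \<bar>d\<bar>" using d by simp
      fix R
      have "eventually (\<lambda>j. int R \<le> r j) sequentially" using r by (simp add: filterlim_at_top)
      then obtain j where j: "int R \<le> r j" by (auto simp: eventually_sequentially)
      then obtain r' where r': "r j = int r'" "R \<le> r'" by (metis nat_0_le of_nat_0_le_iff of_nat_le_iff order_trans)
      obtain z where z: "z \<in> carrier (ModuleAutoGroup (laurent_ring n) M)"
        "\<And>x. x \<in> carrier M \<Longrightarrow> (z ^^ r') x = var_power i (- s) ^ nat \<bar>d\<bar> \<odot>\<^bsub>M\<^esub> x"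
        using exists_root_of_sign[OF assms(1) i s w[of j] wr[of j, unfolded r'(1)]] by blast
      obtain f where f: "V.linear_map f" "f ` N0 \<subseteq> N0" "\<And>v. phi (f v) = z (phi v)"
        using lift[OF z(1)] by blast
      have pow: "phi ((f ^^ k) v) = (z ^^ k) (phi v)" for k v
        by (induction k) (simp_all add: f(3))
      have up: "var_power i (- s) ^ nat \<bar>d\<bar> \<in> carrier (laurent_ring n)"
        unfolding carrier_laurent_ring
        by (rule subring_closed(7)[OF subring_laurents var_power_laurents[OF i]])
      have "(f ^^ r') v - sc (var_power i (- s) ^ nat \<bar>d\<bar>) v \<in> N0" for v
        unfolding N0_def using phi_diff by (simp add: pow phi_sc z(2)[OF phi_c] psi_id[OF up])
      then show "\<exists>r\<ge>R. \<exists>z. V.linear_map z \<and> z ` N0 \<subseteq> N0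
          \<and> (\<forall>v. (z ^^ r) v - sc (var_power i (- s) ^ nat \<bar>d\<bar>) v \<in> N0)"
        using r'(2) f(1,2) by blast
    qed simp
  qed
  have one: "mult_closed {1 :: laurent}" by (simp add: mult_closed_def)
  have "\<exists>X'. finite X' \<and> V.gspan (laurents ({} \<union> ?W)) {1} N0 X \<subseteq> V.gspan (laurents {}) {1} N0 X'"
  proof (rule V.gspan_remove_variables[OF N0 one _ _ fX])
    show "{1} \<subseteq> laurents {}" using subring_closed(1)[OF subring_laurents] by blast
    fix i assume i: "i \<in> ?W"
    obtain h where h: "h \<in> half_laurents {} i 1" "\<And>v. sc (1 + var_power i (- 1) * h) v \<in> N0"
      using integral[OF i, of 1] by auto
    obtain g where g: "g \<in> half_laurents {} i (- 1)" "\<And>v. sc (1 + var_power i 1 * g) v \<in> N0"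
      using integral[OF i, of "- 1"] by auto
    obtain e b a where b: "\<forall>j\<le>e. b j \<in> laurents {}" "b 0 = 1" "b e = 1"
      "(\<Sum>j\<le>e. b j * var_power i (int j)) = a * (1 + var_power i (- 1) * h) + (1 + var_power i 1 * g)"
      using bimonic_combination[OF h(1) g(1)] by blast
    have "sc (\<Sum>j\<le>e. b j * var_power i (int j)) v \<in> N0" for v
    proof -
      have "sc a (sc (1 + var_power i (- 1) * h) v) + sc (1 + var_power i 1 * g) v \<in> N0"
        by (rule V.subspace_add[OF N0 V.subspace_scale[OF N0 h(2)] g(2)])
      moreover have "sc (a * p + q) v = sc a (sc p v) + sc q v" for p q
        by (simp add: V.scale_left_distrib)
      ultimately show ?thesis unfolding b(4) by simp
    qed
    then show "\<exists>e b. (\<forall>j\<le>e. b j \<in> laurents {}) \<and> b 0 \<in> {1} \<and> b e \<in> {1}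
        \<and> (\<forall>v. sc (\<Sum>j\<le>e. b j * var_power i (int j)) v \<in> N0)"
      using b(1-3) by blast
  qed simp
  then obtain X' where X': "finite X'"
    "V.gspan (laurents ?W) {1} N0 X \<subseteq> V.gspan (laurents {}) {1} N0 X'" by auto
  have span: "v \<in> V.gspan (laurents {}) {1} N0 X'" for v
  proof -
    have "v \<in> V.gspan (laurents ?W) {1} N0 X" using genX[of v] by (simp add: V.gspan_def)
    then show ?thesis using X'(2) by blast
  qed
  show ?thesis
  proof (rule fin_gen_over_int[OF assms(1), of "phi ` X'"])
    show "finite (phi ` X')" "phi ` X' \<subseteq> carrier M" using X'(1) phi_c by auto
    fix x assume "x \<in> carrier M"
    then obtain v where v: "phi v = x" using surj by blast
    obtain l where l: "l \<in> V.bspan (laurents {}) X'" "v - l \<in> N0"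
      using span[of v] by (auto simp: V.gspan_def)
    obtain c where c: "l = (\<Sum>y\<in>X'. sc (c y) y)" "\<forall>y\<in>X'. c y \<in> laurents {}"
      using l(1) by (auto simp: V.bspan_def)
    have "x = phi l" using phi_eq l(2) v by (auto simp: N0_def)
    also have "\<dots> = (\<Oplus>\<^bsub>M\<^esub>y\<in>X'. psi (c y) \<odot>\<^bsub>M\<^esub> phi y)"
      unfolding c(1) by (simp add: phi_sum[OF X'(1)] phi_sc)
    also have "\<dots> = (\<Oplus>\<^bsub>M\<^esub>y\<in>X'. of_int (lookup (c y) 0) \<odot>\<^bsub>M\<^esub> phi y)"
    proof (rule finsum_cong')
      fix y assume "y \<in> X'"
      then have cy: "c y \<in> laurents {}" using c(2) by blast
      then have "c y \<in> carrier (laurent_ring n)"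
        unfolding carrier_laurent_ring using laurents_mono[of "{}" ?W] by auto
      then have "psi (c y) = of_int (lookup (c y) 0)" using laurents_empty[OF cy] psi_id by metis
      then show "psi (c y) \<odot>\<^bsub>M\<^esub> phi y = of_int (lookup (c y) 0) \<odot>\<^bsub>M\<^esub> phi y" by simp
    qed (use phi_c in \<open>auto intro!: smult_closed simp: carrier_laurent_ring of_int_laurents\<close>)
    finally show "\<exists>X y k. finite X \<and> (\<forall>b\<in>X. y b \<in> phi ` X')
        \<and> x = (\<Oplus>\<^bsub>M\<^esub>b\<in>(X :: ('m \<Rightarrow> laurent) set). of_int (k b) \<odot>\<^bsub>M\<^esub> y b)"
      using X'(1) by (intro exI[of _ X'] exI[of _ phi] exI[of _ "\<lambda>y. lookup (c y) 0"]) auto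
  qed
qed

end
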